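(* Let $d\ge 1$, let $\mathbb T^d=\mathbb R^d/\mathbb Z^d$ carry Lebesgue probability measure $m$ and the Euclidean metric $\mathbf d$, and let $\mu$ be a probability measure on $G=\mathrm{Aut}(\mathbb T^d)$. Let $S_\mu$ and $G_\mu$ denote respectively the semigroup and the group generated by the support of $\mu$. Assume that there is no nontrivial $G_\mu$-invariant factor torus $\overline T$ of $\mathbb T^d$ such that the projection of $G_\mu$ on $\mathrm{Aut}(\overline T)$ is amenable. Assume moreover that the support of $\mu$ is bounded and that $\det(g-I)\neq 0$ for all $g\in S_\mu$. For $x_0\in\mathbb T^d$ put $\Delta(x)=-\log \mathbf d(x,x_0)$ and $M_n=\max_{0\le i<n}\Delta(X_i)$, where $(X_i)_{i\ge 0}$ is the random walk on $\mathbb T^d$ driven by $\mu$ with initial distribution $m$. Let $r\in\mathbb R$ and $u_n=r+\frac1d\log n$. Then for $m$-a.e. $x_0\in\mathbb T^d$, $$\lim_{n\to\infty}\mathbf P(M_n\le u_n)=e^{-V_d e^{-dr}},$$ where $V_d$ is the volume of the unit ball in $\mathbb R^d$.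
   Context: $\mathrm{Aut}(\mathbb T^d)$ is the group of linear automorphisms of $\mathbb T^d$, identified with the integer matrices of determinant $\pm1$ (a discrete group); "bounded" means bounded in a matrix norm, and $I$ is the identity matrix. The semigroup $S_\mu$ consists of all finite nonempty products of elements of $\mathrm{supp}(\mu)$. Random walk: $\mathbf P=\mu^{\otimes\mathbb N}\otimes m$ on $G^{\mathbb N}\times\mathbb T^d$, and for $(\bar g,x)$ with $\bar g=(g_1,g_2,\dots)$ one sets $X_0=x$, $X_i=g_i\cdots g_1x$ for $i\geq 1$. $\Delta(x_0)=+\infty$ by convention (an event of probability $0$). *)

theory Defs
  imports
    "HOL-Probability.Probability"
    "HOL-Algebra.Generated_Groups"
    "HOL-Algebra.Bij"
begin

section \<open>The torus\<close>

definition lattice_cong :: "real ^ 'n \<Rightarrow> real ^ 'n \<Rightarrow> bool" where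
  "lattice_cong v w \<longleftrightarrow> (\<forall>i. v $ i - w $ i \<in> \<int>)"

lemma equivp_lattice_cong: "equivp lattice_cong"
proof (intro equivpI reflpI sympI transpI)
  show "lattice_cong v v" for v :: "real ^ 'n"
    by (simp add: lattice_cong_def)
  show "lattice_cong w v" if "lattice_cong v w" for v w :: "real ^ 'n"
    using that unfolding lattice_cong_def by (metis Ints_minus minus_diff_eq)
  show "lattice_cong u w" if "lattice_cong u v" "lattice_cong v w" for u v w :: "real ^ 'n"
    unfolding lattice_cong_def
  proof
    fix i
    have "(u $ i - v $ i) + (v $ i - w $ i) \<in> \<int>"
      using that unfolding lattice_cong_def by (intro Ints_add) auto
    then show "u $ i - w $ i \<in> \<int>" by simp
  qed
qed

quotient_type (overloaded) 'n torus = "real ^ ('n::finite)" / lattice_cong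
  morphisms rep_torus to_torus
  by (rule equivp_lattice_cong)

lemma to_torus_eq_iff: "to_torus v = to_torus w \<longleftrightarrow> (\<forall>i. v $ i - w $ i \<in> \<int>)"
  by (simp add: torus.abs_eq_iff lattice_cong_def)

lemma torus_cases: obtains v where "x = to_torus v"
  by (metis Quotient3_abs_rep Quotient3_torus)

instantiation torus :: (finite) ab_group_add
begin

lift_definition zero_torus :: "'a torus" is 0 .

lift_definition plus_torus :: "'a torus \<Rightarrow> 'a torus \<Rightarrow> 'a torus" is "(+)"
  by (auto simp: lattice_cong_def add_diff_add intro!: Ints_add)

lift_definition uminus_torus :: "'a torus \<Rightarrow> 'a torus" is uminus
  unfolding lattice_cong_def
proof
  fix a b :: "real ^ 'a" and i
  assume "\<forall>i. a $ i - b $ i \<in> \<int>"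
  then have "- (a $ i - b $ i) \<in> \<int>" by (intro Ints_minus) auto
  then show "(- a) $ i - (- b) $ i \<in> \<int>" by simp
qed

lift_definition minus_torus :: "'a torus \<Rightarrow> 'a torus \<Rightarrow> 'a torus" is "(-)"
  unfolding lattice_cong_def
proof
  fix a b c e :: "real ^ 'a" and i
  assume *: "\<forall>i. a $ i - b $ i \<in> \<int>" "\<forall>i. c $ i - e $ i \<in> \<int>"
  have "(a $ i - b $ i) - (c $ i - e $ i) \<in> \<int>"
    by (rule Ints_diff[OF *[rule_format]])
  then show "(a - c) $ i - (b - e) $ i \<in> \<int>" by (simp add: algebra_simps)
qed

instance
  by standard (transfer, simp add: lattice_cong_def)+

end

lemma to_torus_add: "to_torus (v + w) = to_torus v + to_torus w"
  by (simp add: plus_torus.abs_eq)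

text \<open>The quotient of the Euclidean metric.\<close>

instantiation torus :: (finite) metric_space
begin

definition dist_torus :: "'a torus \<Rightarrow> 'a torus \<Rightarrow> real" where
  "dist_torus x y = Inf {norm (v - w) |v w. to_torus v = x \<and> to_torus w = y}"

definition uniformity_torus :: "('a torus \<times> 'a torus) filter" where
  "uniformity_torus = (INF e\<in>{0<..}. principal {(x, y). dist x y < e})"

definition open_torus :: "'a torus set \<Rightarrow> bool" where
  "open_torus U \<longleftrightarrow> (\<forall>x\<in>U. \<forall>\<^sub>F (x', y) in uniformity. x' = x \<longrightarrow> y \<in> U)"

lemma dist_torus_bdd: "bdd_below {norm (v - w) |v w. to_torus v = x \<and> to_torus w = (y::'a torus)}"
  by (intro bdd_belowI[of _ 0]) auto

lemma dist_torus_ne: "{norm (v - w) |v w. to_torus v = x \<and> to_torus w = (y::'a torus)} \<noteq> {}"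
proof -
  obtain v w where "to_torus v = x" "to_torus w = y"
    using torus_cases[of x] torus_cases[of y] by metis
  then show ?thesis by auto
qed

lemma dist_to_torus_le: "dist (to_torus v) (to_torus w :: 'a torus) \<le> norm (v - w)"
  unfolding dist_torus_def by (intro cInf_lower dist_torus_bdd) auto

lemma dist_torus_approx:
  fixes v :: "real ^ 'a"
  assumes "dist (to_torus v) y < e"
  obtains w where "y = to_torus w" "norm (v - w) < e"
proof -
  obtain a b where ab: "to_torus a = to_torus v" "to_torus b = y" "norm (a - b) < e"
    using assms cInf_lessD[OF dist_torus_ne, of "to_torus v" y e] unfolding dist_torus_def by auto
  have "to_torus (v - a + b) = to_torus b"
    using ab(1)[symmetric] by (simp add: to_torus_eq_iff)
  moreover have "norm (v - (v - a + b)) < e"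
    using ab(3) by simp
  ultimately show thesis using that[of "v - a + b"] ab(2) by simp
qed

instance
proof
  fix x y z :: "'a torus"
  show "dist x y = 0 \<longleftrightarrow> x = y"
  proof
    obtain v where v: "x = to_torus v" by (rule torus_cases)
    obtain u where u: "y = to_torus u" by (rule torus_cases)
    {
      assume "dist x y = 0"
      have "v $ i - u $ i \<in> \<int>" for i
      proof -
        have "\<exists>k\<in>\<int>. dist k (v $ i - u $ i) < e" if e: "e > 0" for e
        proof -
          obtain w where w: "y = to_torus w" "norm (v - w) < e"
            using dist_torus_approx[of v y e thesis] \<open>dist x y = 0\<close> v e by simp
          have "w $ i - u $ i \<in> \<int>" using w(1) u to_torus_eq_iff by metis
          moreover have "dist (w $ i - u $ i) (v $ i - u $ i) < e"
            using component_le_norm_cart[of "v - w" i] w(2) by (simp add: dist_real_def)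
          ultimately show ?thesis by blast
        qed
        then have "v $ i - u $ i \<in> closure \<int>" unfolding closure_approachable by blast
        then show ?thesis by (simp add: closed_Ints)
      qed
      then show "x = y" by (simp add: u v to_torus_eq_iff)
    }
    assume "x = y"
    have "dist x x \<ge> 0"
      unfolding dist_torus_def by (rule cInf_greatest[OF dist_torus_ne]) auto
    moreover have "dist x x \<le> 0" using dist_to_torus_le[of v v] v by simp
    ultimately show "dist x y = 0" using \<open>x = y\<close> by simp
  qed
  have sym: "dist a b \<le> dist b a" for a b :: "'a torus"
  proof -
    have "{norm (v - w) |v w. to_torus v = a \<and> to_torus w = b}
        = {norm (v - w) |v w. to_torus v = b \<and> to_torus w = a}"
      by (auto, (metis norm_minus_commute)+)
    then show ?thesis by (simp add: dist_torus_def)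
  qed
  show "dist x y \<le> dist x z + dist y z"
  proof (rule field_le_epsilon)
    fix e :: real assume "e > 0"
    obtain v where v: "z = to_torus v" by (rule torus_cases)
    obtain a where a: "x = to_torus a" "norm (v - a) < dist z x + e / 2"
      using dist_torus_approx[of v x "dist z x + e / 2" thesis] v \<open>e > 0\<close> by simp
    obtain b where b: "y = to_torus b" "norm (v - b) < dist z y + e / 2"
      using dist_torus_approx[of v y "dist z y + e / 2" thesis] v \<open>e > 0\<close> by simp
    have "dist x y \<le> norm (a - b)" using a b dist_to_torus_le by simp
    also have "\<dots> \<le> norm (v - a) + norm (v - b)"
      using norm_triangle_ineq4[of "v - b" "v - a"] by (simp add: add.commute)
    finally show "dist x y \<le> dist x z + dist y z + e"
      using a b sym[of z x] sym[of z y] by simp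
  qed
qed (simp_all add: uniformity_torus_def open_torus_def)

end

lemma continuous_to_torus: "continuous_on S to_torus"
  unfolding continuous_on_iff
proof (intro ballI allI impI)
  fix v and e :: real assume "e > 0"
  then show "\<exists>\<delta>>0. \<forall>w\<in>S. dist w v < \<delta> \<longrightarrow> dist (to_torus w) (to_torus v) < e"
    using dist_to_torus_le by (intro exI[of _ e]) (auto simp: dist_norm intro: le_less_trans)
qed

lemma measurable_to_torus [measurable]: "to_torus \<in> borel_measurable borel"
  by (intro borel_measurable_continuous_onI continuous_to_torus)

definition torus_measure :: "'n::finite torus measure" where
  "torus_measure =
     distr (restrict_space lborel {v. \<forall>i. 0 \<le> v $ i \<and> v $ i < 1}) borel to_torus"

lemma prob_space_torus_measure: "prob_space torus_measure"
proof -
  let ?Q = "{v :: real ^ 'a. \<forall>i. 0 \<le> v $ i \<and> v $ i < 1}"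
  have Q: "?Q \<in> sets lborel" by simp
  have "emeasure lborel ?Q = 1"
  proof (rule antisym)
    have "?Q \<subseteq> cbox 0 1" by (auto simp: mem_box_cart less_imp_le)
    then have "emeasure lborel ?Q \<le> emeasure lborel (cbox (0::real^'a) 1)"
      by (intro emeasure_mono) auto
    also have "\<dots> = 1"
      by (subst emeasure_lborel_cbox) (auto simp: Basis_vec_def inner_axis prod.neutral)
    finally show "emeasure lborel ?Q \<le> 1" .
    have "box 0 1 \<subseteq> ?Q" by (auto simp: mem_box_cart less_imp_le)
    then have "emeasure lborel (box (0::real^'a) 1) \<le> emeasure lborel ?Q"
      using Q by (intro emeasure_mono) auto
    moreover have "emeasure lborel (box (0::real^'a) 1) = 1"
      by (subst emeasure_lborel_box) (auto simp: Basis_vec_def inner_axis prod.neutral)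
    ultimately show "1 \<le> emeasure lborel ?Q" by simp
  qed
  then have "prob_space (restrict_space lborel ?Q)"
    using Q by (intro prob_spaceI) (simp add: space_restrict_space emeasure_restrict_space)
  then show ?thesis unfolding torus_measure_def
    by (rule prob_space.prob_space_distr) (intro measurable_restrict_space1, simp)
qed

text \<open>The additive group of the torus as a structure, to have its subgroups, its quotients
  and their automorphism groups available.\<close>

definition torus_group :: "'n::finite torus monoid" where
  "torus_group = \<lparr>carrier = UNIV, mult = (+), one = 0\<rparr>"

lemma comm_group_torus_group: "comm_group torus_group"
proof (rule comm_groupI)
  fix x :: "'a torus"
  show "\<exists>y\<in>carrier torus_group. y \<otimes>\<^bsub>torus_group\<^esub> x = \<one>\<^bsub>torus_group\<^esub>"
    by (rule bexI[of _ "- x"]) (simp_all add: torus_group_def)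
qed (simp_all add: torus_group_def algebra_simps)


section \<open>Linear automorphisms\<close>

definition GLZ :: "(int ^ 'n ^ 'n) monoid" where
  "GLZ = \<lparr>carrier = {A. det A = 1 \<or> det A = - 1}, mult = (**), one = mat 1\<rparr>"

abbreviation real_matrix :: "int ^ 'm ^ 'n \<Rightarrow> real ^ 'm ^ 'n" where
  "real_matrix \<equiv> map_matrix real_of_int"

lemma real_matrix_mult: "real_matrix (A ** B) = real_matrix A ** real_matrix B"
  by (simp add: vec_eq_iff matrix_matrix_mult_def)

lemma real_matrix_inject: "real_matrix A = real_matrix B \<longleftrightarrow> A = B"
  by (simp add: vec_eq_iff)

lemma real_matrix_one: "real_matrix (mat 1) = mat 1"
  by (simp add: vec_eq_iff mat_def)

lemma det_real_matrix: "det (real_matrix A) = real_of_int (det A)"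
  by (simp add: det_def)

lemma GLZ_inverse:
  fixes A :: "int ^ 'n ^ 'n"
  assumes "det A = 1 \<or> det A = - 1"
  shows "\<exists>B. (det B = 1 \<or> det B = - 1) \<and> B ** A = mat 1"
proof -
  have dd: "real_of_int (det A) \<noteq> 0" "1 / real_of_int (det A) = real_of_int (det A)"
    using assms by auto
  define B where "B = (\<chi> j k. det (\<chi> i l. if l = j then axis k 1 $ i else A $ i $ l) * det A)"
  have "real_matrix A *v (\<chi> j. real_of_int (B $ j $ k)) = axis k 1" for k
  proof -
    have "(\<chi> j. real_of_int (B $ j $ k)) =
      (\<chi> j. det (\<chi> i l. if l = j then axis k 1 $ i else real_matrix A $ i $ l) / det (real_matrix A))"
    proof (subst vec_eq_iff, intro allI)
      fix j
      have "(\<chi> i l. if l = j then axis k 1 $ i else real_matrix A $ i $ l) =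
        real_matrix (\<chi> i l. if l = j then axis k 1 $ i else A $ i $ l)"
        by (simp add: vec_eq_iff axis_def)
      then show "(\<chi> j. real_of_int (B $ j $ k)) $ j = (\<chi> j. det (\<chi> i l. if l = j then axis k 1 $ i else real_matrix A $ i $ l) / det (real_matrix A)) $ j"
        using dd assms by (auto simp: B_def det_real_matrix)
    qed
    then show ?thesis using cramer[of "real_matrix A"] dd by (simp add: det_real_matrix)
  qed
  then have "real_matrix A ** real_matrix B = mat 1"
    by (simp add: vec_eq_iff matrix_vector_mult_def matrix_matrix_mult_def mat_def axis_def)
  then have "real_matrix B ** real_matrix A = mat 1" by (simp add: matrix_left_right_inverse)
  then have BA: "B ** A = mat 1"
    by (metis real_matrix_inject real_matrix_mult real_matrix_one)
  then have "det B * det A = 1" by (metis det_I det_mul)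
  then show ?thesis using BA by (metis zmult_eq_1_iff)
qed

lemma group_GLZ: "group GLZ"
proof (rule groupI)
  fix A assume "A \<in> carrier GLZ"
  then show "\<exists>B\<in>carrier GLZ. B \<otimes>\<^bsub>GLZ\<^esub> A = \<one>\<^bsub>GLZ\<^esub>"
    using GLZ_inverse[of A] by (auto simp: GLZ_def)
qed (auto simp: GLZ_def det_mul matrix_mul_assoc)

lift_definition torus_act :: "int ^ 'n ^ 'n \<Rightarrow> 'n::finite torus \<Rightarrow> 'n torus"
  is "\<lambda>A v. real_matrix A *v v"
  unfolding lattice_cong_def
proof
  fix A :: "int ^ 'n ^ 'n" and v w :: "real ^ 'n" and i
  assume *: "\<forall>i. v $ i - w $ i \<in> \<int>"
  have "(real_matrix A *v v) $ i - (real_matrix A *v w) $ i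
      = (\<Sum>j\<in>UNIV. real_of_int (A $ i $ j) * (v $ j - w $ j))"
    by (simp add: matrix_vector_mult_def sum_subtractf right_diff_distrib)
  also have "\<dots> \<in> \<int>" using * by (intro Ints_sum Ints_mult) auto
  finally show "(real_matrix A *v v) $ i - (real_matrix A *v w) $ i \<in> \<int>" .
qed

lemma torus_act_mult: "torus_act (A ** B) x = torus_act A (torus_act B x)"
  by (transfer, simp add: real_matrix_mult matrix_vector_mul_assoc lattice_cong_def)

lemma torus_act_one: "torus_act (mat 1) x = x"
  by (transfer, simp add: real_matrix_one lattice_cong_def)

lemma torus_act_add: "torus_act A (x + y) = torus_act A x + torus_act A y"
  by (transfer, simp add: matrix_vector_right_distrib lattice_cong_def)

inductive_set semigroup_generated :: "(int ^ 'n ^ 'n) set \<Rightarrow> (int ^ 'n ^ 'n) set"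
  for S where
    base: "g \<in> S \<Longrightarrow> g \<in> semigroup_generated S"
  | mult: "g \<in> semigroup_generated S \<Longrightarrow> h \<in> semigroup_generated S
      \<Longrightarrow> g ** h \<in> semigroup_generated S"


section \<open>Amenability and invariant factor tori\<close>

text \<open>Amenability of a discrete group: existence of a left invariant, finitely additive
  probability on all subsets of the group.\<close>

definition amenable :: "('a, 'b) monoid_scheme \<Rightarrow> bool" where
  "amenable G \<longleftrightarrow> (\<exists>\<nu> :: 'a set \<Rightarrow> real.
     (\<forall>A. A \<subseteq> carrier G \<longrightarrow> 0 \<le> \<nu> A) \<and>
     \<nu> (carrier G) = 1 \<and>
     (\<forall>A B. A \<subseteq> carrier G \<longrightarrow> B \<subseteq> carrier G \<longrightarrow> A \<inter> B = {} \<longrightarrow> \<nu> (A \<union> B) = \<nu> A + \<nu> B) \<and>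
     (\<forall>g\<in>carrier G. \<forall>A. A \<subseteq> carrier G \<longrightarrow> \<nu> (g <#\<^bsub>G\<^esub> A) = \<nu> A))"

text \<open>The factor tori of the torus are its quotients by closed subgroups \<open>H\<close> (such a quotient is
  again a torus); the quotient is nontrivial when \<open>H\<close> is a proper subgroup, so the torus itself
  counts as a nontrivial factor. It is invariant when \<open>H\<close> is, and each automorphism in question
  then permutes the cosets of \<open>H\<close>, the elements of the factor.\<close>

definition invariant_factor_kernel ::
  "(int ^ 'n ^ 'n) set \<Rightarrow> 'n::finite torus set \<Rightarrow> bool" where
  "invariant_factor_kernel \<Gamma> H \<longleftrightarrow>
     closed H \<and> subgroup H torus_group \<and> (\<forall>g\<in>\<Gamma>. torus_act g ` H = H)"

definition factor_aut ::
  "'n torus set \<Rightarrow> int ^ 'n ^ 'n \<Rightarrow> 'n::finite torus set \<Rightarrow> 'n torus set" where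
  "factor_aut H g = (\<lambda>C \<in> carrier (torus_group Mod H). torus_act g ` C)"

definition factor_projection ::
  "(int ^ 'n ^ 'n) set \<Rightarrow> 'n::finite torus set \<Rightarrow> ('n torus set \<Rightarrow> 'n torus set) monoid" where
  "factor_projection \<Gamma> H = (AutoGroup (torus_group Mod H))\<lparr>carrier := factor_aut H ` \<Gamma>\<rparr>"

lemma subgroup_factor_projection:
  fixes H :: "'n::finite torus set"
  assumes \<Gamma>: "subgroup \<Gamma> GLZ" and H: "invariant_factor_kernel \<Gamma> H"
  shows "subgroup (factor_aut H ` \<Gamma>) (AutoGroup (torus_group Mod H))"
proof -
  interpret T: comm_group "torus_group :: 'n torus monoid" by (rule comm_group_torus_group)
  have sH: "subgroup H torus_group" and inv: "\<And>g. g \<in> \<Gamma> \<Longrightarrow> torus_act g ` H = H"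
    using H by (auto simp: invariant_factor_kernel_def)
  have nH: "H \<lhd> torus_group" using sH by (rule T.subgroup_imp_normal)
  interpret N: normal H torus_group by (rule nH)
  let ?Q = "torus_group Mod H"
  interpret Q: group ?Q by (rule N.factorgroup_is_group)
  have car: "carrier ?Q = range (\<lambda>a. (\<lambda>h. h + a) ` H)"
    by (auto simp: FactGroup_def RCOSETS_def r_coset_def torus_group_def)
  have act_coset: "torus_act g ` ((\<lambda>h. h + a) ` H) = (\<lambda>h. h + torus_act g a) ` H"
    if "g \<in> \<Gamma>" for g a
  proof -
    have "torus_act g ` ((\<lambda>h. h + a) ` H) = (\<lambda>h. h + torus_act g a) ` (torus_act g ` H)"
      by (auto simp: image_image torus_act_add)
    then show ?thesis using inv[OF that] by simp
  qed
  have cl: "torus_act g ` C \<in> carrier ?Q" if "g \<in> \<Gamma>" "C \<in> carrier ?Q" for g C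
    using that act_coset by (auto simp: car)
  have sub: "\<Gamma> \<subseteq> carrier GLZ" using \<Gamma> by (rule subgroup.subset)
  have comp: "compose (carrier ?Q) (factor_aut H g) (factor_aut H h) = factor_aut H (g ** h)"
    if "g \<in> \<Gamma>" "h \<in> \<Gamma>" for g h
    unfolding compose_def factor_aut_def using cl that
    by (auto simp: fun_eq_iff restrict_def torus_act_mult image_image)
  have one: "factor_aut H (mat 1) = (\<lambda>C\<in>carrier ?Q. C)"
    by (simp add: factor_aut_def torus_act_one restrict_def)
  have oneG: "mat 1 \<in> \<Gamma>" using subgroup.one_closed[OF \<Gamma>] by (simp add: GLZ_def)
  have multG: "g ** h \<in> \<Gamma>" if "g \<in> \<Gamma>" "h \<in> \<Gamma>" for g h
    using subgroup.m_closed[OF \<Gamma> that] by (simp add: GLZ_def)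
  have invG: "\<exists>h\<in>\<Gamma>. h ** g = mat 1 \<and> g ** h = mat 1" if "g \<in> \<Gamma>" for g
    using subgroup.m_inv_closed[OF \<Gamma> that] group.l_inv[OF group_GLZ, of g] group.r_inv[OF group_GLZ, of g]
      sub that by (intro bexI[of _ "inv\<^bsub>GLZ\<^esub> g"]) (auto simp: GLZ_def)
  have bij: "bij_betw (factor_aut H g) (carrier ?Q) (carrier ?Q)" if g: "g \<in> \<Gamma>" for g
  proof -
    obtain h where h: "h \<in> \<Gamma>" "h ** g = mat 1" "g ** h = mat 1" using invG[OF g] by blast
    show ?thesis
      by (rule bij_betw_byWitness[of _ "factor_aut H h"])
        (auto simp: factor_aut_def cl g h image_image torus_act_mult[symmetric] torus_act_one)
  qed
  have Bij: "factor_aut H g \<in> Bij (carrier ?Q)" if "g \<in> \<Gamma>" for g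
    using bij[OF that] by (simp add: Bij_def factor_aut_def)
  have setmult: "torus_act g ` (C <#>\<^bsub>torus_group\<^esub> D) = torus_act g ` C <#>\<^bsub>torus_group\<^esub> torus_act g ` D"
    for g C D
    by (simp add: set_mult_def torus_group_def torus_act_add image_UN)
  have hom: "factor_aut H g \<in> hom ?Q ?Q" if "g \<in> \<Gamma>" for g
  proof (rule homI)
    fix C D assume CD: "C \<in> carrier ?Q" "D \<in> carrier ?Q"
    then have "C \<otimes>\<^bsub>?Q\<^esub> D \<in> carrier ?Q" by (rule Q.m_closed)
    then show "factor_aut H g (C \<otimes>\<^bsub>?Q\<^esub> D) = factor_aut H g C \<otimes>\<^bsub>?Q\<^esub> factor_aut H g D"
      using CD by (simp add: factor_aut_def FactGroup_def setmult)
  qed (use cl that in \<open>auto simp: factor_aut_def\<close>)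
  have mult: "\<phi> \<otimes>\<^bsub>AutoGroup ?Q\<^esub> \<psi> = compose (carrier ?Q) \<phi> \<psi>"
    if "\<phi> \<in> Bij (carrier ?Q)" "\<psi> \<in> Bij (carrier ?Q)" for \<phi> \<psi>
    using that by (simp add: AutoGroup_def BijGroup_def)
  have one': "\<one>\<^bsub>AutoGroup ?Q\<^esub> = factor_aut H (mat 1)"
    by (simp add: AutoGroup_def BijGroup_def one)
  have carA: "factor_aut H g \<in> carrier (AutoGroup ?Q)" if "g \<in> \<Gamma>" for g
    using hom[OF that] Bij[OF that] by (simp add: AutoGroup_def auto_def)
  have grp: "group (AutoGroup ?Q)" by (rule Q.AutoGroup)
  show ?thesis
  proof (rule group.subgroupI[OF grp])
    show "factor_aut H ` \<Gamma> \<subseteq> carrier (AutoGroup ?Q)" using carA by auto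
    show "factor_aut H ` \<Gamma> \<noteq> {}" using oneG by auto
    fix \<phi> assume "\<phi> \<in> factor_aut H ` \<Gamma>"
    then obtain g where g: "g \<in> \<Gamma>" "\<phi> = factor_aut H g" by auto
    obtain h where h: "h \<in> \<Gamma>" "h ** g = mat 1" using invG[OF g(1)] by blast
    have "factor_aut H h \<otimes>\<^bsub>AutoGroup ?Q\<^esub> \<phi> = \<one>\<^bsub>AutoGroup ?Q\<^esub>"
      using g h by (simp add: mult Bij comp one')
    then have "inv\<^bsub>AutoGroup ?Q\<^esub> \<phi> = factor_aut H h"
      using group.inv_equality[OF grp] carA g h by blast
    then show "inv\<^bsub>AutoGroup ?Q\<^esub> \<phi> \<in> factor_aut H ` \<Gamma>" using h by auto
    fix \<psi> assume "\<psi> \<in> factor_aut H ` \<Gamma>"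
    then show "\<phi> \<otimes>\<^bsub>AutoGroup ?Q\<^esub> \<psi> \<in> factor_aut H ` \<Gamma>"
      using g multG by (auto simp: mult Bij comp)
  qed
qed

lemma group_factor_projection:
  assumes "set_pmf \<mu> \<subseteq> carrier GLZ" "invariant_factor_kernel (generate GLZ (set_pmf \<mu>)) H"
  shows "group (factor_projection (generate GLZ (set_pmf \<mu>)) H)"
  unfolding factor_projection_def
  by (intro subgroup.subgroup_is_group subgroup_factor_projection group.generate_is_subgroup group_GLZ assms
      group.AutoGroup normal.factorgroup_is_group)
   (use assms(2) comm_group.normal_iff_subgroup[OF comm_group_torus_group] in \<open>auto simp: invariant_factor_kernel_def\<close>)


section \<open>The random walk\<close>

text \<open>The factor \<open>g\<^sub>i\<close> of the informal notation is \<open>\<omega> (i - 1)\<close>: sequences start at index \<open>0\<close>.\<close>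

definition walk_measure ::
  "(int ^ 'n ^ 'n) pmf \<Rightarrow> ((nat \<Rightarrow> int ^ 'n ^ 'n) \<times> 'n::finite torus) measure" where
  "walk_measure \<mu> = (\<Pi>\<^sub>M i\<in>UNIV. measure_pmf \<mu>) \<Otimes>\<^sub>M torus_measure"

fun walk :: "nat \<Rightarrow> (nat \<Rightarrow> int ^ 'n ^ 'n) \<times> 'n::finite torus \<Rightarrow> 'n torus" where
  "walk 0 (\<omega>, x) = x"
| "walk (Suc i) (\<omega>, x) = torus_act (\<omega> i) (walk i (\<omega>, x))"

definition neg_log_dist :: "'n::finite torus \<Rightarrow> 'n torus \<Rightarrow> ereal" where
  "neg_log_dist x\<^sub>0 x = (if x = x\<^sub>0 then \<infinity> else ereal (- ln (dist x x\<^sub>0)))"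

text \<open>Only meaningful for \<open>n \<ge> 1\<close>.\<close>

definition walk_max ::
  "'n torus \<Rightarrow> nat \<Rightarrow> (nat \<Rightarrow> int ^ 'n ^ 'n) \<times> 'n::finite torus \<Rightarrow> ereal" where
  "walk_max x\<^sub>0 n \<omega> = (MAX i\<in>{..<n}. neg_log_dist x\<^sub>0 (walk i \<omega>))"

end

theory Submission
  imports Defs "HOL-Real_Asymp.Real_Asymp"
begin

text \<open>
  The bounded support is finite. The walk acts on the Fourier coefficients by averaging over the
  transposed matrices on the nonzero lattice points. If this averaging has no spectral gap on
  \<open>\<ell>\<^sup>2\<close>, its almost invariant vectors cluster at a mean on the nonzero lattice points that is
  invariant under the generated group. Take a linear subspace of minimal dimension with positive
  mean and let \<open>U\<close> be the span of its translates. Independent points drawn from the mean span \<open>U\<close>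
  with positive probability; since an element fixing a spanning tuple acts trivially on \<open>U\<close>, the
  conditional law of such tuples yields an invariant mean on the action on \<open>U\<close>, that is, a nontrivial
  factor torus with amenable action. So the hypothesis gives a spectral gap, and correlations on the
  torus decay exponentially.

  Let \<open>B\<close> be the ball of measure \<open>\<tau> / n\<close> and let \<open>a\<^sub>k\<close> be the probability of no visit to \<open>B\<close> before
  time \<open>k\<close>. By stationarity \<open>a\<^sub>k - a\<^sub>k\<^sub>+\<^sub>1\<close> is the probability of starting in \<open>B\<close> and
  then avoiding it up to time \<open>k\<close>. This is \<open>\<tau> a\<^sub>k / n\<close> up to \<open>o(1/n)\<close>, by decay of correlations for
  long times, while returns after a fixed time are eventually impossible because almost every centre
  is moved by every element of the semigroup. Hence \<open>a\<^sub>n\<close> is close to \<open>(1 - \<tau> / n)\<^sup>n\<close>.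
\<close>

section \<open>Haar measure and characters of the torus\<close>

text \<open>The averaging operator need not be self-adjoint or even normal, so the gap is obtained
  as contraction by some fixed power and then extended to all times. It is sought on the
  frequencies, a countable set permuted by the transposed matrices, where failure of the gap leaves
  a finitely additive mean to which linear algebra applies. Such a mean says little about the group
  by itself, because stabilisers of lattice points can be large; spanning tuples remove the
  stabilisers, and minimal dimension prevents independent draws from being trapped in a proper
  subspace. On the probabilistic side the one-step error is incurred \<open>n\<close> times, so it
  must be o(1/n). Decay of correlations bounds the mass returning at time \<open>i\<close> by m(B)^2
  + K kappa^i m(B), whose second term is of order 1/n for fixed \<open>i\<close>. Decay therefore
  handles only return times beyond a large fixed \<open>I\<close>, with total cost of order kappa^I
  after \<open>n\<close> steps. The first \<open>I\<close> return times are excluded by the absence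
  of fixed points, and \<open>I\<close> tends to infinity only after \<open>n\<close>.\<close>

abbreviation unit_cube :: "(real ^ 'n) set" where
  "unit_cube \<equiv> {v. \<forall>i. 0 \<le> v $ i \<and> v $ i < 1}"

text \<open>The cell of the integer grid containing a point: its fibres are the lattice translates
  of the unit cube, and a lattice shift adds to the label.\<close>

definition floor_vec :: "real ^ 'n \<Rightarrow> int ^ 'n" where
  "floor_vec v = (\<chi> i. \<lfloor>v $ i\<rfloor>)"

definition of_int_vec :: "int ^ 'n \<Rightarrow> real ^ 'n" where
  "of_int_vec z = (\<chi> i. of_int (z $ i))"

lemma of_int_vec_nth [simp]: "of_int_vec z $ i = of_int (z $ i)"
  by (simp add: of_int_vec_def)

lemma floor_vec_eq_0_iff: "floor_vec v = 0 \<longleftrightarrow> v \<in> unit_cube"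
  by (simp add: floor_vec_def vec_eq_iff floor_eq_iff)

lemma floor_vec_add: "floor_vec (v + of_int_vec z) = floor_vec v + z"
  by (simp add: floor_vec_def vec_eq_iff)

lemma to_torus_add_of_int_vec [simp]: "to_torus (v + of_int_vec z) = to_torus v"
  by (simp add: to_torus_eq_iff)

lemma measurable_floor_vec [measurable]: "Measurable.pred borel (\<lambda>v. floor_vec (v + c) = z)"
  unfolding floor_vec_def vec_eq_iff by simp

lemma sets_torus_measure [measurable_cong]: "sets torus_measure = sets borel"
  by (simp add: torus_measure_def)

lemma space_torus_measure [simp]: "space torus_measure = UNIV"
  by (simp add: torus_measure_def)

interpretation torus: prob_space "torus_measure :: 'n::finite torus measure"
  by (rule prob_space_torus_measure)

lemma measure_torus_UNIV [simp]: "measure torus_measure (UNIV :: 'n::finite torus set) = 1"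
  using torus.prob_space[where 'n = 'n] by simp

abbreviation torus_integral ::
    "('n::finite torus \<Rightarrow> 'b::{banach,second_countable_topology}) \<Rightarrow> 'b"
    (binder "\<integral>\<^sub>T" 10) where
  "torus_integral f \<equiv> integral\<^sup>L torus_measure f"

lemma emeasure_torus_measure:
  fixes A :: "'n::finite torus set"
  assumes "A \<in> sets borel"
  shows "emeasure torus_measure A = emeasure lborel {v. to_torus v \<in> A \<and> v \<in> unit_cube}"
proof -
  have Q: "unit_cube \<in> sets (lborel :: (real^'n) measure)" by simp
  have "emeasure torus_measure A
      = emeasure (restrict_space lborel unit_cube) (to_torus -` A \<inter> space (restrict_space lborel unit_cube))"
    unfolding torus_measure_def using assms
    by (intro emeasure_distr measurable_restrict_space1) simp_all
  also have "\<dots> = emeasure lborel (to_torus -` A \<inter> space (restrict_space lborel unit_cube))"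
    using Q by (intro emeasure_restrict_space) (auto simp: space_restrict_space)
  also have "to_torus -` A \<inter> space (restrict_space lborel unit_cube) = {v. to_torus v \<in> A \<and> v \<in> unit_cube}"
    by (auto simp: space_restrict_space)
  finally show ?thesis .
qed

section \<open>Translation invariance and the measure of balls\<close>

lemma emeasure_lborel_shift:
  fixes A :: "'a::euclidean_space set"
  assumes "A \<in> sets borel"
  shows "emeasure lborel {v. v + c \<in> A} = emeasure lborel A"
proof -
  have "emeasure lborel A = emeasure (distr lborel borel ((+) c)) A"
    by (simp add: lborel_distr_plus)
  also have "\<dots> = emeasure lborel {v. v + c \<in> A}"
    using assms by (subst emeasure_distr) (auto simp: vimage_def add.commute)
  finally show ?thesis ..
qed

text \<open>Cut the translated cube along the integer grid and move the pieces back to the unit cube.\<close>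

lemma emeasure_periodic_shifted_cube:
  fixes A :: "(real ^ 'n) set"
  assumes A [measurable]: "A \<in> sets borel" and per: "\<And>v z. v + of_int_vec z \<in> A \<longleftrightarrow> v \<in> A"
  shows "emeasure lborel {v \<in> A. floor_vec (v + s) = 0} = emeasure lborel {v \<in> A. floor_vec v = 0}"
proof -
  have fm [measurable]: "Measurable.pred borel (\<lambda>v::real^'n. floor_vec v = z)" for z
    using measurable_floor_vec[of 0 z] by simp
  have "emeasure lborel {v \<in> A. floor_vec (v + s) = 0} =
      emeasure lborel (\<Union>z. {v \<in> A. floor_vec (v + s) = 0 \<and> floor_vec v = z})"
    by (rule arg_cong[where f = "emeasure lborel"]) auto
  also have "\<dots> = (\<integral>\<^sup>+z. emeasure lborel {v \<in> A. floor_vec (v + s) = 0 \<and> floor_vec v = z} \<partial>count_space UNIV)"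
    by (rule emeasure_UN_countable) (auto simp: disjoint_family_on_def)
  also have "\<dots> = (\<integral>\<^sup>+z. emeasure lborel {v \<in> A. floor_vec (v + s) = - z \<and> floor_vec v = 0} \<partial>count_space UNIV)"
  proof (rule nn_integral_cong)
    fix z :: "int ^ 'n"
    have *: "floor_vec (v + of_int_vec z + s) = floor_vec (v + s) + z" for v
      using floor_vec_add[of "v + s" z] by (simp add: algebra_simps)
    have "emeasure lborel {v \<in> A. floor_vec (v + s) = 0 \<and> floor_vec v = z}
       = emeasure lborel {v. v + of_int_vec z \<in> {v \<in> A. floor_vec (v + s) = 0 \<and> floor_vec v = z}}"
      by (rule emeasure_lborel_shift[symmetric]) measurable
    also have "{v. v + of_int_vec z \<in> {v \<in> A. floor_vec (v + s) = 0 \<and> floor_vec v = z}}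
       = {v \<in> A. floor_vec (v + s) = - z \<and> floor_vec v = 0}"
      by (auto simp: per * floor_vec_add eq_neg_iff_add_eq_0)
    finally show "emeasure lborel {v \<in> A. floor_vec (v + s) = 0 \<and> floor_vec v = z}
       = emeasure lborel {v \<in> A. floor_vec (v + s) = - z \<and> floor_vec v = 0}" .
  qed
  also have "\<dots> = emeasure lborel (\<Union>z. {v \<in> A. floor_vec (v + s) = - z \<and> floor_vec v = 0})"
    by (rule emeasure_UN_countable[symmetric]) (auto simp: disjoint_family_on_def)
  also have "(\<Union>z. {v \<in> A. floor_vec (v + s) = - z \<and> floor_vec v = 0}) = {v \<in> A. floor_vec v = 0}"
    by (auto intro: minus_minus[symmetric])
  finally show ?thesis .
qed

text \<open>Translating near-optimal lifts of both points by a lift of \<open>a\<close> keeps their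
  distance. A second application with \<open>- a\<close> gives an isometry.\<close>

lemma dist_torus_plus_le: "dist (a + x) (a + y) \<le> dist x (y :: 'n::finite torus)"
proof (rule field_le_epsilon)
  obtain s where s: "a = to_torus s" by (rule torus_cases)
  fix e :: real assume "e > 0"
  obtain v where v: "x = to_torus v" by (rule torus_cases)
  obtain w where w: "y = to_torus w" "norm (v - w) < dist x y + e"
    using dist_torus_approx[of v y "dist x y + e" thesis] v \<open>e > 0\<close> by auto
  have "dist (a + x) (a + y) \<le> norm ((s + v) - (s + w))"
    unfolding s v w to_torus_add[symmetric] by (rule dist_to_torus_le)
  then show "dist (a + x) (a + y) \<le> dist x y + e" using w by simp
qed

lemma measurable_torus_plus [measurable]: "(\<lambda>x. a + x) \<in> borel_measurable (borel :: 'n::finite torus measure)"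
proof (intro borel_measurable_continuous_onI)
  show "continuous_on UNIV (\<lambda>x. a + x)"
    unfolding continuous_on_iff using dist_torus_plus_le[of a] by (meson le_less_trans)
qed

text \<open>On lifts, translation by \<open>s\<close> replaces the unit cube by a shifted cube, and
  a lattice-periodic set has the same measure in both.\<close>

lemma torus_measure_translate:
  fixes a :: "'n::finite torus"
  shows "distr torus_measure borel (\<lambda>x. a + x) = torus_measure"
proof (rule measure_eqI)
  fix A :: "'n torus set" assume "A \<in> sets (distr torus_measure borel (\<lambda>x. a + x))"
  then have A [measurable]: "A \<in> sets borel" by simp
  obtain s where s: "a = to_torus s" by (rule torus_cases)
  let ?A = "{v. to_torus v \<in> A}"
  have A' [measurable]: "?A \<in> sets borel"
    using measurable_sets[OF measurable_to_torus A] by (simp add: vimage_def)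
  have mA: "{x. a + x \<in> A} \<in> sets borel"
    using measurable_sets[OF measurable_torus_plus A] by (simp add: vimage_def)
  have fm [measurable]: "Measurable.pred borel (\<lambda>v::real^'n. floor_vec v = z)" for z
    using measurable_floor_vec[of 0 z] by simp
  have "emeasure (distr torus_measure borel (\<lambda>x. a + x)) A = emeasure torus_measure {x. a + x \<in> A}"
    by (subst emeasure_distr) (auto simp: vimage_def)
  also have "\<dots> = emeasure lborel {v. to_torus (s + v) \<in> A \<and> v \<in> unit_cube}"
    by (subst emeasure_torus_measure[OF mA]) (simp add: s to_torus_add)
  also have "\<dots> = emeasure lborel {v. v + s \<in> {v. to_torus v \<in> A \<and> floor_vec (v + - s) = 0}}"
    by (rule arg_cong[where f = "emeasure lborel"]) (auto simp: floor_vec_eq_0_iff add.commute)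
  also have "\<dots> = emeasure lborel {v. to_torus v \<in> A \<and> floor_vec (v + - s) = 0}"
    by (rule emeasure_lborel_shift) measurable
  also have "\<dots> = emeasure lborel {v \<in> ?A. floor_vec (v + - s) = 0}"
    by simp
  also have "\<dots> = emeasure lborel {v \<in> ?A. floor_vec v = 0}"
    by (rule emeasure_periodic_shifted_cube) auto
  also have "\<dots> = emeasure torus_measure A"
    by (subst emeasure_torus_measure[OF A]) (simp add: floor_vec_eq_0_iff)
  finally show "emeasure (distr torus_measure borel (\<lambda>x. a + x)) A = emeasure torus_measure A" .
qed (simp add: sets_torus_measure)

text \<open>By translation the centre may be the midpoint of the unit cube. A ball of radius at most
  1/2 around it stays inside the cube and lifts there to a single Euclidean ball.\<close>

lemma measure_torus_ball:
  fixes x :: "'n::finite torus"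
  assumes "0 \<le> \<rho>" "\<rho> \<le> 1 / 2"
  shows "measure torus_measure {y. dist y x < \<rho>} = measure lborel (ball (0 :: real ^ 'n) 1) * \<rho> ^ CARD('n)"
proof -
  define c :: "real ^ 'n" where "c = (\<chi> i. 1 / 2)"
  define a where "a = x - to_torus c"
  have ball_c: "{y. dist (a + y) x < \<rho>} = {y. dist y (to_torus c) < \<rho>}"
  proof -
    have "dist (a + y) (a + to_torus c) = dist y (to_torus c)" for y
      using dist_torus_plus_le[of a y "to_torus c"] dist_torus_plus_le[of "- a" "a + y" "a + to_torus c"] by simp
    then show ?thesis by (simp add: a_def)
  qed
  have B [measurable]: "{y. dist y z < \<rho>} \<in> sets borel" for z :: "'n torus"
    by (intro borel_open) (auto intro!: open_Collect_less continuous_intros)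
  have "emeasure torus_measure {y. dist y x < \<rho>} = emeasure (distr torus_measure borel (\<lambda>y. a + y)) {y. dist y x < \<rho>}"
    by (simp add: torus_measure_translate)
  also have "\<dots> = emeasure torus_measure {y. dist (a + y) x < \<rho>}"
    by (subst emeasure_distr) (auto simp: vimage_def)
  also have "\<dots> = emeasure lborel {v. dist (to_torus v) (to_torus c) < \<rho> \<and> v \<in> unit_cube}"
    unfolding ball_c by (subst emeasure_torus_measure) auto
  also have "{v. dist (to_torus v) (to_torus c) < \<rho> \<and> v \<in> unit_cube} = ball c \<rho>"
  proof (intro equalityI subsetI)
    fix v assume "v \<in> ball c \<rho>"
    then have n: "norm (v - c) < \<rho>" by (simp add: dist_norm norm_minus_commute)
    have "0 \<le> v $ i \<and> v $ i < 1" for i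
      using component_le_norm_cart[of "v - c" i] n assms(2) by (auto simp: c_def)
    then show "v \<in> {v. dist (to_torus v) (to_torus c) < \<rho> \<and> v \<in> unit_cube}"
      using dist_to_torus_le[of v c] n by auto
  next
    fix v assume v: "v \<in> {v. dist (to_torus v) (to_torus c) < \<rho> \<and> v \<in> unit_cube}"
    then have d: "dist (to_torus c) (to_torus v) < \<rho>" by (simp add: dist_commute)
    obtain w where w: "to_torus v = to_torus w" "norm (c - w) < \<rho>"
      using dist_torus_approx[OF d] by metis
    \<comment> \<open>Both coordinates lie within 1/2 of that of \<open>c\<close>, one of them
      strictly, so their integer difference is smaller than 1 in absolute value.\<close>
    have "v $ i = w $ i" for i
    proof -
      have "v $ i - w $ i \<in> \<int>" using w(1) to_torus_eq_iff by blast
      moreover have "\<bar>v $ i - w $ i\<bar> < 1"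
        using component_le_norm_cart[of "c - w" i] w(2) assms(2) v
        by (auto simp: c_def abs_if split: if_splits dest!: spec[of _ i])
      ultimately show ?thesis using Ints_nonzero_abs_ge1 by fastforce
    qed
    then have "v = w" by (simp add: vec_eq_iff)
    then show "v \<in> ball c \<rho>" using w(2) by (simp add: dist_norm)
  qed
  finally have "measure torus_measure {y. dist y x < \<rho>} = measure lborel (ball c \<rho>)"
    by (simp add: measure_def)
  also have "\<dots> = \<rho> ^ CARD('n) * measure lborel (ball (0 :: real ^ 'n) 1)"
    using content_ball_conv_unit_ball[of \<rho> c] assms(1) by simp
  finally show ?thesis by simp
qed

lemma compact_torus: "compact (UNIV :: 'n::finite torus set)"
proof -
  have "\<exists>v\<in>cbox 0 1. x = to_torus v" for x :: "'n torus"
  proof -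
    obtain v where v: "x = to_torus v" by (rule torus_cases)
    have "to_torus (v + of_int_vec (- floor_vec v)) = x" using v by simp
    moreover have "v + of_int_vec (- floor_vec v) \<in> cbox 0 1"
      by (auto simp: mem_box_cart floor_vec_def) linarith+
    ultimately show ?thesis by metis
  qed
  then have "(UNIV :: 'n torus set) = to_torus ` cbox 0 1" by auto
  then show ?thesis
    by (metis compact_cbox compact_continuous_image continuous_to_torus)
qed

section \<open>Characters and their integrals\<close>

lift_definition chi :: "int ^ 'n \<Rightarrow> 'n::finite torus \<Rightarrow> complex" is
  "\<lambda>k v. cis (2 * pi * (\<Sum>i\<in>UNIV. of_int (k $ i) * v $ i))"
proof -
  fix k :: "int ^ 'n" and v w :: "real ^ 'n"
  assume "lattice_cong v w"
  then have "(\<Sum>i\<in>UNIV. of_int (k $ i) * (v $ i - w $ i)) \<in> \<int>"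
    by (intro Ints_sum Ints_mult) (auto simp: lattice_cong_def)
  then have "(\<Sum>i\<in>UNIV. of_int (k $ i) * v $ i) - (\<Sum>i\<in>UNIV. of_int (k $ i) * w $ i) \<in> \<int>"
    by (simp add: sum_subtractf right_diff_distrib)
  then have "cis (2 * pi * ((\<Sum>i\<in>UNIV. of_int (k $ i) * v $ i) - (\<Sum>i\<in>UNIV. of_int (k $ i) * w $ i))) = 1"
    by (rule cis_multiple_2pi)
  then show "cis (2 * pi * (\<Sum>i\<in>UNIV. of_int (k $ i) * v $ i)) = cis (2 * pi * (\<Sum>i\<in>UNIV. of_int (k $ i) * w $ i))"
    by (simp add: right_diff_distrib cis_divide[symmetric])
qed

lemma chi_0_left [simp]: "chi 0 x = 1"
  by transfer simp

lemma chi_add_left: "chi (k + l) x = chi k x * chi l x"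
  by transfer (simp add: cis_mult sum.distrib algebra_simps)

lemma chi_add_right: "chi k (x + y) = chi k x * chi k y"
  by transfer (simp add: cis_mult sum.distrib algebra_simps)

lemma norm_chi [simp]: "norm (chi k x) = 1"
  by transfer simp

lemma cnj_chi: "cnj (chi k x) = chi (- k) x"
  by transfer (simp add: cis_cnj sum_negf)

lemma chi_uminus_right: "chi k (- x) = cnj (chi k x)"
  by transfer (simp add: cis_cnj sum_negf)

text \<open>Composition with an automorphism sends characters to characters. This duality carries
  the walk over to the lattice of frequencies and is the origin of all later transposes.\<close>

lemma chi_torus_act: "chi k (torus_act A x) = chi (transpose A *v k) x"
proof (transfer)
  fix k :: "int ^ 'n" and A :: "int ^ 'n ^ 'n" and v :: "real ^ 'n"
  have "(\<Sum>i\<in>UNIV. of_int (k $ i) * (real_matrix A *v v) $ i) = (\<Sum>i\<in>UNIV. \<Sum>j\<in>UNIV. of_int (k $ i) * (of_int (A $ i $ j) * v $ j))"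
    by (simp add: matrix_vector_mult_def sum_distrib_left)
  also have "\<dots> = (\<Sum>j\<in>UNIV. \<Sum>i\<in>UNIV. of_int (k $ i) * (of_int (A $ i $ j) * v $ j))"
    by (rule sum.swap)
  also have "\<dots> = (\<Sum>j\<in>UNIV. of_int ((transpose A *v k) $ j) * v $ j)"
    by (simp add: matrix_vector_mult_def transpose_def sum_distrib_left sum_distrib_right ac_simps)
  finally show "cis (2 * pi * (\<Sum>i\<in>UNIV. of_int (k $ i) * (real_matrix A *v v) $ i)) =
     cis (2 * pi * (\<Sum>j\<in>UNIV. of_int ((transpose A *v k) $ j) * v $ j))" by simp
qed

lemma chi_to_torus: "chi k (to_torus v) = cis (2 * pi * (\<Sum>i\<in>UNIV. of_int (k $ i) * v $ i))"
  by transfer simp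

text \<open>A point close to \<open>x\<close> on the torus has a lift close to a given lift of
  \<open>x\<close>, so the metric topology is the quotient topology.\<close>

lemma continuous_on_torusI:
  fixes f :: "'n::finite torus \<Rightarrow> 'b::topological_space"
  assumes "continuous_on UNIV (\<lambda>v. f (to_torus v))"
  shows "continuous_on UNIV f"
  unfolding continuous_on_eq_continuous_at[OF open_UNIV]
proof
  fix x :: "'n torus"
  show "isCont f x"
    unfolding continuous_at_open
  proof (intro allI impI)
    fix T assume T: "open T \<and> f x \<in> T"
    obtain v where v: "x = to_torus v" by (rule torus_cases)
    have "open ((\<lambda>v. f (to_torus v)) -` T)" using assms T by (simp add: open_vimage)
    moreover have "v \<in> (\<lambda>v. f (to_torus v)) -` T" using T v by simp
    ultimately obtain e where e: "e > 0" "ball v e \<subseteq> (\<lambda>v. f (to_torus v)) -` T"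
      unfolding open_contains_ball by blast
    have "f y \<in> T" if y: "y \<in> ball x e" for y
    proof -
      obtain w where "y = to_torus w" "norm (v - w) < e"
        using dist_torus_approx[of v y e thesis] y v by auto
      then show ?thesis using e(2) by (auto simp: dist_norm)
    qed
    then show "\<exists>S. open S \<and> x \<in> S \<and> (\<forall>x'\<in>S. f x' \<in> T)"
      using e(1) by (intro exI[of _ "ball x e"]) auto
  qed
qed

lemma continuous_chi: "continuous_on UNIV (chi k)"
  by (rule continuous_on_torusI) (simp add: chi_to_torus, intro continuous_intros)

lemma measurable_chi [measurable]: "chi k \<in> borel_measurable borel"
  by (intro borel_measurable_continuous_onI continuous_chi)

lemma integrable_chi [simp]: "integrable torus_measure (chi k)"
  by (rule torus.integrable_const_bound[where B = 1]) (auto simp: sets_torus_measure)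

lemma integral_chi: "(\<integral>\<^sub>T x. chi k x) = (if k = 0 then 1 else 0)"
proof (cases "k = 0")
  case True
  then show ?thesis by simp
next
  case False
  then obtain i where i: "k $ i \<noteq> 0" by (auto simp: vec_eq_iff)
  \<comment> \<open>A half period in direction \<open>i\<close>, chosen so that the character is - 1
    there; translation by it forces the integral to equal its own negative.\<close>
  define a where "a = to_torus (axis i (1 / (2 * of_int (k $ i))))"
  have "chi k a = cis (2 * pi * (of_int (k $ i) * (1 / (2 * of_int (k $ i)))))"
    unfolding a_def chi_to_torus
    by (subst sum.remove[of _ i]) (auto simp: axis_def intro!: arg_cong[where f=cis] sum.neutral)
  also have "\<dots> = -1" using i by simp
  finally have a: "chi k a = -1" .
  have "(\<integral>\<^sub>T x. chi k x) = (\<integral>x. chi k x \<partial>distr torus_measure borel (\<lambda>x. a + x))"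
    by (simp add: torus_measure_translate)
  also have "\<dots> = (\<integral>\<^sub>T x. chi k (a + x))"
    by (rule integral_distr) auto
  also have "\<dots> = - (\<integral>\<^sub>T x. chi k x)"
    by (simp add: chi_add_right a)
  finally show ?thesis using False by simp
qed

section \<open>Trigonometric polynomials\<close>

text \<open>The linear span of the characters. The inductive form makes algebraic closure and
  continuity provable by induction; an explicit coefficient sum is extracted by
  \<open>trig_poly_expansion\<close> when Parseval requires it.\<close>

inductive_set trig_poly :: "('n::finite torus \<Rightarrow> complex) set" where
  chi: "chi k \<in> trig_poly"
| scale: "f \<in> trig_poly \<Longrightarrow> (\<lambda>x. c * f x) \<in> trig_poly"
| add: "f \<in> trig_poly \<Longrightarrow> g \<in> trig_poly \<Longrightarrow> (\<lambda>x. f x + g x) \<in> trig_poly"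

lemma trig_poly_const: "(\<lambda>x. c) \<in> trig_poly"
  using trig_poly.scale[OF trig_poly.chi, of c 0] by simp

lemma trig_poly_mult:
  assumes "f \<in> trig_poly" "g \<in> trig_poly"
  shows "(\<lambda>x. f x * g x) \<in> trig_poly"
  using assms(1)
proof induction
  case (chi k)
  from assms(2) show ?case
  proof induction
    case (chi l)
    then show ?case using trig_poly.chi[of "k + l"] by (simp add: chi_add_left[abs_def])
  next
    case (scale f c)
    then show ?case using trig_poly.scale[OF scale.IH, of c] by (simp add: algebra_simps)
  next
    case (add f g)
    then show ?case using trig_poly.add[OF add.IH] by (simp add: algebra_simps)
  qed
next
  case (scale f c)
  then show ?case using trig_poly.scale[OF scale.IH, of c] by (simp add: algebra_simps)
next
  case (add f g)
  then show ?case using trig_poly.add[OF add.IH] by (simp add: algebra_simps)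
qed

lemma trig_poly_cnj: "f \<in> trig_poly \<Longrightarrow> (\<lambda>x. cnj (f x)) \<in> trig_poly"
proof (induction rule: trig_poly.induct)
  case (chi k)
  then show ?case using trig_poly.chi[of "- k"] by (simp add: cnj_chi)
next
  case (scale f c)
  then show ?case using trig_poly.scale[OF scale.IH, of "cnj c"] by simp
next
  case (add f g)
  then show ?case using trig_poly.add[OF add.IH] by simp
qed

lemma trig_poly_Re:
  assumes "f \<in> trig_poly"
  shows "(\<lambda>x. complex_of_real (Re (f x))) \<in> trig_poly"
  using trig_poly.scale[OF trig_poly.add[OF assms trig_poly_cnj[OF assms]], of "1/2"]
  by (simp add: complex_add_cnj)

lemma trig_poly_Im:
  assumes "f \<in> trig_poly"
  shows "(\<lambda>x. complex_of_real (Im (f x))) \<in> trig_poly"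
proof -
  have "Re (- \<i> * f x) = Im (f x)" for x by simp
  then show ?thesis using trig_poly_Re[OF trig_poly.scale[OF assms, of "- \<i>"]] by simp
qed

lemma continuous_trig_poly: "f \<in> trig_poly \<Longrightarrow> continuous_on UNIV f"
  by (induction rule: trig_poly.induct) (auto intro!: continuous_intros continuous_chi)

lemma measurable_trig_poly: "f \<in> trig_poly \<Longrightarrow> f \<in> borel_measurable borel"
  by (intro borel_measurable_continuous_onI continuous_trig_poly)

lemma trig_poly_bounded: "f \<in> trig_poly \<Longrightarrow> \<exists>C. \<forall>x. norm (f x) \<le> C"
  using compact_imp_bounded[OF compact_continuous_image[OF continuous_trig_poly compact_torus], of f]
  by (auto simp: bounded_iff)

lemma trig_poly_expansion:
  assumes "f \<in> trig_poly"
  obtains K b where "finite K" "\<And>x. f x = (\<Sum>k\<in>K. b k * chi k x)"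
proof -
  have "\<exists>K b. finite K \<and> (\<forall>x. f x = (\<Sum>k\<in>K. b k * chi k x))"
    using assms
  proof induction
    case (chi k)
    then show ?case by (intro exI[of _ "{k}"] exI[of _ "\<lambda>_. 1"]) simp
  next
    case (scale f c)
    then obtain K b where "finite K" "\<And>x. f x = (\<Sum>k\<in>K. b k * chi k x)" by blast
    then show ?case
      by (intro exI[of _ K] exI[of _ "\<lambda>k. c * b k"]) (simp add: sum_distrib_left mult.assoc)
  next
    case (add f g)
    then obtain K b L c where K: "finite K" "\<And>x. f x = (\<Sum>k\<in>K. b k * chi k x)"
      and L: "finite L" "\<And>x. g x = (\<Sum>k\<in>L. c k * chi k x)" by blast
    have "f x + g x = (\<Sum>k\<in>K \<union> L. ((if k \<in> K then b k else 0) + (if k \<in> L then c k else 0)) * chi k x)" for x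
    proof -
      have "(\<Sum>k\<in>K. b k * chi k x) = (\<Sum>k\<in>K \<union> L. (if k \<in> K then b k else 0) * chi k x)"
        using K(1) L(1) by (intro sum.mono_neutral_cong_left) auto
      moreover have "(\<Sum>k\<in>L. c k * chi k x) = (\<Sum>k\<in>K \<union> L. (if k \<in> L then c k else 0) * chi k x)"
        using K(1) L(1) by (intro sum.mono_neutral_cong_left) auto
      ultimately show ?thesis by (simp add: K L sum.distrib distrib_right)
    qed
    then show ?case using K(1) L(1)
      by (intro exI[of _ "K \<union> L"] exI[of _ "\<lambda>k. (if k \<in> K then b k else 0) + (if k \<in> L then c k else 0)"]) auto
  qed
  then show thesis using that by blast
qed

text \<open>Some coordinate of the difference of two lifts is not an integer, and the corresponding
  coordinate character already detects this.\<close>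

lemma chi_separates:
  assumes "x \<noteq> y"
  obtains k where "chi k x \<noteq> chi k y"
proof -
  obtain v where v: "x = to_torus v" by (rule torus_cases)
  obtain w where w: "y = to_torus w" by (rule torus_cases)
  obtain i where i: "v $ i - w $ i \<notin> \<int>" using assms by (auto simp: v w to_torus_eq_iff)
  have c: "chi (axis i 1) (to_torus u) = cis (2 * pi * u $ i)" for u
    unfolding chi_to_torus
    by (subst sum.remove[of _ i]) (auto simp: axis_def intro!: arg_cong[where f=cis] sum.neutral)
  have "chi (axis i 1) x \<noteq> chi (axis i 1) y"
  proof
    assume "chi (axis i 1) x = chi (axis i 1) y"
    then have "cis (2 * pi * v $ i) / cis (2 * pi * w $ i) = 1" by (simp add: v w c)
    then have "cis (2 * pi * v $ i - 2 * pi * w $ i) = 1" by (simp add: cis_divide)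
    then have "cos (2 * pi * v $ i - 2 * pi * w $ i) = 1" by (simp add: complex_eq_iff)
    then obtain n :: int where "2 * pi * v $ i - 2 * pi * w $ i = real_of_int n * 2 * pi"
      by (auto simp only: cos_one_2pi_int)
    then have "2 * pi * (v $ i - w $ i) = 2 * pi * n" by (simp add: algebra_simps)
    then have "v $ i - w $ i = n" by simp
    then show False using i by simp
  qed
  then show thesis by (rule that)
qed

text \<open>The real form of the Stone-Weierstrass theorem, for the algebra of real-valued
  trigonometric polynomials; real and imaginary parts of characters separate points.\<close>

lemma trig_poly_uniformly_dense:
  fixes f :: "'n::finite torus \<Rightarrow> real"
  assumes "continuous_on UNIV f" "e > 0"
  obtains q where "(\<lambda>x. complex_of_real (q x)) \<in> trig_poly" "\<And>x. \<bar>f x - q x\<bar> < e"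
proof -
  let ?R = "{q :: 'n torus \<Rightarrow> real. (\<lambda>x. complex_of_real (q x)) \<in> trig_poly}"
  interpret function_ring_on ?R UNIV
  proof
    show "compact (UNIV :: 'n torus set)" by (rule compact_torus)
    show "continuous_on UNIV q" if "q \<in> ?R" for q
      using continuous_on_Re[OF continuous_trig_poly, of "\<lambda>x. complex_of_real (q x)"] that by simp
    show "(\<lambda>x. p x + q x) \<in> ?R" if "p \<in> ?R" "q \<in> ?R" for p q
      using that trig_poly.add[of "\<lambda>x. complex_of_real (p x)"] by simp
    show "(\<lambda>x. p x * q x) \<in> ?R" if "p \<in> ?R" "q \<in> ?R" for p q
      using that trig_poly_mult[of "\<lambda>x. complex_of_real (p x)"] by simp
    show "(\<lambda>_. c) \<in> ?R" for c by (simp add: trig_poly_const)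
    fix x y :: "'n torus" assume "x \<noteq> y"
    then obtain k where k: "chi k x \<noteq> chi k y" by (rule chi_separates)
    show "\<exists>f\<in>?R. f x \<noteq> f y"
    proof (cases "Re (chi k x) = Re (chi k y)")
      case False
      then show ?thesis by (intro bexI[of _ "\<lambda>x. Re (chi k x)"]) (auto intro: trig_poly_Re trig_poly.chi)
    next
      case True
      then have "Im (chi k x) \<noteq> Im (chi k y)" using k complex_eqI by blast
      then show ?thesis by (intro bexI[of _ "\<lambda>x. Im (chi k x)"]) (auto intro: trig_poly_Im trig_poly.chi)
    qed
  qed
  show thesis using Stone_Weierstrass_basic[OF assms] that by blast
qed

section \<open>Measures are determined by their Fourier coefficients\<close>

lemma closed_indicator_limit:
  fixes C :: "'a::metric_space set"
  assumes "closed C" "C \<noteq> {}"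
  shows "(\<lambda>j. max 0 (1 - real j * infdist x C)) \<longlonglongrightarrow> indicator C x"
proof (cases "x \<in> C")
  case True
  then show ?thesis by simp
next
  case False
  then have p: "infdist x C > 0" using assms in_closed_iff_infdist_zero infdist_nonneg
    by (metis less_eq_real_def)
  have "eventually (\<lambda>j. real j \<ge> 1 / infdist x C) sequentially"
    by (intro eventually_compose_filterlim[OF eventually_ge_at_top filterlim_real_sequentially])
  then have "eventually (\<lambda>j. max 0 (1 - real j * infdist x C) = 0) sequentially"
    by eventually_elim (use p in \<open>simp add: field_simps max_def\<close>)
  then show ?thesis using False by (simp add: tendsto_eventually)
qed

lemma integral_continuous_eq_of_chi:
  fixes N N' :: "'n::finite torus measure"
  assumes N: "prob_space N" "sets N = sets borel" and N': "prob_space N'" "sets N' = sets borel"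
    and chi: "\<And>k. (\<integral>x. chi k x \<partial>N) = (\<integral>x. chi k x \<partial>N')"
    and f: "continuous_on UNIV (f :: 'n torus \<Rightarrow> real)"
  shows "(\<integral>x. f x \<partial>N) = (\<integral>x. f x \<partial>N')"
proof -
  interpret N: prob_space N by (rule N)
  interpret N': prob_space N' by (rule N')
  note [measurable_cong] = N(2) N'(2)
  have int: "integrable N g \<and> integrable N' g" if "g \<in> borel_measurable borel" "\<exists>C. \<forall>x. norm (g x) \<le> C"
    for g :: "'n torus \<Rightarrow> 'c::{banach,second_countable_topology}"
    using that by (auto intro!: N.integrable_const_bound N'.integrable_const_bound)
  have eq: "(\<integral>x. q x \<partial>N) = (\<integral>x. q x \<partial>N')" if "q \<in> trig_poly" for q
    using that
  proof induction
    case (add p q)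
    then have "integrable N p \<and> integrable N' p" "integrable N q \<and> integrable N' q"
      by (auto intro!: int[THEN conjunct1] int[THEN conjunct2] measurable_trig_poly trig_poly_bounded)
    then show ?case using add by simp
  qed (simp_all add: chi)
  have bf: "f \<in> borel_measurable borel" by (rule borel_measurable_continuous_onI[OF f])
  have bd: "\<exists>C. \<forall>x. norm (f x) \<le> C"
    using compact_imp_bounded[OF compact_continuous_image[OF f compact_torus]] by (auto simp: bounded_iff)
  note fi = int[OF bf bd]
  have "\<bar>(\<integral>x. f x \<partial>N) - (\<integral>x. f x \<partial>N')\<bar> \<le> 0 + e" if e: "e > 0" for e
  proof -
    obtain q where q: "(\<lambda>x. complex_of_real (q x)) \<in> trig_poly" "\<And>x. \<bar>f x - q x\<bar> < e / 2"
      using trig_poly_uniformly_dense[OF f half_gt_zero[OF e]] by blast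
    have "continuous_on UNIV q" using continuous_on_Re[OF continuous_trig_poly[OF q(1)]] by simp
    then have qm: "q \<in> borel_measurable borel" by (rule borel_measurable_continuous_onI)
    have qb: "\<exists>C. \<forall>x. norm (q x) \<le> C" using trig_poly_bounded[OF q(1)] by simp
    note qi = int[OF qm qb]
    have "complex_of_real (\<integral>x. q x \<partial>N) = complex_of_real (\<integral>x. q x \<partial>N')"
      using eq[OF q(1)] by simp
    then have qq: "(\<integral>x. q x \<partial>N) = (\<integral>x. q x \<partial>N')" by (simp only: of_real_eq_iff)
    have close: "\<bar>(\<integral>x. f x \<partial>L) - (\<integral>x. q x \<partial>L)\<bar> \<le> e / 2"
      if L: "prob_space L" "integrable L f" "integrable L q" for L
    proof -
      have c: "integrable L (\<lambda>x. e / 2)"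
        using L(1) by (intro finite_measure.integrable_const) (simp add: prob_space_def)
      have "\<bar>\<integral>x. f x - q x \<partial>L\<bar> \<le> (\<integral>x. \<bar>f x - q x\<bar> \<partial>L)" by (rule integral_abs_bound)
      also have "\<dots> \<le> (\<integral>x. e / 2 \<partial>L)"
        by (rule integral_mono) (use L c q(2) in \<open>auto simp: less_imp_le\<close>)
      finally show ?thesis using L prob_space.prob_space[OF L(1)] by simp
    qed
    have "\<bar>(\<integral>x. f x \<partial>N) - (\<integral>x. q x \<partial>N)\<bar> \<le> e / 2" using N(1) fi qi by (intro close) auto
    moreover have "\<bar>(\<integral>x. f x \<partial>N') - (\<integral>x. q x \<partial>N')\<bar> \<le> e / 2" using N'(1) fi qi by (intro close) auto
    ultimately show ?thesis using qq by linarith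
  qed
  then show ?thesis using field_le_epsilon[of "\<bar>(\<integral>x. f x \<partial>N) - (\<integral>x. f x \<partial>N')\<bar>" 0] by simp
qed

text \<open>Agreement on characters extends to continuous functions by uniform density, then to
  closed sets by the approximations of \<open>closed_indicator_limit\<close>, and closed sets are an
  intersection-stable generator.\<close>

lemma torus_measure_eqI:
  fixes N N' :: "'n::finite torus measure"
  assumes N: "prob_space N" "sets N = sets borel" and N': "prob_space N'" "sets N' = sets borel"
    and chi: "\<And>k. (\<integral>x. chi k x \<partial>N) = (\<integral>x. chi k x \<partial>N')"
  shows "N = N'"
proof (rule measure_eqI_generator_eq[where \<Omega> = UNIV and E = "Collect closed" and A = "\<lambda>_. UNIV"])
  interpret N: prob_space N by (rule N)
  interpret N': prob_space N' by (rule N')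
  note [measurable_cong] = N(2) N'(2)
  show "Int_stable (Collect closed :: 'n torus set set)" by (auto simp: Int_stable_def)
  show "emeasure N C = emeasure N' C" if "C \<in> Collect closed" for C
  proof (cases "C = {}")
    case False
    have C: "closed C" "C \<in> sets borel" using that by auto
    let ?f = "\<lambda>j x. max 0 (1 - real j * infdist x C)"
    have cf: "continuous_on UNIV (?f j)" for j by (intro continuous_intros)
    have mf: "?f j \<in> borel_measurable borel" for j
      using cf by (rule borel_measurable_continuous_onI)
    have lim: "(\<lambda>j. \<integral>x. ?f j x \<partial>M) \<longlonglongrightarrow> measure M C"
      if M: "prob_space M" "sets M = sets borel" for M
    proof -
      interpret M: prob_space M by (rule M)
      note [measurable_cong] = M(2)
      have "(\<lambda>j. \<integral>x. ?f j x \<partial>M) \<longlonglongrightarrow> (\<integral>x. indicator C x \<partial>M)"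
      proof (rule integral_dominated_convergence[where w = "\<lambda>_. 1"])
        show "indicat_real C \<in> borel_measurable M" using C(2) M(2) by (intro borel_measurable_indicator) simp
        show "?f j \<in> borel_measurable M" for j using mf by measurable
        show "AE x in M. (\<lambda>j. ?f j x) \<longlonglongrightarrow> indicat_real C x"
          using closed_indicator_limit[OF C(1) False] by (intro AE_I2)
        show "AE x in M. norm (?f j x) \<le> 1" for j by (simp add: infdist_nonneg)
      qed simp
      then show ?thesis using C M sets_eq_imp_space_eq[OF M(2)] by simp
    qed
    have "(\<integral>x. ?f j x \<partial>N) = (\<integral>x. ?f j x \<partial>N')" for j
      by (rule integral_continuous_eq_of_chi[OF N N' chi cf])
    then have "measure N C = measure N' C"
      using LIMSEQ_unique[OF lim[OF N]] lim[OF N'] by simp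
    then show ?thesis by (simp add: N.emeasure_eq_measure N'.emeasure_eq_measure)
  qed simp
qed (use N N' in \<open>auto simp: borel_eq_closed prob_space_def finite_measure.emeasure_eq_measure\<close>)

section \<open>Invariance under integer matrices and fixed points\<close>

lemma of_int_vec_eq_0_iff [simp]: "of_int_vec k = 0 \<longleftrightarrow> k = 0"
  by (simp add: vec_eq_iff)

lemma of_int_vec_matrix_mult: "of_int_vec (A *v k) = real_matrix A *v of_int_vec k"
  by (simp add: vec_eq_iff matrix_vector_mult_def)

lemma int_matrix_mult_eq_0_iff:
  fixes A :: "int ^ 'n ^ 'n"
  assumes "det A \<noteq> 0"
  shows "A *v k = 0 \<longleftrightarrow> k = 0"
proof
  assume "A *v k = 0"
  then have "real_matrix A *v of_int_vec k = 0" by (metis of_int_vec_eq_0_iff of_int_vec_matrix_mult)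
  moreover have "invertible (real_matrix A)" using assms by (simp add: invertible_det_nz det_real_matrix)
  ultimately have "of_int_vec k = 0"
    by (meson invertible_left_inverse matrix_left_invertible_ker)
  then show "k = 0" by simp
qed simp

lemma continuous_torus_act: "continuous_on UNIV (torus_act A)"
proof (rule continuous_on_torusI)
  have "continuous_on UNIV (\<lambda>v. to_torus (real_matrix A *v v))"
    by (rule continuous_on_compose2[OF continuous_to_torus[of UNIV]]) (auto intro!: continuous_intros)
  then show "continuous_on UNIV (\<lambda>v. torus_act A (to_torus v))"
    by (simp add: torus_act.abs_eq)
qed

lemma measurable_torus_act [measurable]: "torus_act A \<in> borel_measurable borel"
  by (intro borel_measurable_continuous_onI continuous_torus_act)

text \<open>A nonsingular matrix maps only the frequency 0 to 0, so all Fourier coefficients are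
  preserved. The determinant is merely nonzero here so that the result also covers
  \<open>A - mat 1\<close>, an endomorphism that is in general not invertible on the torus.\<close>

lemma torus_measure_act:
  fixes A :: "int ^ 'n ^ 'n"
  assumes "det A \<noteq> 0"
  shows "distr torus_measure borel (torus_act A) = torus_measure"
proof (rule torus_measure_eqI)
  show "prob_space (distr torus_measure borel (torus_act A))"
    by (rule torus.prob_space_distr) (simp add: measurable_cong_sets[OF sets_torus_measure refl])
  fix k
  have "(\<integral>x. chi k x \<partial>distr torus_measure borel (torus_act A)) = (\<integral>\<^sub>T x. chi k (torus_act A x))"
    by (rule integral_distr) auto
  also have "\<dots> = (\<integral>\<^sub>T x. chi k x)"
    using int_matrix_mult_eq_0_iff[of "transpose A" k] assms by (simp add: chi_torus_act integral_chi)
  finally show "(\<integral>x. chi k x \<partial>distr torus_measure borel (torus_act A)) = (\<integral>\<^sub>T x. chi k x)" .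
qed (simp_all add: prob_space_torus_measure sets_torus_measure)

text \<open>A point of the torus has only one lift in the half-open unit cube.\<close>

lemma torus_measure_singleton: "emeasure torus_measure {x :: 'n::finite torus} = 0"
proof -
  obtain v where v: "x = to_torus v" by (rule torus_cases)
  have "emeasure torus_measure {x} = emeasure lborel {w. to_torus w \<in> {x} \<and> w \<in> unit_cube}"
    by (rule emeasure_torus_measure) simp
  also have "\<dots> \<le> emeasure lborel {v + of_int_vec (- floor_vec v)}"
  proof (rule emeasure_mono)
    have "w $ i = (v + of_int_vec (- floor_vec v)) $ i" if "to_torus w = x" "w \<in> unit_cube" for w i
    proof -
      have "w $ i - v $ i \<in> \<int>" using that(1) v to_torus_eq_iff by metis
      then obtain n :: int where n: "w $ i - v $ i = n" by (auto elim: Ints_cases)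
      have "0 \<le> w $ i" "w $ i < 1" using that(2) by auto
      then have "\<lfloor>v $ i\<rfloor> = - n" using n by (simp add: floor_eq_iff)
      then show ?thesis using n by (simp add: floor_vec_def)
    qed
    then have "w = v + of_int_vec (- floor_vec v)" if "to_torus w = x" "w \<in> unit_cube" for w
      using that unfolding vec_eq_iff by blast
    then show "{w. to_torus w \<in> {x} \<and> w \<in> unit_cube} \<subseteq> {v + of_int_vec (- floor_vec v)}"
      by blast
  qed simp
  finally show ?thesis by simp
qed

lemma torus_act_minus_one: "torus_act (A - mat 1) x = torus_act A x - x"
proof (transfer)
  fix A :: "int ^ 'n ^ 'n" and v :: "real ^ 'n"
  have "real_matrix (A - mat 1) = real_matrix A - mat 1" by (simp add: vec_eq_iff mat_def)
  then show "lattice_cong (real_matrix (A - mat 1) *v v) (real_matrix A *v v - v)"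
    by (simp add: matrix_vector_mult_diff_rdistrib lattice_cong_def)
qed

text \<open>The fixed points form the preimage of 0 under \<open>A - mat 1\<close>, which preserves
  the measure, and points are null.\<close>

lemma AE_torus_act_neq:
  assumes "det (A - mat 1) \<noteq> 0"
  shows "AE x in torus_measure. torus_act A x \<noteq> x"
proof -
  have "emeasure torus_measure {x. torus_act A x = x}
      = emeasure (distr torus_measure borel (torus_act (A - mat 1))) {0}"
    by (subst emeasure_distr) (auto simp: vimage_def torus_act_minus_one)
  also have "\<dots> = 0" using assms by (simp add: torus_measure_act torus_measure_singleton)
  finally have "emeasure torus_measure {x. torus_act A x = x} = 0" .
  moreover have "closed {x. torus_act A x = x}"
    by (intro closed_Collect_eq continuous_torus_act continuous_intros)
  ultimately show ?thesis
    by (intro AE_I[of _ _ "{x. torus_act A x = x}"]) (auto simp: sets_torus_measure)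
qed

section \<open>Approximation and Parseval in the square mean\<close>

lemma torus_integrable_bounded:
  fixes f :: "'n::finite torus \<Rightarrow> 'b::{banach,second_countable_topology}"
  assumes "f \<in> borel_measurable borel" "\<And>x. norm (f x) \<le> C"
  shows "integrable torus_measure f"
  using assms by (intro torus.integrable_const_bound[where B = C]) auto

text \<open>Membership in the closure of the trigonometric polynomials in square mean. Boundedness
  is included so that all the integrals exist and limits can be taken under a constant
  majorant.\<close>

definition L2_approximable :: "('n::finite torus \<Rightarrow> real) \<Rightarrow> bool" where
  "L2_approximable f \<longleftrightarrow> f \<in> borel_measurable borel \<and> (\<exists>C. \<forall>x. \<bar>f x\<bar> \<le> C) \<and>
     (\<forall>e>0. \<exists>q\<in>trig_poly. (\<integral>\<^sub>T x. (norm (of_real (f x) - q x))\<^sup>2) < e)"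

lemma norm_add_square_le:
  fixes a b :: "'a::real_normed_vector"
  shows "(norm (a + b))\<^sup>2 \<le> 2 * (norm a)\<^sup>2 + 2 * (norm b)\<^sup>2"
proof -
  have "(norm (a + b))\<^sup>2 \<le> (norm a + norm b)\<^sup>2" by (intro power_mono norm_triangle_ineq) simp
  also have "\<dots> \<le> 2 * (norm a)\<^sup>2 + 2 * (norm b)\<^sup>2"
    using sum_squares_bound[of "norm a" "norm b"] by (simp add: power2_sum)
  finally show ?thesis .
qed

lemma integrable_norm_square_bounded:
  fixes f :: "'n::finite torus \<Rightarrow> complex"
  assumes "f \<in> borel_measurable borel" "\<exists>C. \<forall>x. norm (f x) \<le> C"
  shows "integrable torus_measure (\<lambda>x. (norm (f x))\<^sup>2)"
proof -
  obtain C where "\<And>x. norm (f x) \<le> C" using assms(2) by blast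
  then show ?thesis using assms(1)
    by (intro torus_integrable_bounded[where C = "C\<^sup>2"]) (auto intro!: power_mono)
qed

lemma integrable_norm_square_diff:
  assumes f: "f \<in> borel_measurable borel" "\<exists>C. \<forall>x. \<bar>f x\<bar> \<le> C" and q: "q \<in> trig_poly"
  shows "integrable torus_measure (\<lambda>x. (norm (complex_of_real (f x) - q x))\<^sup>2)"
proof (rule integrable_norm_square_bounded)
  show "(\<lambda>x. complex_of_real (f x) - q x) \<in> borel_measurable borel"
    using f measurable_trig_poly[OF q] by simp
  obtain C D where "\<And>x. \<bar>f x\<bar> \<le> C" "\<And>x. norm (q x) \<le> D" using f trig_poly_bounded[OF q] by blast
  then have "norm (complex_of_real (f x) - q x) \<le> C + D" for x
    by (metis add_mono norm_of_real norm_triangle_ineq4 order_trans)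
  then show "\<exists>C. \<forall>x. norm (complex_of_real (f x) - q x) \<le> C" by blast
qed

lemma L2_approximable_add:
  assumes f: "L2_approximable f" and g: "L2_approximable g"
  shows "L2_approximable (\<lambda>x. f x + g x)"
proof -
  obtain C D where CD: "\<And>x. \<bar>f x\<bar> \<le> C" "\<And>x. \<bar>g x\<bar> \<le> D"
    using f g by (auto simp: L2_approximable_def)
  have m: "f \<in> borel_measurable borel" "g \<in> borel_measurable borel"
    using f g by (auto simp: L2_approximable_def)
  have bd: "\<exists>C. \<forall>x. \<bar>f x + g x\<bar> \<le> C"
    using CD by (intro exI[of _ "C + D"]) (meson abs_triangle_ineq add_mono order_trans)
  have "\<exists>q\<in>trig_poly. (\<integral>\<^sub>T x. (norm (of_real (f x + g x) - q x))\<^sup>2) < e" if e: "e > 0" for e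
  proof -
    have "e / 4 > 0" using e by simp
    then obtain p q where
      p: "p \<in> trig_poly" "(\<integral>\<^sub>T x. (norm (of_real (f x) - p x))\<^sup>2) < e / 4" and
      q: "q \<in> trig_poly" "(\<integral>\<^sub>T x. (norm (of_real (g x) - q x))\<^sup>2) < e / 4"
      using f g unfolding L2_approximable_def by meson
    have i: "integrable torus_measure (\<lambda>x. (norm (of_real (f x) - p x))\<^sup>2)"
      "integrable torus_measure (\<lambda>x. (norm (of_real (g x) - q x))\<^sup>2)"
      "integrable torus_measure (\<lambda>x. (norm (of_real (f x + g x) - (p x + q x)))\<^sup>2)"
      using m bd CD p(1) q(1)
      by (auto intro!: integrable_norm_square_diff trig_poly.add simp del: of_real_add)
    have "(\<integral>\<^sub>T x. (norm (of_real (f x + g x) - (p x + q x)))\<^sup>2)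
      \<le> (\<integral>\<^sub>T x. 2 * (norm (of_real (f x) - p x))\<^sup>2 + 2 * (norm (of_real (g x) - q x))\<^sup>2)"
    proof (rule integral_mono)
      fix x
      show "(norm (of_real (f x + g x) - (p x + q x)))\<^sup>2
        \<le> 2 * (norm (of_real (f x) - p x))\<^sup>2 + 2 * (norm (of_real (g x) - q x))\<^sup>2"
        using norm_add_square_le[of "of_real (f x) - p x" "of_real (g x) - q x"] by (simp add: algebra_simps)
    qed (use i in auto)
    also have "\<dots> < e" using i p q by simp
    finally show ?thesis using trig_poly.add[OF p(1) q(1)] by (intro bexI[of _ "\<lambda>x. p x + q x"])
  qed
  then show ?thesis using m bd by (simp add: L2_approximable_def)
qed

lemma L2_approximable_scale:
  assumes f: "L2_approximable f"
  shows "L2_approximable (\<lambda>x. c * f x)"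
proof -
  obtain C where C: "\<And>x. \<bar>f x\<bar> \<le> C" using f by (auto simp: L2_approximable_def)
  have m: "f \<in> borel_measurable borel" using f by (auto simp: L2_approximable_def)
  have bd: "\<exists>C. \<forall>x. \<bar>c * f x\<bar> \<le> C"
    using C by (intro exI[of _ "\<bar>c\<bar> * C"]) (simp add: abs_mult mult_left_mono)
  have "\<exists>q\<in>trig_poly. (\<integral>\<^sub>T x. (norm (of_real (c * f x) - q x))\<^sup>2) < e" if e: "e > 0" for e
  proof -
    have c: "c\<^sup>2 + 1 > 0" using zero_le_power2[of c] by linarith
    then have "e / (c\<^sup>2 + 1) > 0" using e by simp
    then obtain p where
      p: "p \<in> trig_poly" "(\<integral>\<^sub>T x. (norm (of_real (f x) - p x))\<^sup>2) < e / (c\<^sup>2 + 1)"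
      using f unfolding L2_approximable_def by meson
    have "(norm (of_real (c * f x) - of_real c * p x))\<^sup>2 = c\<^sup>2 * (norm (of_real (f x) - p x))\<^sup>2" for x
      by (simp flip: right_diff_distrib add: norm_mult power_mult_distrib)
    then have "(\<integral>\<^sub>T x. (norm (of_real (c * f x) - of_real c * p x))\<^sup>2)
      = c\<^sup>2 * (\<integral>\<^sub>T x. (norm (of_real (f x) - p x))\<^sup>2)" by simp
    also have "\<dots> \<le> c\<^sup>2 * (e / (c\<^sup>2 + 1))" using p(2) by (intro mult_left_mono) auto
    also have "\<dots> < e" using e c by (simp add: field_simps)
    finally show ?thesis using trig_poly.scale[OF p(1), of "of_real c"]
      by (intro bexI[of _ "\<lambda>x. of_real c * p x"])
  qed
  then show ?thesis using m bd by (simp add: L2_approximable_def)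
qed

text \<open>A uniform bound turns pointwise convergence into convergence in square mean.\<close>

lemma L2_approximable_limit:
  fixes f :: "'n::finite torus \<Rightarrow> real"
  assumes F: "\<And>j. L2_approximable (F j)" and C: "\<And>j x. \<bar>F j x\<bar> \<le> C" and lim: "\<And>x. (\<lambda>j. F j x) \<longlonglongrightarrow> f x"
  shows "L2_approximable f"
proof -
  have m: "F j \<in> borel_measurable borel" for j using F by (auto simp: L2_approximable_def)
  have fm: "f \<in> borel_measurable borel" by (rule borel_measurable_LIMSEQ_real[OF lim m])
  have fC: "\<bar>f x\<bar> \<le> C" for x
    by (rule LIMSEQ_le_const2[OF tendsto_rabs[OF lim]]) (use C in auto)
  have "\<exists>q\<in>trig_poly. (\<integral>\<^sub>T x. (norm (of_real (f x) - q x))\<^sup>2) < e" if e: "e > 0" for e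
  proof -
    have "(\<lambda>j. \<integral>\<^sub>T x. (f x - F j x)\<^sup>2) \<longlonglongrightarrow> (\<integral>\<^sub>T x :: 'n torus. 0)"
    proof (rule integral_dominated_convergence[where w = "\<lambda>_. (2 * C)\<^sup>2"])
      show "AE x in torus_measure. (\<lambda>j. (f x - F j x)\<^sup>2) \<longlonglongrightarrow> 0"
      proof (rule AE_I2)
        fix x
        have "(\<lambda>j. (f x - F j x)\<^sup>2) \<longlonglongrightarrow> (f x - f x)\<^sup>2" by (intro tendsto_intros lim)
        then show "(\<lambda>j. (f x - F j x)\<^sup>2) \<longlonglongrightarrow> 0" by simp
      qed
      show "AE x in torus_measure. norm ((f x - F j x)\<^sup>2) \<le> (2 * C)\<^sup>2" for j
      proof (rule AE_I2)
        fix x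
        have "\<bar>f x - F j x\<bar> \<le> \<bar>2 * C\<bar>" using fC[of x] C[of j x] by linarith
        then show "norm ((f x - F j x)\<^sup>2) \<le> (2 * C)\<^sup>2" by (simp add: abs_le_square_iff)
      qed
    qed (use fm m in auto)
    then have "eventually (\<lambda>j. (\<integral>\<^sub>T x. (f x - F j x)\<^sup>2) < e / 4) sequentially"
      using e by (intro order_tendstoD) auto
    then obtain j where j: "(\<integral>\<^sub>T x. (f x - F j x)\<^sup>2) < e / 4"
      by (auto simp: eventually_sequentially)
    have "e / 4 > 0" using e by simp
    then obtain q where
      q: "q \<in> trig_poly" "(\<integral>\<^sub>T x. (norm (of_real (F j x) - q x))\<^sup>2) < e / 4"
      using F unfolding L2_approximable_def by meson
    have i: "integrable torus_measure (\<lambda>x. (norm (of_real (F j x) - q x))\<^sup>2)"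
      "integrable torus_measure (\<lambda>x. (norm (of_real (f x) - q x))\<^sup>2)"
      using m fm C fC q by (auto intro!: integrable_norm_square_diff)
    have "integrable torus_measure (\<lambda>x. (f x - F j x)\<^sup>2)"
    proof (rule torus_integrable_bounded[where C = "(2 * C)\<^sup>2"])
      fix x
      have "\<bar>f x - F j x\<bar> \<le> \<bar>2 * C\<bar>" using fC[of x] C[of j x] by linarith
      then show "norm ((f x - F j x)\<^sup>2) \<le> (2 * C)\<^sup>2" by (simp add: abs_le_square_iff)
    qed (use m fm in simp)
    note i = i this
    have "(\<integral>\<^sub>T x. (norm (of_real (f x) - q x))\<^sup>2)
      \<le> (\<integral>\<^sub>T x. 2 * (f x - F j x)\<^sup>2 + 2 * (norm (of_real (F j x) - q x))\<^sup>2)"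
    proof (rule integral_mono)
      fix x
      show "(norm (of_real (f x) - q x))\<^sup>2 \<le> 2 * (f x - F j x)\<^sup>2 + 2 * (norm (of_real (F j x) - q x))\<^sup>2"
        using norm_add_square_le[of "of_real (f x - F j x)" "of_real (F j x) - q x"]
        by (simp only: norm_of_real power2_abs) (simp add: algebra_simps)
    qed (use i in auto)
    also have "\<dots> < e" using i q j by simp
    finally show ?thesis using q(1) by blast
  qed
  then show ?thesis using fm fC by (auto simp: L2_approximable_def)
qed

lemma L2_approximable_continuous:
  fixes f :: "'n::finite torus \<Rightarrow> real"
  assumes f: "continuous_on UNIV f"
  shows "L2_approximable f"
proof -
  have m: "f \<in> borel_measurable borel" by (rule borel_measurable_continuous_onI[OF f])
  have bd: "\<exists>C. \<forall>x. \<bar>f x\<bar> \<le> C"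
    using compact_imp_bounded[OF compact_continuous_image[OF f compact_torus]] by (auto simp: bounded_iff)
  have "\<exists>q\<in>trig_poly. (\<integral>\<^sub>T x. (norm (of_real (f x) - q x))\<^sup>2) < e" if e: "e > 0" for e
  proof -
    define d where "d = sqrt (e / 2)"
    have d: "d > 0" "d\<^sup>2 = e / 2" using e by (auto simp: d_def)
    obtain q where q: "(\<lambda>x. complex_of_real (q x)) \<in> trig_poly" "\<And>x. \<bar>f x - q x\<bar> < d"
      using trig_poly_uniformly_dense[OF f d(1)] by blast
    have "(\<integral>\<^sub>T x. (norm (of_real (f x) - complex_of_real (q x)))\<^sup>2) \<le> (\<integral>\<^sub>T x :: 'n torus. d\<^sup>2)"
    proof (rule integral_mono)
      fix x
      show "(norm (of_real (f x) - complex_of_real (q x)))\<^sup>2 \<le> d\<^sup>2"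
        using q(2)[of x] d(1) by (intro power_mono) (auto simp flip: of_real_diff simp: less_imp_le)
    qed (use integrable_norm_square_diff[OF m bd q(1)] in auto)
    also have "\<dots> < e" using d e by simp
    finally show ?thesis using q(1) by (intro bexI[of _ "\<lambda>x. complex_of_real (q x)"])
  qed
  then show ?thesis using m bd by (auto simp: L2_approximable_def)
qed

text \<open>A Dynkin class argument starting from closed sets, whose indicators are bounded limits
  of continuous functions. A countable disjoint union is the limit of its finite subunions.\<close>

lemma L2_approximable_indicator:
  fixes A :: "'n::finite torus set"
  assumes "A \<in> sets borel"
  shows "L2_approximable (indicator A)"
proof -
  have "Int_stable (Collect closed :: 'n torus set set)" by (auto simp: Int_stable_def)
  moreover have "(Collect closed :: 'n torus set set) \<subseteq> Pow UNIV" by simp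
  moreover have "A \<in> sigma_sets UNIV (Collect closed)"
    using assms by (simp add: borel_eq_closed)
  ultimately show ?thesis
  proof (induction rule: sigma_sets_induct_disjoint)
    case (basic A)
    show ?case
    proof (cases "A = {}")
      case True
      then show ?thesis by (auto intro: L2_approximable_continuous)
    next
      case False
      show ?thesis
      proof (rule L2_approximable_limit)
        show "L2_approximable (\<lambda>x. max 0 (1 - real j * infdist x A))" for j
          by (intro L2_approximable_continuous continuous_intros)
        show "\<bar>max 0 (1 - real j * infdist x A)\<bar> \<le> 1" for j x by (simp add: infdist_nonneg)
        show "(\<lambda>j. max 0 (1 - real j * infdist x A)) \<longlonglongrightarrow> indicator A x" for x
          using closed_indicator_limit[of A x] basic False by simp
      qed
    qed
  next
    case empty
    show ?case by (auto intro: L2_approximable_continuous)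
  next
    case (compl A)
    have "L2_approximable (\<lambda>x. 1 + (- 1) * indicator A x)"
      by (intro L2_approximable_add L2_approximable_scale compl L2_approximable_continuous) auto
    moreover have "(\<lambda>x. 1 + (- 1) * indicator A x) = (indicator (UNIV - A) :: _ \<Rightarrow> real)"
      by (auto simp: indicator_def)
    ultimately show ?case by simp
  next
    case (union A)
    have "L2_approximable (indicator (\<Union>i<j. A i))" for j :: nat
    proof (induction j)
      case 0
      show ?case by (auto intro: L2_approximable_continuous)
    next
      case (Suc j)
      have "A j \<inter> A i = {}" if "i < j" for i
        using disjoint_family_onD[OF union(1), of j i] that by simp
      then have "A j \<inter> (\<Union>i<j. A i) = {}" by blast
      then have "indicator (\<Union>i<Suc j. A i) = (\<lambda>x. indicator (A j) x + indicator (\<Union>i<j. A i) x :: real)"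
        by (auto simp: fun_eq_iff lessThan_Suc indicator_def)
      then show ?case using L2_approximable_add[OF union(3)[of j] Suc] by simp
    qed
    then show ?case
    proof (rule L2_approximable_limit[where C = 1])
      show "\<bar>indicator (\<Union>i<j. A i) x :: real\<bar> \<le> 1" for j x by (simp add: indicator_def)
    qed (rule LIMSEQ_indicator_UN)
  qed
qed

lemma L2_approximable_bounded:
  fixes f :: "'n::finite torus \<Rightarrow> real"
  assumes f: "f \<in> borel_measurable borel" "\<And>x. 0 \<le> f x" "\<And>x. f x \<le> C"
  shows "L2_approximable f"
proof -
  \<comment> \<open>The bound is part of the inductive claim because the approximating functions
    differ from \<open>f\<close>; they inherit the bound by monotonicity.\<close>
  have "(\<exists>C. \<forall>x. f x \<le> C) \<longrightarrow> L2_approximable f"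
    using f(1,2)
  proof (induction rule: borel_measurable_induct_real)
    case (set A)
    then show ?case by (simp add: L2_approximable_indicator)
  next
    case (mult u c)
    show ?case
    proof
      assume "\<exists>C. \<forall>x. c * u x \<le> C"
      then obtain C where C: "\<And>x. c * u x \<le> C" by blast
      show "L2_approximable (\<lambda>x. c * u x)"
      proof (cases "c = 0")
        case True
        then show ?thesis by (auto intro: L2_approximable_continuous)
      next
        case False
        then have "u x \<le> C / c" for x using C[of x] mult.hyps(1) by (simp add: field_simps)
        then show ?thesis using mult.IH by (auto intro: L2_approximable_scale)
      qed
    qed
  next
    case (add u v)
    show ?case
    proof
      assume "\<exists>C. \<forall>x. v x + u x \<le> C"
      then obtain C where C: "\<And>x. v x + u x \<le> C" by blast
      have "u x \<le> C" "v x \<le> C" for x using C[of x] add.hyps(2,4)[of x] by linarith+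
      then show "L2_approximable (\<lambda>x. v x + u x)"
        using add.IH by (intro L2_approximable_add) blast+
    qed
  next
    case (seq U)
    show ?case
    proof
      assume "\<exists>C. \<forall>x. f x \<le> C"
      then obtain C where C: "\<And>x. f x \<le> C" by blast
      have U: "U i x \<le> f x" for i x
        using seq.hyps(3,4) by (intro incseq_le) (auto simp: incseq_def le_fun_def)
      have UC: "U i x \<le> C" for i x using U C order_trans by blast
      show "L2_approximable f"
      proof (rule L2_approximable_limit)
        show "L2_approximable (U i)" for i using seq.IH[of i] UC by blast
        show "\<bar>U i x\<bar> \<le> C" for i x using UC[of i x] seq.hyps(2)[of i x] by simp
        show "(\<lambda>i. U i x) \<longlonglongrightarrow> f x" for x using seq.hyps(4) by simp
      qed
    qed
  qed
  then show ?thesis using f(3) by blast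
qed

section \<open>Parseval and Bessel\<close>

lemma parseval_trig_sum:
  fixes b :: "int ^ 'n \<Rightarrow> complex"
  assumes "finite K"
  shows "(\<integral>\<^sub>T x. (norm (\<Sum>k\<in>K. b k * chi k x))\<^sup>2) = (\<Sum>k\<in>K. (norm (b k))\<^sup>2)"
proof -
  let ?p = "\<lambda>x. \<Sum>k\<in>K. b k * chi k x"
  have i: "integrable torus_measure (\<lambda>x. b k * cnj (b l) * chi (k - l) x)" for k l
    by simp
  have eq: "complex_of_real ((norm (?p x))\<^sup>2) = (\<Sum>k\<in>K. \<Sum>l\<in>K. b k * cnj (b l) * chi (k - l) x)" for x
  proof -
    have "complex_of_real ((norm (?p x))\<^sup>2) = ?p x * cnj (?p x)" by (rule complex_norm_square)
    also have "\<dots> = (\<Sum>k\<in>K. \<Sum>l\<in>K. (b k * chi k x) * cnj (b l * chi l x))"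
      by (simp only: cnj_sum sum_product)
    also have "\<dots> = (\<Sum>k\<in>K. \<Sum>l\<in>K. b k * cnj (b l) * chi (k - l) x)"
      using chi_add_left[of _ "- _" x] by (intro sum.cong refl) (simp add: cnj_chi)
    finally show ?thesis .
  qed
  have "complex_of_real (\<integral>\<^sub>T x. (norm (?p x))\<^sup>2) = (\<integral>\<^sub>T x. complex_of_real ((norm (?p x))\<^sup>2))"
    by (rule integral_complex_of_real[symmetric])
  also have "\<dots> = (\<Sum>k\<in>K. \<Sum>l\<in>K. b k * cnj (b l) * (\<integral>\<^sub>T x. chi (k - l) x))"
    unfolding eq by (simp add: i Bochner_Integration.integral_sum)
  also have "\<dots> = (\<Sum>k\<in>K. b k * cnj (b k))"
    by (simp add: integral_chi if_distrib assms cong: if_cong)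
  also have "\<dots> = complex_of_real (\<Sum>k\<in>K. (norm (b k))\<^sup>2)"
    by (simp only: complex_norm_square of_real_sum)
  finally show ?thesis by (simp only: of_real_eq_iff)
qed

lemma bessel_inequality:
  fixes f :: "'n::finite torus \<Rightarrow> real"
  assumes f: "f \<in> borel_measurable borel" "\<And>x. \<bar>f x\<bar> \<le> C" and K: "finite K"
  shows "(\<Sum>k\<in>K. (\<integral>\<^sub>T x. f x * Re (chi k x))\<^sup>2 + (\<integral>\<^sub>T x. f x * Im (chi k x))\<^sup>2)
    \<le> (\<integral>\<^sub>T x. (f x)\<^sup>2)"
proof -
  define s t where "s k = (\<integral>\<^sub>T x. f x * Re (chi k x))"
    and "t k = (\<integral>\<^sub>T x. f x * Im (chi k x))" for k
  \<comment> \<open>The Fourier coefficient of \<open>f\<close> at \<open>k\<close>. Its real and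
    imaginary parts are kept apart because the averaging operators act on real functions.\<close>
  define b where "b k = Complex (s k) (- t k)" for k
  let ?p = "\<lambda>x. \<Sum>k\<in>K. b k * chi k x"
  have C0: "0 \<le> C" using f(2)[of undefined] by linarith
  have mp: "?p \<in> borel_measurable borel" by measurable
  have bp: "norm (?p x) \<le> (\<Sum>k\<in>K. norm (b k))" for x
    by (rule order_trans[OF norm_sum]) (simp add: norm_mult)
  have sq: "integrable torus_measure (\<lambda>x. (f x)\<^sup>2)"
    using f by (intro torus_integrable_bounded[where C = "C\<^sup>2"]) (auto simp: abs_le_square_iff[symmetric] C0)
  have pq: "integrable torus_measure (\<lambda>x. (norm (?p x))\<^sup>2)"
    by (rule integrable_norm_square_bounded[OF mp]) (use bp in blast)
  have re: "\<bar>Re (chi k x)\<bar> \<le> 1" "\<bar>Im (chi k x)\<bar> \<le> 1" for k x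
    using abs_Re_le_cmod[of "chi k x"] abs_Im_le_cmod[of "chi k x"] by simp_all
  have "\<bar>f x\<bar> * \<bar>Re (chi k x)\<bar> \<le> C * 1" "\<bar>f x\<bar> * \<bar>Im (chi k x)\<bar> \<le> C * 1" for k x
    using f(2) re C0 by (auto intro!: mult_mono simp del: mult_1_right)
  then have i: "integrable torus_measure (\<lambda>x. f x * Re (chi k x))" "integrable torus_measure (\<lambda>x. f x * Im (chi k x))" for k
    using f(1) by (auto intro!: torus_integrable_bounded[where C = C] simp: abs_mult)
  have fp: "f x * Re (?p x) = (\<Sum>k\<in>K. s k * (f x * Re (chi k x)) + t k * (f x * Im (chi k x)))" for x
    by (simp add: b_def sum_distrib_left algebra_simps)
  have ifp: "integrable torus_measure (\<lambda>x. f x * Re (?p x))"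
    unfolding fp using i by simp
  have "(\<integral>\<^sub>T x. f x * Re (?p x)) = (\<Sum>k\<in>K. s k * s k + t k * t k)"
    unfolding fp using i by (simp add: s_def t_def Bochner_Integration.integral_sum)
  then have 1: "(\<integral>\<^sub>T x. f x * Re (?p x)) = (\<Sum>k\<in>K. (s k)\<^sup>2 + (t k)\<^sup>2)"
    by (simp add: power2_eq_square)
  have 2: "(\<integral>\<^sub>T x. (norm (?p x))\<^sup>2) = (\<Sum>k\<in>K. (s k)\<^sup>2 + (t k)\<^sup>2)"
    unfolding parseval_trig_sum[OF K] by (simp add: b_def cmod_power2)
  have "0 \<le> (\<integral>\<^sub>T x. (f x)\<^sup>2 - 2 * (f x * Re (?p x)) + (norm (?p x))\<^sup>2)"
  proof (rule Bochner_Integration.integral_nonneg)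
    fix x
    have "0 \<le> (f x - Re (?p x))\<^sup>2 + (Im (?p x))\<^sup>2" by simp
    also have "\<dots> = (f x)\<^sup>2 - 2 * (f x * Re (?p x)) + (norm (?p x))\<^sup>2"
      unfolding cmod_power2 power2_diff by simp
    finally show "0 \<le> (f x)\<^sup>2 - 2 * (f x * Re (?p x)) + (norm (?p x))\<^sup>2" .
  qed
  also have "\<dots> = (\<integral>\<^sub>T x. (f x)\<^sup>2) - 2 * (\<integral>\<^sub>T x. f x * Re (?p x))
      + (\<integral>\<^sub>T x. (norm (?p x))\<^sup>2)"
    using sq ifp pq by simp
  finally show ?thesis unfolding 1 2 by (simp add: s_def t_def)
qed

section \<open>Averaging operators\<close>

text \<open>Used twice below: for the automorphisms on the torus with Haar measure, and for the
  transposed matrices on the nonzero lattice points with counting measure.\<close>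

locale averaging_operator =
  fixes M :: "'x measure" and I :: "'g set" and w :: "'g \<Rightarrow> real" and \<alpha> :: "'g \<Rightarrow> 'x \<Rightarrow> 'x"
  assumes finite_I: "finite I" and w_pos: "g \<in> I \<Longrightarrow> 0 < w g" and w_sum: "(\<Sum>g\<in>I. w g) = 1"
    and \<alpha>_measurable: "g \<in> I \<Longrightarrow> \<alpha> g \<in> measurable M M"
    and \<alpha>_preserving: "g \<in> I \<Longrightarrow> distr M M (\<alpha> g) = M"
begin

definition average :: "('x \<Rightarrow> real) \<Rightarrow> 'x \<Rightarrow> real" where
  "average f = (\<lambda>x. \<Sum>g\<in>I. w g * f (\<alpha> g x))"

definition square_integrable :: "('x \<Rightarrow> real) \<Rightarrow> bool" where
  "square_integrable f \<longleftrightarrow> f \<in> borel_measurable M \<and> integrable M (\<lambda>x. (f x)\<^sup>2)"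

definition energy :: "('x \<Rightarrow> real) \<Rightarrow> real" where
  "energy f = (\<integral>x. (f x)\<^sup>2 \<partial>M)"

lemma I_nonempty: "I \<noteq> {}"
  using w_sum by auto

lemma w_nonneg: "g \<in> I \<Longrightarrow> 0 \<le> w g"
  using w_pos by (simp add: less_imp_le)

lemma energy_nonneg: "0 \<le> energy f"
  by (simp add: energy_def)

lemma integrable_compose:
  assumes "g \<in> I" "integrable M (f :: 'x \<Rightarrow> real)"
  shows "integrable M (\<lambda>x. f (\<alpha> g x))"
  using assms integrable_distr[of "\<alpha> g" M M f] \<alpha>_measurable \<alpha>_preserving by simp

lemma integral_compose:
  assumes "g \<in> I" "f \<in> borel_measurable M"
  shows "(\<integral>x. f (\<alpha> g x) \<partial>M) = (\<integral>x. (f x :: real) \<partial>M)"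
  using integral_distr[of "\<alpha> g" M M f] assms \<alpha>_measurable \<alpha>_preserving by simp

lemma square_integrable_mult:
  assumes "square_integrable f" "square_integrable h"
  shows "integrable M (\<lambda>x. f x * h x)"
proof (rule Bochner_Integration.integrable_bound)
  show "integrable M (\<lambda>x. (f x)\<^sup>2 + (h x)\<^sup>2)"
    using assms by (simp add: square_integrable_def)
  show "(\<lambda>x. f x * h x) \<in> borel_measurable M"
    using assms by (auto simp: square_integrable_def)
  have "\<bar>a * b\<bar> \<le> a\<^sup>2 + b\<^sup>2" for a b :: real
  proof -
    have "2 * \<bar>a * b\<bar> \<le> a\<^sup>2 + b\<^sup>2"
      using sum_squares_bound[of "\<bar>a\<bar>" "\<bar>b\<bar>"] by (simp add: abs_mult)
    then show ?thesis using abs_ge_zero[of "a * b"] by linarith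
  qed
  then show "AE x in M. norm (f x * h x) \<le> norm ((f x)\<^sup>2 + (h x)\<^sup>2)" by simp
qed

lemma square_integrable_add:
  assumes "square_integrable f" "square_integrable h"
  shows "square_integrable (\<lambda>x. f x + h x)"
proof -
  have "integrable M (\<lambda>x. (f x)\<^sup>2 + (h x)\<^sup>2 + 2 * (f x * h x))"
    using square_integrable_mult[OF assms] assms by (simp add: square_integrable_def)
  then show ?thesis using assms by (auto simp: square_integrable_def power2_sum algebra_simps)
qed

lemma square_integrable_scale: "square_integrable f \<Longrightarrow> square_integrable (\<lambda>x. c * f x)"
  by (auto simp: square_integrable_def power_mult_distrib)

lemma square_integrable_diff:
  assumes "square_integrable f" "square_integrable h"
  shows "square_integrable (\<lambda>x. f x - h x)"
  using square_integrable_add[OF assms(1) square_integrable_scale[OF assms(2), of "-1"]] by simp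

lemma square_integrable_compose:
  assumes "g \<in> I" "square_integrable f"
  shows "square_integrable (\<lambda>x. f (\<alpha> g x))"
  using assms integrable_compose[of g "\<lambda>x. (f x)\<^sup>2"] measurable_compose[OF \<alpha>_measurable, of g f borel]
  by (auto simp: square_integrable_def)

lemma energy_compose:
  assumes "g \<in> I" "square_integrable f"
  shows "energy (\<lambda>x. f (\<alpha> g x)) = energy f"
  using assms integral_compose[of g "\<lambda>x. (f x)\<^sup>2"] by (auto simp: square_integrable_def energy_def)

lemma square_integrable_average:
  assumes "square_integrable f"
  shows "square_integrable (average f)"
proof -
  have "square_integrable (\<lambda>x. \<Sum>g\<in>J. w g * f (\<alpha> g x))" if "J \<subseteq> I" for J
    using finite_subset[OF that finite_I] that
  proof induction
    case empty
    then show ?case by (simp add: square_integrable_def)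
  next
    case (insert g J)
    then have "square_integrable (\<lambda>x. w g * f (\<alpha> g x) + (\<Sum>g\<in>J. w g * f (\<alpha> g x)))"
      by (intro square_integrable_add square_integrable_scale square_integrable_compose assms) auto
    then show ?case using insert by simp
  qed
  then show ?thesis by (simp add: average_def)
qed

lemma square_integrable_average_power:
  "square_integrable f \<Longrightarrow> square_integrable ((average ^^ t) f)"
  by (induction t) (auto intro: square_integrable_average)

text \<open>Pointwise this is the variance formula for \<open>f (\<alpha> g x)\<close> with
  \<open>g\<close> random. After integration, invariance of the measure replaces each second moment
  by \<open>energy f\<close>.\<close>

lemma average_variance:
  assumes f: "square_integrable f"
  shows "(\<Sum>g\<in>I. w g * energy (\<lambda>x. f (\<alpha> g x) - average f x)) = energy f - energy (average f)"
proof -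
  have fg: "square_integrable (\<lambda>x. f (\<alpha> g x))" if "g \<in> I" for g
    using that f by (rule square_integrable_compose)
  have Tf: "square_integrable (average f)" using f by (rule square_integrable_average)
  have i1: "integrable M (\<lambda>x. (f (\<alpha> g x) - average f x)\<^sup>2)" if "g \<in> I" for g
    using square_integrable_diff[OF fg[OF that] Tf] by (simp add: square_integrable_def)
  have i2: "integrable M (\<lambda>x. (f (\<alpha> g x))\<^sup>2)" if "g \<in> I" for g
    using fg[OF that] by (simp add: square_integrable_def)
  have i3: "integrable M (\<lambda>x. (average f x)\<^sup>2)"
    using Tf by (simp add: square_integrable_def)
  have "(\<Sum>g\<in>I. w g * energy (\<lambda>x. f (\<alpha> g x) - average f x))
     = (\<integral>x. (\<Sum>g\<in>I. w g * (f (\<alpha> g x) - average f x)\<^sup>2) \<partial>M)"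
    unfolding energy_def using i1 by (subst Bochner_Integration.integral_sum) auto
  also have "\<dots> = (\<integral>x. (\<Sum>g\<in>I. w g * (f (\<alpha> g x))\<^sup>2) - (average f x)\<^sup>2 \<partial>M)"
  proof (rule Bochner_Integration.integral_cong[OF refl])
    fix x
    have "(\<Sum>g\<in>I. w g * (f (\<alpha> g x) - average f x)\<^sup>2)
      = (\<Sum>g\<in>I. w g * (f (\<alpha> g x))\<^sup>2 - 2 * average f x * (w g * f (\<alpha> g x)) + (average f x)\<^sup>2 * w g)"
      by (rule sum.cong) (auto simp: power2_eq_square algebra_simps)
    also have "\<dots> = (\<Sum>g\<in>I. w g * (f (\<alpha> g x))\<^sup>2) - 2 * average f x * average f x + (average f x)\<^sup>2 * 1"
      by (simp only: sum.distrib sum_subtractf sum_distrib_left[symmetric] w_sum) (simp add: average_def)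
    finally show "(\<Sum>g\<in>I. w g * (f (\<alpha> g x) - average f x)\<^sup>2) = (\<Sum>g\<in>I. w g * (f (\<alpha> g x))\<^sup>2) - (average f x)\<^sup>2"
      by (simp add: power2_eq_square)
  qed
  also have "\<dots> = (\<Sum>g\<in>I. w g * energy (\<lambda>x. f (\<alpha> g x))) - energy (average f)"
    unfolding energy_def using i2 i3
    by (subst Bochner_Integration.integral_diff) (auto simp: Bochner_Integration.integral_sum)
  also have "(\<Sum>g\<in>I. w g * energy (\<lambda>x. f (\<alpha> g x))) = energy f"
    by (simp add: energy_compose f sum_distrib_right[symmetric] w_sum)
  finally show ?thesis .
qed

lemma energy_average_le:
  assumes "square_integrable f"
  shows "energy (average f) \<le> energy f"
proof -
  have "0 \<le> (\<Sum>g\<in>I. w g * energy (\<lambda>x. f (\<alpha> g x) - average f x))"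
    by (intro sum_nonneg mult_nonneg_nonneg w_nonneg energy_nonneg)
  then show ?thesis using average_variance[OF assms] by simp
qed

lemma energy_average_power_antimono:
  assumes "square_integrable f" "s \<le> t"
  shows "energy ((average ^^ t) f) \<le> energy ((average ^^ s) f)"
  using assms(2)
proof (induction rule: dec_induct)
  case (step n)
  then show ?case
    using energy_average_le[OF square_integrable_average_power[OF assms(1)], of n] by simp
qed simp

text \<open>Cauchy-Schwarz for the product of \<open>u - v\<close> and \<open>u + v\<close>, in
  weighted additive form. A small weight makes the last term small, and closeness of
  \<open>u\<close> and \<open>v\<close> then controls the first.\<close>

lemma integral_abs_diff_squares_le:
  assumes u: "square_integrable u" and v: "square_integrable v" and "\<eta> > 0"
  shows "(\<integral>x. \<bar>(u x)\<^sup>2 - (v x)\<^sup>2\<bar> \<partial>M)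
    \<le> energy (\<lambda>x. u x - v x) / (2 * \<eta>) + \<eta> * (energy u + energy v)"
proof -
  note i = u[unfolded square_integrable_def] v[unfolded square_integrable_def]
    square_integrable_diff[OF u v, unfolded square_integrable_def]
  have "(\<integral>x. \<bar>(u x)\<^sup>2 - (v x)\<^sup>2\<bar> \<partial>M)
    \<le> (\<integral>x. (u x - v x)\<^sup>2 / (2 * \<eta>) + \<eta> * ((u x)\<^sup>2 + (v x)\<^sup>2) \<partial>M)"
  proof (rule integral_mono)
    fix x
    define a b where "a = \<bar>u x - v x\<bar>" and "b = \<bar>u x + v x\<bar>"
    have "0 \<le> (a - \<eta> * b)\<^sup>2" by simp
    then have "2 * \<eta> * (a * b) \<le> a\<^sup>2 + \<eta>\<^sup>2 * b\<^sup>2"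
      by (simp add: power2_diff power_mult_distrib algebra_simps)
    then have "a * b \<le> a\<^sup>2 / (2 * \<eta>) + \<eta> * b\<^sup>2 / 2"
      using \<open>\<eta> > 0\<close> by (simp add: field_simps power2_eq_square)
    moreover have "b\<^sup>2 \<le> 2 * ((u x)\<^sup>2 + (v x)\<^sup>2)"
      using sum_squares_bound[of "u x" "v x"] by (simp add: b_def power2_sum)
    then have "\<eta> * b\<^sup>2 / 2 \<le> \<eta> * ((u x)\<^sup>2 + (v x)\<^sup>2)"
      using \<open>\<eta> > 0\<close> by (simp add: mult_left_mono)
    moreover have "\<bar>(u x)\<^sup>2 - (v x)\<^sup>2\<bar> = a * b"
      by (simp add: a_def b_def abs_mult[symmetric] power2_eq_square algebra_simps)
    ultimately show "\<bar>(u x)\<^sup>2 - (v x)\<^sup>2\<bar> \<le> (u x - v x)\<^sup>2 / (2 * \<eta>) + \<eta> * ((u x)\<^sup>2 + (v x)\<^sup>2)"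
      by (simp add: a_def)
  qed (use i in auto)
  also have "\<dots> = energy (\<lambda>x. u x - v x) / (2 * \<eta>) + \<eta> * (energy u + energy v)"
    using i by (simp add: energy_def)
  finally show ?thesis .
qed

text \<open>If \<open>N\<close> averagings lose hardly any energy, the variance identity shows that \<open>g\<close> moves each
  iterate close to the next one, so the mean of the squares of the iterates is almost invariant.\<close>

lemma almost_invariant_density:
  assumes "e > 0"
    and flat: "\<And>N \<delta>. \<delta> > 0 \<Longrightarrow> \<exists>f. square_integrable f \<and> (1 - \<delta>) * energy f < energy ((average ^^ N) f)"
  obtains p :: "'x \<Rightarrow> real" where "integrable M p" "\<And>x. 0 \<le> p x" "(\<integral>x. p x \<partial>M) = 1"
    "\<And>g. g \<in> I \<Longrightarrow> (\<integral>x. \<bar>p (\<alpha> g x) - p x\<bar> \<partial>M) \<le> e"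
proof -
  define wm where "wm = Min (w ` I)"
  have wm: "0 < wm" "\<And>g. g \<in> I \<Longrightarrow> wm \<le> w g"
    unfolding wm_def using finite_I I_nonempty w_pos by auto
  \<comment> \<open>The final error consists of the one-step displacements, the terms weighted by
    \<open>\<eta>\<close>, and two boundary terms. The choices of \<open>\<eta>\<close>,
    \<open>\<delta>\<close> and \<open>N\<close> make each of the three at most a quarter of
    \<open>e * N * A / 2\<close>, which is at most \<open>e * Z\<close>; the cap 1/2 on
    \<open>\<delta>\<close> gives the lower bound for \<open>Z\<close>.\<close>
  define \<eta> where "\<eta> = e / 16"
  have \<eta>: "\<eta> > 0" using \<open>e > 0\<close> by (simp add: \<eta>_def)
  define \<delta> where "\<delta> = min (1 / 2) (wm * \<eta> * e / 4)"
  have \<delta>: "\<delta> > 0" "\<delta> \<le> 1 / 2" "\<delta> \<le> wm * \<eta> * e / 4"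
    unfolding \<delta>_def using wm \<eta> \<open>e > 0\<close> by auto
  obtain N :: nat where N: "16 / e < real N" using reals_Archimedean2 by blast
  then have "N > 0" using \<open>e > 0\<close> by (metis divide_pos_pos gr0I not_less_iff_gr_or_eq of_nat_0 zero_less_numeral)
  obtain f where f: "square_integrable f" "(1 - \<delta>) * energy f < energy ((average ^^ N) f)"
    using flat[OF \<delta>(1)] by blast
  define b where "b j = (average ^^ j) f" for j
  define A where "A = energy f"
  have b: "square_integrable (b j)" for j
    using f(1) by (simp add: b_def square_integrable_average_power)
  have A: "A > 0"
  proof (rule ccontr)
    assume "\<not> A > 0"
    then have "energy f = 0" using energy_nonneg[of f] by (simp add: A_def)
    then show False
      using f energy_average_power_antimono[of f 0 N] by simp
  qed
  have bA: "energy (b j) \<le> A" for j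
    using energy_average_power_antimono[OF f(1), of 0 j] by (simp add: b_def A_def)
  have bl: "(1 - \<delta>) * A < energy (b j)" if "j \<le> N" for j
    using energy_average_power_antimono[OF f(1) that] f(2) by (simp add: b_def A_def)
  have step: "energy (\<lambda>x. b j (\<alpha> g x) - b (Suc j) x) \<le> \<delta> * A / wm" if "j < N" "g \<in> I" for j g
  proof -
    have "w g * energy (\<lambda>x. b j (\<alpha> g x) - average (b j) x)
      \<le> (\<Sum>g\<in>I. w g * energy (\<lambda>x. b j (\<alpha> g x) - average (b j) x))"
      by (rule member_le_sum) (auto simp: that finite_I w_nonneg energy_nonneg)
    also have "\<dots> = energy (b j) - energy (b (Suc j))"
      using average_variance[OF b, of j] by (simp add: b_def)
    also have "\<dots> \<le> \<delta> * A"
      using bA[of j] bl[of "Suc j"] that(1) by (simp add: algebra_simps)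
    finally have "wm * energy (\<lambda>x. b j (\<alpha> g x) - b (Suc j) x) \<le> \<delta> * A"
      using mult_right_mono[OF wm(2)[OF that(2)] energy_nonneg, of "\<lambda>x. b j (\<alpha> g x) - b (Suc j) x"]
      by (simp add: b_def)
    then show ?thesis using wm(1) by (simp add: field_simps)
  qed
  define Z where "Z = (\<Sum>j<N. energy (b j))"
  have "(\<Sum>j<N. A / 2) \<le> Z"
    unfolding Z_def
  proof (rule sum_mono)
    fix j assume "j \<in> {..<N}"
    then have "(1 - \<delta>) * A < energy (b j)" using bl by simp
    moreover have "(1 - \<delta>) * A \<ge> 1 / 2 * A" using \<delta>(2) A by (intro mult_right_mono) auto
    ultimately show "A / 2 \<le> energy (b j)" by simp
  qed
  then have Z: "real N * A / 2 \<le> Z" by simp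
  have "0 < real N * A" using A \<open>N > 0\<close> by simp
  then have Z0: "Z > 0" using Z by linarith
  define p where "p x = (\<Sum>j<N. (b j x)\<^sup>2) / Z" for x
  have bi: "integrable M (\<lambda>x. (b j x)\<^sup>2)" for j using b by (simp add: square_integrable_def)
  have pi: "integrable M p" unfolding p_def using bi by simp
  have close: "(\<integral>x. \<bar>p (\<alpha> g x) - p x\<bar> \<partial>M) \<le> e" if g: "g \<in> I" for g
  proof -
    let ?d = "\<lambda>j x. (b j (\<alpha> g x))\<^sup>2 - (b (Suc j) x)\<^sup>2"
    have bgi: "integrable M (\<lambda>x. (b j (\<alpha> g x))\<^sup>2)" for j
      using square_integrable_compose[OF g b[of j]] by (simp add: square_integrable_def)
    have "(\<integral>x. \<bar>p (\<alpha> g x) - p x\<bar> \<partial>M) \<le> (\<integral>x. ((\<Sum>j<N. \<bar>?d j x\<bar>) + (b N x)\<^sup>2 + (b 0 x)\<^sup>2) / Z \<partial>M)"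
    proof (rule integral_mono)
      fix x
      have "(\<Sum>j<N. (b j (\<alpha> g x))\<^sup>2) - (\<Sum>j<N. (b j x)\<^sup>2)
         = (\<Sum>j<N. ?d j x) + ((\<Sum>j<N. (b (Suc j) x)\<^sup>2) - (\<Sum>j<N. (b j x)\<^sup>2))"
        by (simp add: sum_subtractf)
      \<comment> \<open>The element \<open>g\<close> moves iterate \<open>j\<close> close to iterate
        \<open>j + 1\<close>, so the index shift has to be undone; by telescoping this costs only
        the two boundary squares.\<close>
      also have "(\<Sum>j<N. (b (Suc j) x)\<^sup>2) - (\<Sum>j<N. (b j x)\<^sup>2) = (b N x)\<^sup>2 - (b 0 x)\<^sup>2"
        by (simp add: sum_subtractf[symmetric] sum_lessThan_telescope[of "\<lambda>j. (b j x)\<^sup>2"])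
      finally have "\<bar>(\<Sum>j<N. (b j (\<alpha> g x))\<^sup>2) - (\<Sum>j<N. (b j x)\<^sup>2)\<bar>
          \<le> \<bar>\<Sum>j<N. ?d j x\<bar> + (b N x)\<^sup>2 + (b 0 x)\<^sup>2"
        using zero_le_power2[of "b N x"] zero_le_power2[of "b 0 x"] by linarith
      also have "\<dots> \<le> (\<Sum>j<N. \<bar>?d j x\<bar>) + (b N x)\<^sup>2 + (b 0 x)\<^sup>2"
        by (intro add_right_mono sum_abs)
      finally show "\<bar>p (\<alpha> g x) - p x\<bar> \<le> ((\<Sum>j<N. \<bar>?d j x\<bar>) + (b N x)\<^sup>2 + (b 0 x)\<^sup>2) / Z"
        using Z0 by (simp add: p_def diff_divide_distrib[symmetric] divide_right_mono)
    qed (use pi bi bgi integrable_compose[OF g] in auto)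
    also have "\<dots> = ((\<Sum>j<N. \<integral>x. \<bar>?d j x\<bar> \<partial>M) + energy (b N) + energy (b 0)) / Z"
      using bi bgi by (simp add: energy_def)
    also have "\<dots> \<le> ((\<Sum>j<N. \<delta> * A / wm / (2 * \<eta>) + \<eta> * (A + A)) + A + A) / Z"
    proof (intro divide_right_mono add_mono sum_mono bA)
      fix j assume j: "j \<in> {..<N}"
      have "(\<integral>x. \<bar>?d j x\<bar> \<partial>M) \<le> energy (\<lambda>x. b j (\<alpha> g x) - b (Suc j) x) / (2 * \<eta>)
          + \<eta> * (energy (\<lambda>x. b j (\<alpha> g x)) + energy (b (Suc j)))"
        by (rule integral_abs_diff_squares_le[OF square_integrable_compose[OF g b] b \<eta>])
      also have "\<dots> \<le> \<delta> * A / wm / (2 * \<eta>) + \<eta> * (A + A)"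
        using step[of j g] j g \<eta> bA energy_compose[OF g b]
        by (intro add_mono divide_right_mono mult_left_mono) auto
      finally show "(\<integral>x. \<bar>?d j x\<bar> \<partial>M) \<le> \<delta> * A / wm / (2 * \<eta>) + \<eta> * (A + A)" .
    qed (use Z0 in auto)
    also have "\<dots> \<le> e"
    proof -
      have "\<delta> / (wm * \<eta>) \<le> e / 4" using \<delta>(3) wm(1) \<eta> by (simp add: field_simps)
      then have "real N * A / 2 * (\<delta> / (wm * \<eta>)) \<le> real N * A / 2 * (e / 4)"
        using A by (intro mult_left_mono) auto
      moreover have "real N * (\<delta> * A / wm / (2 * \<eta>)) = real N * A / 2 * (\<delta> / (wm * \<eta>))"
        using wm(1) \<eta> by (simp add: field_simps)
      moreover have "real N * (\<eta> * (A + A)) = real N * A / 2 * (e / 4)"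
        by (simp add: \<eta>_def)
      moreover have "A + A \<le> real N * A / 2 * (e / 4)"
        using N A \<open>e > 0\<close> by (simp add: field_simps)
      moreover have "real N * A / 2 * e \<le> Z * e" using Z \<open>e > 0\<close> by (intro mult_right_mono) auto
      moreover have "0 \<le> real N * A / 2 * (e / 4)" using A \<open>e > 0\<close> by simp
      moreover have "real N * A / 2 * e = 4 * (real N * A / 2 * (e / 4))" by simp
      ultimately have "real N * (\<delta> * A / wm / (2 * \<eta>)) + real N * (\<eta> * (A + A)) + (A + A) \<le> Z * e"
        by linarith
      moreover have "(\<Sum>j<N. \<delta> * A / wm / (2 * \<eta>) + \<eta> * (A + A)) + A + A
          = real N * (\<delta> * A / wm / (2 * \<eta>)) + real N * (\<eta> * (A + A)) + (A + A)"
        by (simp add: distrib_left)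
      ultimately have "(\<Sum>j<N. \<delta> * A / wm / (2 * \<eta>) + \<eta> * (A + A)) + A + A \<le> Z * e" by simp
      then show ?thesis using Z0 by (metis pos_divide_le_eq mult.commute)
    qed
    finally show ?thesis .
  qed
  have "(\<integral>x. p x \<partial>M) = 1"
    unfolding p_def using bi Z0 by (simp add: Z_def energy_def)
  moreover have "0 \<le> p x" for x unfolding p_def using Z0 by (simp add: sum_nonneg)
  ultimately show thesis using that pi close by blast
qed

text \<open>Once almost invariant densities fail for one tolerance, some fixed power contracts every
  energy by a common factor. Energies never increase, so times between multiples of that power cost
  only a constant.\<close>

lemma spectral_gap_or_almost_invariant:
  assumes no: "\<not> (\<forall>e>0. \<exists>p :: 'x \<Rightarrow> real. integrable M p \<and> (\<forall>x. 0 \<le> p x) \<and> (\<integral>x. p x \<partial>M) = 1 \<and>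
    (\<forall>g\<in>I. (\<integral>x. \<bar>p (\<alpha> g x) - p x\<bar> \<partial>M) \<le> e))"
  obtains C \<theta> where "0 < C" "0 < \<theta>" "\<theta> < 1"
    "\<And>t f. square_integrable f \<Longrightarrow> energy ((average ^^ t) f) \<le> C * \<theta> ^ t * energy f"
proof -
  obtain e where e: "e > 0" "\<not> (\<exists>p :: 'x \<Rightarrow> real. integrable M p \<and> (\<forall>x. 0 \<le> p x) \<and> (\<integral>x. p x \<partial>M) = 1 \<and>
    (\<forall>g\<in>I. (\<integral>x. \<bar>p (\<alpha> g x) - p x\<bar> \<partial>M) \<le> e))" using no by blast
  have "\<not> (\<forall>N \<delta>. \<delta> > 0 \<longrightarrow> (\<exists>f. square_integrable f \<and> (1 - \<delta>) * energy f < energy ((average ^^ N) f)))"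
  proof
    assume "\<forall>N \<delta>. \<delta> > 0 \<longrightarrow> (\<exists>f. square_integrable f \<and> (1 - \<delta>) * energy f < energy ((average ^^ N) f))"
    then have "\<exists>f. square_integrable f \<and> (1 - \<delta>) * energy f < energy ((average ^^ N) f)" if "\<delta> > 0" for N \<delta>
      using that by blast
    from almost_invariant_density[OF e(1) this] obtain p :: "'x \<Rightarrow> real"
      where "integrable M p" "\<And>x. 0 \<le> p x" "(\<integral>x. p x \<partial>M) = 1"
        "\<And>g. g \<in> I \<Longrightarrow> (\<integral>x. \<bar>p (\<alpha> g x) - p x\<bar> \<partial>M) \<le> e" by blast
    then show False using e(2) by blast
  qed
  then obtain N \<delta>0 where \<delta>0: "\<delta>0 > 0"
    "\<And>f. square_integrable f \<Longrightarrow> energy ((average ^^ N) f) \<le> (1 - \<delta>0) * energy f"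
    by (metis not_le)
  \<comment> \<open>Capped so that the factor \<open>1 - \<delta>\<close> is positive and has a
    positive root.\<close>
  define \<delta> where "\<delta> = min \<delta>0 (1 / 2)"
  have \<delta>: "0 < \<delta>" "\<delta> < 1" "\<delta> \<le> \<delta>0" using \<delta>0(1) by (auto simp: \<delta>_def)
  have gap: "energy ((average ^^ N) f) \<le> (1 - \<delta>) * energy f" if "square_integrable f" for f
  proof -
    have "(1 - \<delta>0) * energy f \<le> (1 - \<delta>) * energy f"
      using \<delta> energy_nonneg by (intro mult_right_mono) auto
    then show ?thesis using \<delta>0(2)[OF that] by linarith
  qed
  \<comment> \<open>The exponent found may be 0; one more averaging makes it positive, so that the
    root can be taken.\<close>
  have "energy ((average ^^ Suc N) f) \<le> (1 - \<delta>) * energy f" if "square_integrable f" for f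
    using energy_average_power_antimono[OF that le_SucI[OF order_refl], of N] gap[OF that] by linarith
  then have "Suc N > 0 \<and> (\<forall>f. square_integrable f \<longrightarrow> energy ((average ^^ Suc N) f) \<le> (1 - \<delta>) * energy f)"
    by blast
  then obtain N' where N': "N' > 0"
    "\<And>f. square_integrable f \<Longrightarrow> energy ((average ^^ N') f) \<le> (1 - \<delta>) * energy f" by blast
  define \<theta> where "\<theta> = root N' (1 - \<delta>)"
  have \<theta>: "0 < \<theta>" "\<theta> < 1" "\<theta> ^ N' = 1 - \<delta>"
    using \<delta> N'(1) by (auto simp: \<theta>_def)
  have mult: "energy ((average ^^ (N' * q)) f) \<le> \<theta> ^ (N' * q) * energy f" if "square_integrable f" for q f
  proof (induction q)
    case (Suc q)
    have "energy ((average ^^ (N' * Suc q)) f) = energy ((average ^^ N') ((average ^^ (N' * q)) f))"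
      by (simp add: funpow_add)
    also have "\<dots> \<le> \<theta> ^ N' * energy ((average ^^ (N' * q)) f)"
      using N'(2)[OF square_integrable_average_power[OF that]] \<theta>(3) by simp
    also have "\<dots> \<le> \<theta> ^ N' * (\<theta> ^ (N' * q) * energy f)"
      using Suc \<theta>(1) by (intro mult_left_mono) auto
    finally show ?case by (simp add: power_add mult.assoc)
  qed simp
  have decay: "energy ((average ^^ t) f) \<le> 1 / (1 - \<delta>) * \<theta> ^ t * energy f" if f: "square_integrable f" for t f
  proof -
    have t: "t = N' * (t div N') + t mod N'" by simp
    have "energy ((average ^^ t) f) \<le> energy ((average ^^ (N' * (t div N'))) f)"
      by (rule energy_average_power_antimono[OF f]) simp
    also have "\<dots> \<le> \<theta> ^ (N' * (t div N')) * energy f" by (rule mult[OF f])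
    \<comment> \<open>The factor \<open>1 / (1 - \<delta>)\<close> pays for the remainder of
      \<open>t\<close> modulo \<open>N'\<close>.\<close>
    also have "\<theta> ^ (N' * (t div N')) \<le> 1 / (1 - \<delta>) * \<theta> ^ t"
    proof -
      have "\<theta> ^ N' \<le> \<theta> ^ (t mod N')"
        using \<theta> N'(1) by (intro power_decreasing) (auto simp: less_imp_le)
      then have "\<theta> ^ (N' * (t div N')) * (1 - \<delta>) \<le> \<theta> ^ (N' * (t div N')) * \<theta> ^ (t mod N')"
        using \<theta> by (intro mult_left_mono) auto
      also have "\<dots> = \<theta> ^ t" by (simp add: power_add[symmetric])
      finally show ?thesis using \<delta> by (simp add: field_simps)
    qed
    then have "\<theta> ^ (N' * (t div N')) * energy f \<le> 1 / (1 - \<delta>) * \<theta> ^ t * energy f"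
      using energy_nonneg by (rule mult_right_mono)
    finally show ?thesis .
  qed
  show thesis using that[of "1 / (1 - \<delta>)" \<theta>] \<theta> \<delta> decay by simp
qed

section \<open>Linearity, positivity and integrals of iterated averages\<close>

lemma average_apply: "average f x = (\<Sum>g\<in>I. w g * f (\<alpha> g x))"
  by (simp add: average_def)

lemma average_power_linear:
  "(average ^^ t) (\<lambda>x. \<Sum>i\<in>J. c i * F i x) = (\<lambda>x. \<Sum>i\<in>J. c i * (average ^^ t) (F i) x)"
proof (induction t)
  case (Suc t)
  have "average (\<lambda>x. \<Sum>i\<in>J. c i * (average ^^ t) (F i) x) = (\<lambda>x. \<Sum>i\<in>J. c i * average ((average ^^ t) (F i)) x)"
    by (simp add: fun_eq_iff average_apply sum_distrib_left mult.left_commute sum.swap[of _ J I])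
  then show ?case using Suc by simp
qed simp

lemma average_power_diff: "(average ^^ t) (\<lambda>x. f x - h x) = (\<lambda>x. (average ^^ t) f x - (average ^^ t) h x)"
  by (induction t) (simp_all add: average_apply fun_eq_iff right_diff_distrib sum_subtractf)

lemma average_power_const: "(average ^^ t) (\<lambda>x. c) = (\<lambda>x. c)"
  by (induction t) (simp_all add: fun_eq_iff average_apply sum_distrib_right[symmetric] w_sum)

lemma average_power_mono:
  assumes "\<And>x. f x \<le> h x"
  shows "(average ^^ t) f x \<le> (average ^^ t) h x"
  by (induction t arbitrary: x) (auto simp: average_apply assms intro!: sum_mono mult_left_mono w_nonneg)

lemma average_power_abs_le:
  assumes "\<And>x. \<bar>f x\<bar> \<le> C"
  shows "\<bar>(average ^^ t) f x\<bar> \<le> C"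
proof -
  have "(average ^^ t) f x \<le> C"
    using average_power_mono[of f "\<lambda>_. C" t x] abs_le_D1[OF assms] by (simp add: average_power_const)
  moreover have "(average ^^ t) (\<lambda>_. - C) x \<le> (average ^^ t) f x"
    using abs_le_D2[OF assms] by (intro average_power_mono) (simp add: minus_le_iff)
  ultimately show ?thesis by (simp add: average_power_const abs_le_iff)
qed

lemma integrable_average:
  assumes "integrable M f"
  shows "integrable M (average f)"
  unfolding average_def using assms integrable_compose by auto

lemma integral_average:
  assumes "integrable M f"
  shows "(\<integral>x. average f x \<partial>M) = (\<integral>x. f x \<partial>M)"
proof -
  have "(\<integral>x. average f x \<partial>M) = (\<Sum>g\<in>I. w g * (\<integral>x. f (\<alpha> g x) \<partial>M))"
    unfolding average_def using assms integrable_compose by (subst Bochner_Integration.integral_sum) auto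
  also have "\<dots> = (\<Sum>g\<in>I. w g * (\<integral>x. f x \<partial>M))"
    using assms integral_compose by (intro sum.cong refl) auto
  also have "\<dots> = (\<integral>x. f x \<partial>M)" by (simp add: sum_distrib_right[symmetric] w_sum)
  finally show ?thesis .
qed

lemma integral_average_power:
  assumes "integrable M f"
  shows "integrable M ((average ^^ t) f) \<and> (\<integral>x. (average ^^ t) f x \<partial>M) = (\<integral>x. f x \<partial>M)"
  by (induction t) (simp_all add: assms integrable_average integral_average)

end

section \<open>Decay of correlations\<close>

text \<open>Bessel's inequality controls only finite sums; for nonnegative functions such a bound
  passes to the counting-measure integral.\<close>

lemma count_space_integral_bound:
  fixes f :: "'a \<Rightarrow> real"
  assumes "\<And>x. 0 \<le> f x" "\<And>K. finite K \<Longrightarrow> K \<subseteq> X \<Longrightarrow> sum f K \<le> B"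
  shows "integrable (count_space X) f" "(\<integral>x. f x \<partial>count_space X) \<le> B"
proof -
  have s: "f summable_on X"
    by (rule nonneg_bdd_above_summable_on) (use assms in \<open>auto intro!: bdd_aboveI\<close>)
  then have "Infinite_Sum.abs_summable_on f X" by (simp add: assms(1))
  then have a: "Infinite_Set_Sum.abs_summable_on f X" using abs_summable_equivalent by blast
  then show "integrable (count_space X) f" by (simp add: Infinite_Set_Sum.abs_summable_on_def)
  have "(\<integral>x. f x \<partial>count_space X) = infsetsum f X" by (simp add: infsetsum_def)
  also have "\<dots> = infsum f X" by (rule infsetsum_infsum[OF a])
  also have "\<dots> \<le> B" using s assms(2) by (rule infsum_le_finite_sums)
  finally show "(\<integral>x. f x \<partial>count_space X) \<le> B" .
qed

lemma finite_sum_le_count_space_integral: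
  fixes f :: "'a \<Rightarrow> real"
  assumes "\<And>x. 0 \<le> f x" "integrable (count_space X) f" "finite K" "K \<subseteq> X"
  shows "sum f K \<le> (\<integral>x. f x \<partial>count_space X)"
proof -
  have a: "Infinite_Set_Sum.abs_summable_on f X"
    using assms(2) by (simp add: Infinite_Set_Sum.abs_summable_on_def)
  then have "Infinite_Sum.abs_summable_on f X" using abs_summable_equivalent by blast
  then have s: "f summable_on X" by (rule abs_summable_summable)
  have "sum f K \<le> infsum f X" by (rule finite_sum_le_infsum) (use s assms in auto)
  also have "\<dots> = infsetsum f X" by (rule infsetsum_infsum[OF a, symmetric])
  also have "\<dots> = (\<integral>x. f x \<partial>count_space X)" by (simp add: infsetsum_def)
  finally show ?thesis .
qed

lemma GLZ_inverse_two_sided: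
  fixes A :: "int ^ 'n ^ 'n"
  assumes "det A = 1 \<or> det A = - 1"
  shows "\<exists>B. B ** A = mat 1 \<and> A ** B = mat 1"
proof -
  obtain B where B: "det B = 1 \<or> det B = - 1" "B ** A = mat 1" using GLZ_inverse[OF assms] by blast
  obtain C where C: "C ** B = mat 1" using GLZ_inverse[OF B(1)] by blast
  have "C = A" using B(2) C by (metis matrix_mul_assoc matrix_mul_lid matrix_mul_rid)
  then show ?thesis using B(2) C by blast
qed

lemma bij_transpose_mult:
  fixes A :: "int ^ 'n ^ 'n"
  assumes "det A = 1 \<or> det A = - 1"
  shows "bij_betw (\<lambda>k. transpose A *v k) (- {0}) (- {0})"
proof -
  have "det (transpose A) = 1 \<or> det (transpose A) = - 1" using assms by simp
  from GLZ_inverse_two_sided[OF this] obtain B where B: "B ** transpose A = mat 1" "transpose A ** B = mat 1" by blast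
  have 1: "B *v (transpose A *v k) = k" "transpose A *v (B *v k) = k" for k
    using B by (simp_all add: matrix_vector_mul_assoc del: transpose_matrix_vector)
  show ?thesis
  proof (rule bij_betw_byWitness[where f' = "\<lambda>k. B *v k"])
    show "(\<lambda>k. transpose A *v k) ` (- {0}) \<subseteq> - {0}"
      using 1 by (metis (no_types, lifting) ComplI ComplD image_subsetI singletonD singletonI matrix_vector_mult_0_right)
    show "(\<lambda>k. B *v k) ` (- {0}) \<subseteq> - {0}"
      using 1 by (metis (no_types, lifting) ComplI ComplD image_subsetI singletonD singletonI matrix_vector_mult_0_right)
  qed (use 1 in auto)
qed

section \<open>The walk on the torus and its dual on the lattice\<close>

locale torus_walk =
  fixes S :: "(int ^ 'n::finite ^ 'n) set" and w :: "int ^ 'n ^ 'n \<Rightarrow> real"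
  assumes finite_S: "finite S" and w_pos: "g \<in> S \<Longrightarrow> 0 < w g" and w_sum: "(\<Sum>g\<in>S. w g) = 1"
    and GLZ: "g \<in> S \<Longrightarrow> det g = 1 \<or> det g = - 1"

sublocale torus_walk \<subseteq> T: averaging_operator torus_measure S w torus_act
proof
  fix g assume "g \<in> S"
  then have "det g \<noteq> 0" using GLZ by force
  then show "distr torus_measure torus_measure (torus_act g) = torus_measure"
    using torus_measure_act[of g] distr_cong[OF refl sets_torus_measure, of torus_measure "torus_act g" "torus_act g"] by simp
qed (use finite_S w_pos w_sum in \<open>auto simp: measurable_cong_sets[OF sets_torus_measure sets_torus_measure]\<close>)

text \<open>The frequency 0 carries the constants, which every averaging fixes, so a gap can be
  expected only on the remaining lattice points. Invertibility of the transposes makes each of them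
  permute this set.\<close>

sublocale torus_walk \<subseteq> F: averaging_operator "count_space (- {0})" S w "\<lambda>g k. transpose g *v k"
proof
  fix g assume "g \<in> S"
  then have b: "bij_betw (\<lambda>k. transpose g *v k) (- {0}) (- {0})" using GLZ by (intro bij_transpose_mult) auto
  then show "(\<lambda>k. transpose g *v k) \<in> count_space (- {0}) \<rightarrow>\<^sub>M count_space (- {0})"
    by (auto simp: bij_betw_def)
  show "distr (count_space (- {0})) (count_space (- {0})) (\<lambda>k. transpose g *v k) = count_space (- {0})"
    by (rule distr_bij_count_space[OF b])
qed (use finite_S w_pos w_sum in auto)

context torus_walk
begin

lemma measurable_average_power:
  assumes "f \<in> borel_measurable borel"
  shows "(T.average ^^ t) f \<in> borel_measurable borel"
proof (induction t)
  case (Suc t)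
  then have "(\<lambda>x. w g * (T.average ^^ t) f (torus_act g x)) \<in> borel_measurable borel" for g
    using measurable_compose[OF measurable_torus_act[of g] Suc] by simp
  then have "(\<lambda>x. T.average ((T.average ^^ t) f) x) \<in> borel_measurable borel"
    unfolding T.average_apply by (intro borel_measurable_sum)
  then show ?case by simp
qed (simp add: assms)

lemma integrable_mult_bounded:
  fixes f h :: "'n torus \<Rightarrow> real"
  assumes "f \<in> borel_measurable borel" "\<And>x. \<bar>f x\<bar> \<le> C" "h \<in> borel_measurable borel" "\<And>x. \<bar>h x\<bar> \<le> D"
  shows "integrable torus_measure (\<lambda>x. f x * h x)"
proof (rule torus_integrable_bounded[where C = "C * D"])
  show "norm (f x * h x) \<le> C * D" for x
    using assms(2,4) order_trans[OF abs_ge_zero assms(2)] by (auto simp: abs_mult intro!: mult_mono)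
qed (use assms in simp)

text \<open>The family \<open>h\<close> stands for the real or the imaginary parts of the
  characters. Covariance moves the averaging from points to frequencies, so integration against
  \<open>f\<close> turns the torus operator into the lattice operator.\<close>

lemma correlation_family:
  fixes h :: "int ^ 'n \<Rightarrow> 'n torus \<Rightarrow> real"
  assumes f: "f \<in> borel_measurable borel" "\<And>x. \<bar>f x\<bar> \<le> C"
    and h: "\<And>k. h k \<in> borel_measurable borel" "\<And>k x. \<bar>h k x\<bar> \<le> D"
    and act: "\<And>k g x. h k (torus_act g x) = h (transpose g *v k) x"
  shows "(\<integral>\<^sub>T x. f x * (T.average ^^ t) (h k) x) = (F.average ^^ t) (\<lambda>k. \<integral>\<^sub>T x. f x * h k x) k"
proof (induction t arbitrary: k)
  case (Suc t)
  have i: "integrable torus_measure (\<lambda>x. f x * (T.average ^^ t) (h k) x)" for k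
    by (rule integrable_mult_bounded[OF f measurable_average_power[OF h(1)] T.average_power_abs_le[OF h(2)]])
  \<comment> \<open>The innermost averaging is split off, since covariance applies to
    \<open>h k\<close> itself and not to its averages.\<close>
  have "(T.average ^^ Suc t) (h k) = (T.average ^^ t) (\<lambda>x. \<Sum>g\<in>S. w g * h (transpose g *v k) x)"
    by (simp add: funpow_Suc_right T.average_apply[abs_def] act del: funpow.simps transpose_matrix_vector)
  also have "\<dots> = (\<lambda>x. \<Sum>g\<in>S. w g * (T.average ^^ t) (h (transpose g *v k)) x)"
    by (rule T.average_power_linear)
  finally have "(\<integral>\<^sub>T x. f x * (T.average ^^ Suc t) (h k) x)
     = (\<integral>\<^sub>T x. (\<Sum>g\<in>S. w g * (f x * (T.average ^^ t) (h (transpose g *v k)) x)))"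
    by (simp add: sum_distrib_left mult.left_commute)
  also have "\<dots> = (\<Sum>g\<in>S. w g * (\<integral>\<^sub>T x. f x * (T.average ^^ t) (h (transpose g *v k)) x))"
    using i by (simp add: Bochner_Integration.integral_sum)
  also have "\<dots> = (\<Sum>g\<in>S. w g * (F.average ^^ t) (\<lambda>k. \<integral>\<^sub>T x. f x * h k x) (transpose g *v k))"
    by (simp only: Suc)
  also have "\<dots> = F.average ((F.average ^^ t) (\<lambda>k. \<integral>\<^sub>T x. f x * h k x)) k"
    by (rule F.average_apply[symmetric])
  also have "\<dots> = (F.average ^^ Suc t) (\<lambda>k. \<integral>\<^sub>T x. f x * h k x) k"
    by simp
  finally show ?case .
qed simp

text \<open>The correlation pairs the coefficients of \<open>q\<close> with the averaged
  coefficients of \<open>f\<close>. Frequency 0 contributes the product of the integrals; on the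
  rest, Cauchy-Schwarz, the gap and Parseval give the bound.\<close>

lemma correlation_decay_trig_sum:
  fixes f :: "'n torus \<Rightarrow> real" and b :: "int ^ 'n \<Rightarrow> complex"
  assumes gap: "\<And>t a. F.square_integrable a \<Longrightarrow> F.energy ((F.average ^^ t) a) \<le> C * \<theta> ^ t * F.energy a"
    and pos: "0 < C" "0 < \<theta>"
    and f: "f \<in> borel_measurable borel" "\<And>x. \<bar>f x\<bar> \<le> D" and K: "finite K"
    and q: "q = (\<lambda>x. \<Sum>k\<in>K. b k * chi k x)"
  shows "((\<integral>\<^sub>T x. f x * (T.average ^^ t) (\<lambda>x. Re (q x)) x)
      - (\<integral>\<^sub>T x. f x) * (\<integral>\<^sub>T x. Re (q x)))\<^sup>2
    \<le> C * \<theta> ^ t * (\<integral>\<^sub>T x. (f x)\<^sup>2) * (\<integral>\<^sub>T x. (norm (q x))\<^sup>2)"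
proof -
  define fc fs where "fc k = (\<integral>\<^sub>T x. f x * Re (chi k x))"
    and "fs k = (\<integral>\<^sub>T x. f x * Im (chi k x))" for k
  define u v where "u = (F.average ^^ t) fc" and "v = (F.average ^^ t) fs"
  have re: "\<bar>Re (chi k x)\<bar> \<le> 1" "\<bar>Im (chi k x)\<bar> \<le> 1" for k :: "int ^ 'n" and x
    using abs_Re_le_cmod[of "chi k x"] abs_Im_le_cmod[of "chi k x"] by simp_all
  have m: "(\<lambda>x. Re (chi k x)) \<in> borel_measurable borel" "(\<lambda>x. Im (chi k x)) \<in> borel_measurable borel" for k :: "int ^ 'n"
    by measurable
  have u: "(\<integral>\<^sub>T x. f x * (T.average ^^ t) (\<lambda>x. Re (chi k x)) x) = u k" for k
    unfolding u_def fc_def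
    by (rule correlation_family[where h = "\<lambda>k x. Re (chi k x)", OF f m(1) re(1)]) (simp add: chi_torus_act)
  have v: "(\<integral>\<^sub>T x. f x * (T.average ^^ t) (\<lambda>x. Im (chi k x)) x) = v k" for k
    unfolding v_def fs_def
    by (rule correlation_family[where h = "\<lambda>k x. Im (chi k x)", OF f m(2) re(2)]) (simp add: chi_torus_act)
  have sumle: "(\<Sum>k\<in>L. (fc k)\<^sup>2 + (fs k)\<^sup>2) \<le> (\<integral>\<^sub>T x. (f x)\<^sup>2)" if "finite L" for L
    unfolding fc_def fs_def by (rule bessel_inequality[OF f that])
  have sumle': "(\<Sum>k\<in>L. (fc k)\<^sup>2) \<le> (\<integral>\<^sub>T x. (f x)\<^sup>2)"
    "(\<Sum>k\<in>L. (fs k)\<^sup>2) \<le> (\<integral>\<^sub>T x. (f x)\<^sup>2)" if "finite L" for L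
    using sumle[OF that] sum_nonneg[of L "\<lambda>k. (fc k)\<^sup>2"] sum_nonneg[of L "\<lambda>k. (fs k)\<^sup>2"]
    by (auto simp: sum.distrib)
  have si: "F.square_integrable fc" "F.square_integrable fs"
    unfolding F.square_integrable_def
    by (auto intro!: count_space_integral_bound(1) sumle')
  have en: "F.energy fc + F.energy fs \<le> (\<integral>\<^sub>T x. (f x)\<^sup>2)"
  proof -
    have "F.energy fc + F.energy fs = (\<integral>k. (fc k)\<^sup>2 + (fs k)\<^sup>2 \<partial>count_space (- {0}))"
      using si unfolding F.energy_def F.square_integrable_def by simp
    also have "\<dots> \<le> (\<integral>\<^sub>T x. (f x)\<^sup>2)"
      by (rule count_space_integral_bound(2)) (auto intro: sumle)
    finally show ?thesis .
  qed
  have suv: "F.square_integrable u" "F.square_integrable v"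
    unfolding u_def v_def by (intro F.square_integrable_average_power si)+
  have uv: "(\<Sum>k\<in>L. (u k)\<^sup>2 + (v k)\<^sup>2) \<le> C * \<theta> ^ t * (\<integral>\<^sub>T x. (f x)\<^sup>2)"
    if "finite L" "L \<subseteq> - {0}" for L
  proof -
    have "(\<Sum>k\<in>L. (u k)\<^sup>2 + (v k)\<^sup>2) = (\<Sum>k\<in>L. (u k)\<^sup>2) + (\<Sum>k\<in>L. (v k)\<^sup>2)" by (rule sum.distrib)
    also have "\<dots> \<le> F.energy u + F.energy v"
      unfolding F.energy_def using suv that
      by (intro add_mono finite_sum_le_count_space_integral) (auto simp: F.square_integrable_def)
    also have "\<dots> \<le> C * \<theta> ^ t * F.energy fc + C * \<theta> ^ t * F.energy fs"
      unfolding u_def v_def by (intro add_mono gap si)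
    also have "\<dots> \<le> C * \<theta> ^ t * (\<integral>\<^sub>T x. (f x)\<^sup>2)"
      unfolding distrib_left[symmetric] using en pos by (intro mult_left_mono) auto
    finally show ?thesis .
  qed
  have Req: "(\<lambda>x. Re (q x)) = (\<lambda>x. (\<Sum>k\<in>K. Re (b k) * Re (chi k x)) - (\<Sum>k\<in>K. Im (b k) * Im (chi k x)))"
    by (simp add: q sum_subtractf)
  have T: "(T.average ^^ t) (\<lambda>x. Re (q x)) = (\<lambda>x. (\<Sum>k\<in>K. Re (b k) * (T.average ^^ t) (\<lambda>x. Re (chi k x)) x)
      - (\<Sum>k\<in>K. Im (b k) * (T.average ^^ t) (\<lambda>x. Im (chi k x)) x))"
    unfolding Req T.average_power_diff T.average_power_linear ..
  have i: "integrable torus_measure (\<lambda>x. f x * (T.average ^^ t) (\<lambda>x. Re (chi k x)) x)"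
    "integrable torus_measure (\<lambda>x. f x * (T.average ^^ t) (\<lambda>x. Im (chi k x)) x)" for k
    by (rule integrable_mult_bounded[OF f measurable_average_power T.average_power_abs_le], use m re in blast, use m re in blast)+
  have 1: "(\<integral>\<^sub>T x. f x * (T.average ^^ t) (\<lambda>x. Re (q x)) x)
      = (\<Sum>k\<in>K. Re (b k) * u k) - (\<Sum>k\<in>K. Im (b k) * v k)"
  proof -
    have "(\<integral>\<^sub>T x. f x * (T.average ^^ t) (\<lambda>x. Re (q x)) x)
      = (\<integral>\<^sub>T x. (\<Sum>k\<in>K. Re (b k) * (f x * (T.average ^^ t) (\<lambda>x. Re (chi k x)) x))
          - (\<Sum>k\<in>K. Im (b k) * (f x * (T.average ^^ t) (\<lambda>x. Im (chi k x)) x)))"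
      unfolding T by (simp add: right_diff_distrib sum_distrib_left mult.left_commute)
    also have "\<dots> = (\<Sum>k\<in>K. Re (b k) * u k) - (\<Sum>k\<in>K. Im (b k) * v k)"
      using i by (simp add: Bochner_Integration.integral_diff Bochner_Integration.integral_sum u v)
    finally show ?thesis .
  qed
  have 2: "(\<integral>\<^sub>T x. Re (q x)) = (if 0 \<in> K then Re (b 0) else 0)"
  proof -
    have iq: "integrable torus_measure q" unfolding q by simp
    have "(\<integral>\<^sub>T x. Re (q x)) = Re (\<integral>\<^sub>T x. q x)" using iq by simp
    also have "(\<integral>\<^sub>T x. q x) = (\<Sum>k\<in>K. b k * (if k = 0 then 1 else 0))"
      unfolding q by (simp add: Bochner_Integration.integral_sum integral_chi)
    also have "\<dots> = (if 0 \<in> K then b 0 else 0)" using K by (simp add: if_distrib cong: if_cong)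
    finally show ?thesis by simp
  qed
  \<comment> \<open>The constant character is fixed by averaging, which makes its contribution
    cancel against the product of the integrals.\<close>
  have uv0: "u 0 = (\<integral>\<^sub>T x. f x)" "v 0 = 0"
    using u[of 0] v[of 0] by (simp_all add: T.average_power_const)
  have "(\<integral>\<^sub>T x. f x * (T.average ^^ t) (\<lambda>x. Re (q x)) x)
      - (\<integral>\<^sub>T x. f x) * (\<integral>\<^sub>T x. Re (q x))
      = (\<Sum>k\<in>K - {0}. Re (b k * Complex (u k) (v k)))"
  proof (cases "0 \<in> K")
    case True
    then show ?thesis unfolding 1 2
      using sum.remove[OF K True, of "\<lambda>k. Re (b k) * u k"] sum.remove[OF K True, of "\<lambda>k. Im (b k) * v k"]
      by (simp add: uv0 sum_subtractf)
  next
    case False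
    then show ?thesis unfolding 1 2 by (simp add: sum_subtractf)
  qed
  moreover have "\<bar>\<Sum>k\<in>K - {0}. Re (b k * Complex (u k) (v k))\<bar> \<le> (\<Sum>k\<in>K - {0}. norm (b k) * norm (Complex (u k) (v k)))"
    by (intro order_trans[OF sum_abs] sum_mono) (metis abs_Re_le_cmod norm_mult)
  ultimately have "((\<integral>\<^sub>T x. f x * (T.average ^^ t) (\<lambda>x. Re (q x)) x)
      - (\<integral>\<^sub>T x. f x) * (\<integral>\<^sub>T x. Re (q x)))\<^sup>2
      \<le> (\<Sum>k\<in>K - {0}. norm (b k) * norm (Complex (u k) (v k)))\<^sup>2"
    by (simp add: abs_le_square_iff[symmetric] sum_nonneg)
  also have "\<dots> \<le> (\<Sum>k\<in>K - {0}. (norm (b k))\<^sup>2) * (\<Sum>k\<in>K - {0}. (norm (Complex (u k) (v k)))\<^sup>2)"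
    by (rule Cauchy_Schwarz_ineq_sum)
  also have "\<dots> \<le> (\<Sum>k\<in>K. (norm (b k))\<^sup>2) * (C * \<theta> ^ t * (\<integral>\<^sub>T x. (f x)\<^sup>2))"
  proof (intro mult_mono)
    show "(\<Sum>k\<in>K - {0}. (norm (b k))\<^sup>2) \<le> (\<Sum>k\<in>K. (norm (b k))\<^sup>2)"
      using K by (intro sum_mono2) auto
    have "(\<Sum>k\<in>K - {0}. (norm (Complex (u k) (v k)))\<^sup>2) = (\<Sum>k\<in>K - {0}. (u k)\<^sup>2 + (v k)\<^sup>2)"
      by (simp add: cmod_power2)
    also have "\<dots> \<le> C * \<theta> ^ t * (\<integral>\<^sub>T x. (f x)\<^sup>2)" by (rule uv) (use K in auto)
    finally show "(\<Sum>k\<in>K - {0}. (norm (Complex (u k) (v k)))\<^sup>2) \<le> C * \<theta> ^ t * (\<integral>\<^sub>T x. (f x)\<^sup>2)" .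
  qed (auto intro!: sum_nonneg)
  also have "(\<Sum>k\<in>K. (norm (b k))\<^sup>2) = (\<integral>\<^sub>T x. (norm (q x))\<^sup>2)"
    unfolding q by (rule parseval_trig_sum[OF K, symmetric])
  finally show ?thesis by (simp only: mult.commute)
qed

text \<open>Approximation in square mean removes the restriction to trigonometric polynomials. Both
  square means remain in the bound: for two indicators of one small set, its square root then has
  the measure of that set as a factor.\<close>

lemma correlation_decay:
  fixes f \<phi> :: "'n torus \<Rightarrow> real"
  assumes gap: "\<And>t a. F.square_integrable a \<Longrightarrow> F.energy ((F.average ^^ t) a) \<le> C * \<theta> ^ t * F.energy a"
    and pos: "0 < C" "0 < \<theta>"
    and f: "f \<in> borel_measurable borel" "\<And>x. \<bar>f x\<bar> \<le> D"
    and \<phi>: "\<phi> \<in> borel_measurable borel" "\<And>x. 0 \<le> \<phi> x" "\<And>x. \<phi> x \<le> 1"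
  shows "((\<integral>\<^sub>T x. f x * (T.average ^^ t) \<phi> x)
      - (\<integral>\<^sub>T x. f x) * (\<integral>\<^sub>T x. \<phi> x))\<^sup>2
    \<le> C * \<theta> ^ t * (\<integral>\<^sub>T x. (f x)\<^sup>2) * (\<integral>\<^sub>T x. (\<phi> x)\<^sup>2)"
    (is "(?I \<phi>)\<^sup>2 \<le> ?B * _")
proof -
  define e where "e j = 1 / real (Suc j)" for j
  have e: "e j > 0" for j by (simp add: e_def)
  have e0: "e \<longlonglongrightarrow> 0" unfolding e_def by (rule LIMSEQ_Suc[OF lim_1_over_n])
  have \<phi>1: "\<bar>\<phi> x\<bar> \<le> 1" for x using \<phi>(2,3)[of x] by simp
  have D0: "0 \<le> D" using f(2)[of undefined] by linarith
  have f1: "integrable torus_measure f" using f by (intro torus_integrable_bounded) auto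
  have B0: "0 \<le> ?B" using pos by (intro mult_nonneg_nonneg) auto
  have "\<exists>q\<in>trig_poly. (\<integral>\<^sub>T x. (norm (of_real (\<phi> x) - q x))\<^sup>2) < (e j)\<^sup>2" for j
    using L2_approximable_bounded[OF \<phi>] e[of j] by (simp add: L2_approximable_def)
  then obtain q where q: "\<And>j. q j \<in> trig_poly"
    "\<And>j. (\<integral>\<^sub>T x. (norm (of_real (\<phi> x) - q j x))\<^sup>2) < (e j)\<^sup>2" by metis
  define r where "r j x = norm (of_real (\<phi> x) - q j x)" for j x
  have qm: "q j \<in> borel_measurable borel" for j by (rule measurable_trig_poly[OF q(1)])
  have rsq: "integrable torus_measure (\<lambda>x. (r j x)\<^sup>2)" for j
    unfolding r_def using \<phi> \<phi>1 q(1) by (intro integrable_norm_square_diff) auto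
  obtain Q where Q: "\<And>j x. norm (q j x) \<le> Q j" using trig_poly_bounded[OF q(1)] by metis
  have r: "integrable torus_measure (r j)" for j
  proof (rule torus_integrable_bounded)
    show "norm (r j x) \<le> 1 + Q j" for x
      unfolding r_def using norm_triangle_ineq4[of "of_real (\<phi> x)" "q j x"] Q[of j x] \<phi>1[of x] by simp
    show "r j \<in> borel_measurable borel" unfolding r_def using qm \<phi> by measurable
  qed
  have rint: "(\<integral>\<^sub>T x. r j x) \<le> e j" for j
  proof -
    \<comment> \<open>Nonnegativity of the variance bounds the mean error by the root mean square
      error.\<close>
    have "0 \<le> torus.variance (r j)" by (rule torus.variance_positive)
    then have "(\<integral>\<^sub>T x. r j x)\<^sup>2 \<le> (\<integral>\<^sub>T x. (r j x)\<^sup>2)"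
      using torus.variance_eq[OF r rsq, of j] by simp
    also have "\<dots> \<le> (e j)\<^sup>2" using q(2)[of j] by (simp add: r_def)
    finally show ?thesis by (rule power2_le_imp_le) (rule less_imp_le[OF e])
  qed
  \<comment> \<open>The averaging is positive and preserves integrals, so replacing
    \<open>\<phi>\<close> by its approximation costs the same amount at every time
    \<open>t\<close>.\<close>
  have Iq: "\<bar>?I (\<lambda>x. Re (q j x)) - ?I \<phi>\<bar> \<le> 2 * D * e j" for j
  proof -
    define \<psi> where "\<psi> x = Re (q j x) - \<phi> x" for x
    have \<psi>r: "\<bar>\<psi> x\<bar> \<le> r j x" for x
      using abs_Re_le_cmod[of "of_real (\<phi> x) - q j x"] by (simp add: \<psi>_def r_def)
    have reb: "\<bar>Re (q j x)\<bar> \<le> Q j" for x using abs_Re_le_cmod[of "q j x"] Q[of j x] by linarith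
    have rem: "(\<lambda>x. Re (q j x)) \<in> borel_measurable borel" using qm by measurable
    have \<psi>m: "\<psi> \<in> borel_measurable borel" unfolding \<psi>_def using rem \<phi> by simp
    have \<psi>b: "\<bar>\<psi> x\<bar> \<le> Q j + 1" for x using reb[of x] \<phi>1[of x] by (simp add: \<psi>_def)
    have i: "integrable torus_measure (\<lambda>x. Re (q j x))" "integrable torus_measure \<phi>" "integrable torus_measure \<psi>"
      using torus_integrable_bounded[OF rem, of "Q j"] reb torus_integrable_bounded[OF \<phi>(1), of 1] \<phi>1
        torus_integrable_bounded[OF \<psi>m, of "Q j + 1"] \<psi>b by simp_all
    have j: "integrable torus_measure (\<lambda>x. f x * (T.average ^^ t) (\<lambda>x. Re (q j x)) x)"
      "integrable torus_measure (\<lambda>x. f x * (T.average ^^ t) \<phi> x)"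
      using integrable_mult_bounded[OF f measurable_average_power[OF rem] T.average_power_abs_le[OF reb]]
        integrable_mult_bounded[OF f measurable_average_power[OF \<phi>(1)] T.average_power_abs_le[OF \<phi>1]] by auto
    have "?I (\<lambda>x. Re (q j x)) - ?I \<phi> = (\<integral>\<^sub>T x. f x * (T.average ^^ t) \<psi> x)
        - (\<integral>\<^sub>T x. f x) * (\<integral>\<^sub>T x. \<psi> x)"
    proof -
      have "(T.average ^^ t) \<psi> = (\<lambda>x. (T.average ^^ t) (\<lambda>x. Re (q j x)) x - (T.average ^^ t) \<phi> x)"
        unfolding \<psi>_def by (rule T.average_power_diff)
      moreover have "(\<integral>\<^sub>T x. \<psi> x) = (\<integral>\<^sub>T x. Re (q j x)) - (\<integral>\<^sub>T x. \<phi> x)"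
        unfolding \<psi>_def using i by simp
      ultimately show ?thesis using j by (simp add: right_diff_distrib)
    qed
    moreover have "\<bar>\<integral>\<^sub>T x. f x * (T.average ^^ t) \<psi> x\<bar> \<le> D * e j"
    proof -
      have i\<psi>: "integrable torus_measure (\<lambda>x. f x * (T.average ^^ t) \<psi> x)"
        by (rule integrable_mult_bounded[OF f measurable_average_power[OF \<psi>m] T.average_power_abs_le[OF \<psi>b]])
      have ir: "integrable torus_measure ((T.average ^^ t) (r j))" "(\<integral>\<^sub>T x. (T.average ^^ t) (r j) x) = (\<integral>\<^sub>T x. r j x)"
        using T.integral_average_power[OF r] by auto
      have "\<bar>\<integral>\<^sub>T x. f x * (T.average ^^ t) \<psi> x\<bar> \<le> (\<integral>\<^sub>T x. \<bar>f x * (T.average ^^ t) \<psi> x\<bar>)"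
        by (rule integral_abs_bound)
      also have "\<dots> \<le> (\<integral>\<^sub>T x. D * (T.average ^^ t) (r j) x)"
      proof (rule integral_mono)
        fix x
        have "(T.average ^^ t) \<psi> x \<le> (T.average ^^ t) (r j) x"
          by (rule T.average_power_mono) (use \<psi>r abs_le_D1 in blast)
        moreover have "- (T.average ^^ t) \<psi> x \<le> (T.average ^^ t) (r j) x"
        proof -
          have "(T.average ^^ t) (\<lambda>x. 0 - \<psi> x) x \<le> (T.average ^^ t) (r j) x"
            by (rule T.average_power_mono) (use abs_le_D2[OF \<psi>r] in simp)
          then show ?thesis unfolding T.average_power_diff by (simp add: T.average_power_const)
        qed
        ultimately have "\<bar>(T.average ^^ t) \<psi> x\<bar> \<le> (T.average ^^ t) (r j) x" by simp
        then show "\<bar>f x * (T.average ^^ t) \<psi> x\<bar> \<le> D * (T.average ^^ t) (r j) x"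
          using f(2) D0 by (auto simp: abs_mult intro!: mult_mono)
      qed (use i\<psi> ir in auto)
      also have "\<dots> = D * (\<integral>\<^sub>T x. r j x)" using ir by simp
      also have "\<dots> \<le> D * e j" using rint D0 by (rule mult_left_mono)
      finally show ?thesis .
    qed
    moreover have "\<bar>(\<integral>\<^sub>T x. f x) * (\<integral>\<^sub>T x. \<psi> x)\<bar> \<le> D * e j"
    proof -
      have "\<bar>\<integral>\<^sub>T x. f x\<bar> \<le> (\<integral>\<^sub>T x. \<bar>f x\<bar>)" by (rule integral_abs_bound)
      also have "\<dots> \<le> (\<integral>\<^sub>T x :: 'n torus. D)"
        using f1 f(2) by (intro integral_mono) auto
      finally have 1: "\<bar>\<integral>\<^sub>T x. f x\<bar> \<le> D" by simp
      have "\<bar>\<integral>\<^sub>T x. \<psi> x\<bar> \<le> (\<integral>\<^sub>T x. \<bar>\<psi> x\<bar>)" by (rule integral_abs_bound)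
      also have "\<dots> \<le> (\<integral>\<^sub>T x. r j x)"
        using i(3) r \<psi>r by (intro integral_mono) auto
      also have "\<dots> \<le> e j" by (rule rint)
      finally show ?thesis using 1 D0 by (auto simp: abs_mult intro!: mult_mono)
    qed
    ultimately show ?thesis by linarith
  qed
  have "(\<lambda>j. 2 * D * e j) \<longlonglongrightarrow> 2 * D * 0" by (intro tendsto_intros e0)
  then have z: "(\<lambda>j. 2 * D * e j) \<longlonglongrightarrow> 0" by simp
  have "(\<lambda>j. ?I (\<lambda>x. Re (q j x)) - ?I \<phi>) \<longlonglongrightarrow> 0"
    by (rule tendsto_0_le[OF z, of _ 1]) (use Iq abs_ge_self in \<open>auto intro!: always_eventually intro: order_trans\<close>)
  then have lim1: "(\<lambda>j. (?I (\<lambda>x. Re (q j x)))\<^sup>2) \<longlonglongrightarrow> (?I \<phi>)\<^sup>2"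
    by (intro tendsto_power) (rule LIM_zero_cancel)
  \<comment> \<open>An upper bound suffices here: \<open>(\<phi> + r)\<close> squared is expanded
    and \<open>\<phi> \<le> 1\<close> is used in the mixed term.\<close>
  have qsq: "(\<integral>\<^sub>T x. (norm (q j x))\<^sup>2) \<le> (\<integral>\<^sub>T x. (\<phi> x)\<^sup>2) + (e j)\<^sup>2 + 2 * e j" for j
  proof -
    have i: "integrable torus_measure (\<lambda>x. (\<phi> x)\<^sup>2)"
      using \<phi> \<phi>1 by (intro torus_integrable_bounded[where C = 1]) (auto simp: abs_square_le_1)
    have "(\<integral>\<^sub>T x. (norm (q j x))\<^sup>2) \<le> (\<integral>\<^sub>T x. (\<phi> x)\<^sup>2 + (r j x)\<^sup>2 + 2 * r j x)"
    proof (rule integral_mono)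
      fix x
      have "norm (q j x) \<le> \<phi> x + r j x"
        unfolding r_def using norm_triangle_ineq4[of "of_real (\<phi> x)" "of_real (\<phi> x) - q j x"] \<phi>(2)[of x] by simp
      then have "(norm (q j x))\<^sup>2 \<le> (\<phi> x + r j x)\<^sup>2" by (intro power_mono) auto
      also have "\<dots> \<le> (\<phi> x)\<^sup>2 + (r j x)\<^sup>2 + 2 * r j x"
        using mult_right_mono[OF \<phi>(3)[of x], of "2 * r j x"] by (simp add: power2_sum r_def)
      finally show "(norm (q j x))\<^sup>2 \<le> (\<phi> x)\<^sup>2 + (r j x)\<^sup>2 + 2 * r j x" .
      show "integrable torus_measure (\<lambda>x. (norm (q j x))\<^sup>2)"
        by (rule integrable_norm_square_bounded[OF qm]) (use Q in blast)
    qed (use i rsq r in auto)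
    also have "\<dots> = (\<integral>\<^sub>T x. (\<phi> x)\<^sup>2) + (\<integral>\<^sub>T x. (r j x)\<^sup>2) + 2 * (\<integral>\<^sub>T x. r j x)"
      using i rsq r by simp
    also have "\<dots> \<le> (\<integral>\<^sub>T x. (\<phi> x)\<^sup>2) + (e j)\<^sup>2 + 2 * e j"
      using q(2)[of j] rint[of j] by (simp add: r_def)
    finally show ?thesis .
  qed
  have ineq: "(?I (\<lambda>x. Re (q j x)))\<^sup>2 \<le> ?B * ((\<integral>\<^sub>T x. (\<phi> x)\<^sup>2) + (e j)\<^sup>2 + 2 * e j)" for j
  proof -
    obtain K b where K: "finite K" "\<And>x. q j x = (\<Sum>k\<in>K. b k * chi k x)"
      using trig_poly_expansion[OF q(1)] by blast
    then have "q j = (\<lambda>x. \<Sum>k\<in>K. b k * chi k x)" by auto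
    from correlation_decay_trig_sum[OF gap pos f K(1) this]
    have "(?I (\<lambda>x. Re (q j x)))\<^sup>2 \<le> ?B * (\<integral>\<^sub>T x. (norm (q j x))\<^sup>2)" .
    also have "\<dots> \<le> ?B * ((\<integral>\<^sub>T x. (\<phi> x)\<^sup>2) + (e j)\<^sup>2 + 2 * e j)"
      by (rule mult_left_mono[OF qsq B0])
    finally show ?thesis .
  qed
  have "(\<lambda>j. ?B * ((\<integral>\<^sub>T x. (\<phi> x)\<^sup>2) + (e j)\<^sup>2 + 2 * e j))
      \<longlonglongrightarrow> ?B * ((\<integral>\<^sub>T x. (\<phi> x)\<^sup>2) + 0\<^sup>2 + 2 * 0)"
    by (intro tendsto_intros e0)
  then have lim2: "(\<lambda>j. ?B * ((\<integral>\<^sub>T x. (\<phi> x)\<^sup>2) + (e j)\<^sup>2 + 2 * e j))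
      \<longlonglongrightarrow> ?B * (\<integral>\<^sub>T x. (\<phi> x)\<^sup>2)" by simp
  show ?thesis by (rule LIMSEQ_le[OF lim1 lim2]) (use ineq in blast)
qed

end

section \<open>Visits to shrinking balls\<close>

text \<open>Products of exactly \<open>i\<close> letters. New letters enter on the right because the
  outermost averaging applies its element first; length 0 gives the empty product, hence the index
  shift in \<open>word_products_semigroup\<close>.\<close>

primrec word_products :: "(int ^ 'n ^ 'n) set \<Rightarrow> nat \<Rightarrow> (int ^ 'n ^ 'n) set" where
  "word_products S 0 = {mat 1}"
| "word_products S (Suc i) = (\<lambda>(h, g). h ** g) ` (word_products S i \<times> S)"

lemma finite_word_products: "finite S \<Longrightarrow> finite (word_products S i)"
  by (induction i) auto

lemma word_products_semigroup: "word_products S (Suc i) \<subseteq> semigroup_generated S"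
proof (induction i)
  case 0
  show ?case by (auto intro: semigroup_generated.base)
next
  case (Suc i)
  show ?case
    unfolding word_products.simps(2)[of S "Suc i"]
    using Suc by (auto simp del: word_products.simps intro!: semigroup_generated.mult intro: semigroup_generated.base)
qed

section \<open>Returns and avoidance of a set\<close>

context torus_walk
begin

lemma average_power_eq_0:
  assumes "\<And>h. h \<in> word_products S i \<Longrightarrow> f (torus_act h x) = 0"
  shows "(T.average ^^ i) f x = 0"
  using assms
proof (induction i arbitrary: x)
  case 0
  then show ?case by (simp add: torus_act_one)
next
  case (Suc i)
  have "(T.average ^^ i) f (torus_act g x) = 0" if "g \<in> S" for g
  proof (rule Suc.IH)
    fix h assume "h \<in> word_products S i"
    then have "h ** g \<in> word_products S (Suc i)" using that by auto
    then show "f (torus_act h (torus_act g x)) = 0"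
      using Suc.prems by (simp add: torus_act_mult[symmetric])
  qed
  then have "T.average ((T.average ^^ i) f) x = 0"
    unfolding T.average_apply by (intro sum.neutral) simp
  then show ?case by simp
qed

text \<open>Only finitely many words have length \<open>i\<close>. Each of them moves the centre,
  and by continuity moves a sufficiently small ball off itself.\<close>

lemma no_short_returns:
  assumes fix_free: "\<And>h. h \<in> semigroup_generated S \<Longrightarrow> torus_act h x\<^sub>0 \<noteq> x\<^sub>0" and "i \<ge> 1"
  shows "\<forall>\<^sub>F r in at_right 0. (\<integral>\<^sub>T x. indicator {x. dist x x\<^sub>0 < r} x
    * (T.average ^^ i) (indicator {x. dist x x\<^sub>0 < r}) x) = 0"
proof -
  have "\<forall>\<^sub>F r in at_right (0::real). \<forall>x. dist x x\<^sub>0 < r \<longrightarrow> \<not> dist (torus_act h x) x\<^sub>0 < r"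
    if h: "h \<in> word_products S i" for h
  proof -
    define d where "d = dist (torus_act h x\<^sub>0) x\<^sub>0"
    have "h \<in> semigroup_generated S"
      using h \<open>i \<ge> 1\<close> word_products_semigroup[of S "i - 1"] by auto
    then have d: "d > 0" using fix_free by (simp add: d_def)
    obtain \<delta> where \<delta>: "\<delta> > 0" "\<And>x. dist x x\<^sub>0 < \<delta> \<Longrightarrow> dist (torus_act h x) (torus_act h x\<^sub>0) < d / 2"
      using continuous_torus_act[of h] d unfolding continuous_on_iff by (meson UNIV_I half_gt_zero)
    show ?thesis
      unfolding eventually_at_right_field
    \<comment> \<open>With \<open>d\<close> the displacement of the centre, the image of the ball
      stays within \<open>d / 2\<close> of the displaced centre, while a return would be within
      \<open>d / 2\<close> of the original one.\<close>
    proof (intro exI[of _ "min \<delta> (d / 2)"] conjI allI impI notI)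
      fix r x assume r: "0 < r" "r < min \<delta> (d / 2)" and x: "dist x x\<^sub>0 < r" "dist (torus_act h x) x\<^sub>0 < r"
      have "dist (torus_act h x) (torus_act h x\<^sub>0) < d / 2" using \<delta>(2) r x by auto
      moreover have "d \<le> dist (torus_act h x) (torus_act h x\<^sub>0) + dist (torus_act h x) x\<^sub>0"
        unfolding d_def by (metis dist_commute dist_triangle)
      ultimately show False using r x by auto
    qed (use \<delta> d in auto)
  qed
  then have "\<forall>\<^sub>F r in at_right (0::real). \<forall>h\<in>word_products S i. \<forall>x. dist x x\<^sub>0 < r \<longrightarrow> \<not> dist (torus_act h x) x\<^sub>0 < r"
    using finite_word_products[OF finite_S] by (intro eventually_ball_finite) auto
  then show ?thesis
  proof eventually_elim
    case (elim r)
    have z: "indicator {x. dist x x\<^sub>0 < r} x * (T.average ^^ i) (indicator {x. dist x x\<^sub>0 < r}) x = (0::real)" for x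
    proof (cases "dist x x\<^sub>0 < r")
      case True
      then have "(T.average ^^ i) (indicator {x. dist x x\<^sub>0 < r}) x = 0"
        using elim by (intro average_power_eq_0) auto
      then show ?thesis by simp
    qed simp
    show ?case unfolding z by simp
  qed
qed

text \<open>The conditional probability, given the starting point, that the walk is outside
  \<open>B\<close> at times 0 to \<open>k - 1\<close>, written by first-step decomposition.\<close>

primrec avoid :: "'n torus set \<Rightarrow> nat \<Rightarrow> 'n torus \<Rightarrow> real" where
  "avoid B 0 = (\<lambda>x. 1)"
| "avoid B (Suc k) = (\<lambda>x. (1 - indicator B x) * T.average (avoid B k) x)"

lemma average_bounds:
  assumes "\<And>x. 0 \<le> f x" "\<And>x. f x \<le> 1"
  shows "0 \<le> (T.average ^^ t) f x" "(T.average ^^ t) f x \<le> 1"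
  using T.average_power_mono[of "\<lambda>_. 0" f t x] T.average_power_mono[of f "\<lambda>_. 1" t x] assms
  by (simp_all add: T.average_power_const)

lemma avoid_bounds: "0 \<le> avoid B k x \<and> avoid B k x \<le> 1"
proof (induction k arbitrary: x)
  case (Suc k)
  then have "0 \<le> T.average (avoid B k) x" "T.average (avoid B k) x \<le> 1"
    using average_bounds[of "avoid B k" 1 x] by auto
  then show ?case by (auto simp: indicator_def)
qed simp

lemma measurable_avoid:
  assumes "B \<in> sets borel"
  shows "avoid B k \<in> borel_measurable borel"
proof (induction k)
  case (Suc k)
  then have "T.average (avoid B k) \<in> borel_measurable borel"
    using measurable_average_power[of "avoid B k" 1] by simp
  then show ?case using assms by simp
qed simp

text \<open>Dropping the conditions at the first \<open>j\<close> times only enlarges the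
  event.\<close>

lemma avoid_le: "avoid B (k + j) x \<le> (T.average ^^ j) (avoid B k) x"
proof (induction j arbitrary: x)
  case (Suc j)
  have "avoid B (k + Suc j) x \<le> T.average (avoid B (k + j)) x"
    using average_bounds[of "avoid B (k + j)" 1 x] avoid_bounds by (auto simp: indicator_def)
  also have "\<dots> \<le> T.average ((T.average ^^ j) (avoid B k)) x"
    using T.average_power_mono[of _ _ 1, OF Suc] by simp
  finally show ?case by simp
qed simp

text \<open>A union bound: reinstating the conditions at the first \<open>j\<close> times removes at
  most the sum of the visit probabilities at those times.\<close>

lemma avoid_ge: "(T.average ^^ j) (avoid B k) x - (\<Sum>i<j. (T.average ^^ i) (indicator B) x) \<le> avoid B (k + j) x"
proof (induction j arbitrary: x)
  case (Suc j)
  have "(T.average ^^ Suc j) (avoid B k) x - (\<Sum>i<Suc j. (T.average ^^ i) (indicator B) x)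
    = (T.average ^^ Suc j) (avoid B k) x - (\<Sum>i<j. (T.average ^^ Suc i) (indicator B) x) - indicator B x"
    by (subst sum.lessThan_Suc_shift) simp
  also have "(T.average ^^ Suc j) (avoid B k) x - (\<Sum>i<j. (T.average ^^ Suc i) (indicator B) x)
    = (T.average ^^ 1) (\<lambda>x. (T.average ^^ j) (avoid B k) x - (\<Sum>i<j. 1 * (T.average ^^ i) (indicator B) x)) x"
    unfolding T.average_power_diff T.average_power_linear by simp
  also have "\<dots> \<le> (T.average ^^ 1) (avoid B (k + j)) x"
    by (rule T.average_power_mono) (use Suc in simp)
  finally have "(T.average ^^ Suc j) (avoid B k) x - (\<Sum>i<Suc j. (T.average ^^ i) (indicator B) x)
    \<le> T.average (avoid B (k + j)) x - indicator B x" by simp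
  also have "\<dots> \<le> avoid B (k + Suc j) x"
    using average_bounds[of "avoid B (k + j)" 1 x] avoid_bounds by (auto simp: indicator_def)
  finally show ?case .
qed simp

text \<open>The probability that the stationary walk is in \<open>B\<close> both at time 0 and at
  time \<open>i\<close>.\<close>

definition return_mass :: "'n torus set \<Rightarrow> nat \<Rightarrow> real" where
  "return_mass B i = (\<integral>\<^sub>T x. indicator B x * (T.average ^^ i) (indicator B) x)"

lemma integrable_indicator_mult:
  assumes "B \<in> sets borel" "f \<in> borel_measurable borel" "\<And>x. 0 \<le> f x" "\<And>x. f x \<le> 1"
  shows "integrable torus_measure (\<lambda>x. indicator B x * f x :: real)"
  by (rule torus_integrable_bounded[where C = 1]) (use assms in \<open>auto simp: indicator_def\<close>)

lemma integrable_unit_interval: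
  assumes "f \<in> borel_measurable borel" "\<And>x. 0 \<le> f x" "\<And>x. f x \<le> (1::real)"
  shows "integrable torus_measure f"
  by (rule torus_integrable_bounded[where C = 1]) (use assms in auto)

lemma return_mass_nonneg: "0 \<le> return_mass B i"
  unfolding return_mass_def
  by (intro Bochner_Integration.integral_nonneg mult_nonneg_nonneg average_bounds) (auto simp: indicator_def)

lemma integral_avoid_step:
  assumes B: "B \<in> sets borel"
  shows "(\<integral>\<^sub>T x. avoid B k x) - (\<integral>\<^sub>T x. avoid B (Suc k) x)
    = (\<integral>\<^sub>T x. indicator B x * T.average (avoid B k) x)"
proof -
  have m: "T.average (avoid B k) \<in> borel_measurable borel"
    using measurable_average_power[OF measurable_avoid[OF B, of k], of 1] by simp
  have b: "0 \<le> T.average (avoid B k) x" "T.average (avoid B k) x \<le> 1" for x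
    using average_bounds[of "avoid B k" 1 x] avoid_bounds by auto
  have i: "integrable torus_measure (avoid B k)" "integrable torus_measure (T.average (avoid B k))"
    using measurable_avoid[OF B] avoid_bounds m b by (auto intro!: integrable_unit_interval)
  have "(\<integral>\<^sub>T x. avoid B k x) = (\<integral>\<^sub>T x. T.average (avoid B k) x)"
    by (rule T.integral_average[OF i(1), symmetric])
  moreover have "(\<integral>\<^sub>T x. avoid B (Suc k) x)
    = (\<integral>\<^sub>T x. T.average (avoid B k) x) - (\<integral>\<^sub>T x. indicator B x * T.average (avoid B k) x)"
    using i integrable_indicator_mult[OF B m b] by (simp add: left_diff_distrib)
  ultimately show ?thesis by simp
qed

text \<open>One step of the survival probability: go back \<open>j\<close> steps, which costs at most the short
  returns, and decorrelate over the gap.\<close>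

lemma avoid_recursion:
  assumes B: "B \<in> sets borel" and mB: "mB = measure torus_measure B"
    and dec: "\<And>t \<phi>. \<phi> \<in> borel_measurable borel \<Longrightarrow> (\<And>x. 0 \<le> \<phi> x) \<Longrightarrow> (\<And>x. \<phi> x \<le> 1) \<Longrightarrow>
      \<bar>(\<integral>\<^sub>T x. indicator B x * (T.average ^^ t) \<phi> x) - mB * (\<integral>\<^sub>T x. \<phi> x)\<bar> \<le> K * \<kappa> ^ t"
    and K: "0 \<le> K" and \<kappa>: "0 < \<kappa>" "\<kappa> < 1"
  shows "\<bar>(\<integral>\<^sub>T x. avoid B (Suc k) x) - (1 - mB) * (\<integral>\<^sub>T x. avoid B k x)\<bar>
     \<le> (\<Sum>i=1..J. return_mass B i) + J * mB\<^sup>2 + K * \<kappa> ^ J"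
proof -
  define a where "a k = (\<integral>\<^sub>T x. avoid B k x)" for k
  note m = measurable_avoid[OF B]
  have Bi: "integrable torus_measure (indicator B :: _ \<Rightarrow> real)"
    using B by (intro integrable_unit_interval) (auto simp: indicator_def)
  have mBint: "(\<integral>\<^sub>T x. indicator B x) = mB"
    unfolding mB using B by (simp add: sets_torus_measure)
  have mB0: "0 \<le> mB" by (simp add: mB)
  have step: "0 \<le> a k - a (Suc k)" "a k - a (Suc k) \<le> mB" for k
  proof -
    have mm: "T.average (avoid B k) \<in> borel_measurable borel"
      using measurable_average_power[OF m, of 1 k] by simp
    have b: "0 \<le> T.average (avoid B k) x" "T.average (avoid B k) x \<le> 1" for x
      using average_bounds[of "avoid B k" 1 x] avoid_bounds by auto
    show "0 \<le> a k - a (Suc k)"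
      unfolding a_def integral_avoid_step[OF B] using b
      by (intro Bochner_Integration.integral_nonneg mult_nonneg_nonneg) auto
    have "(\<integral>\<^sub>T x. indicator B x * T.average (avoid B k) x) \<le> (\<integral>\<^sub>T x. indicator B x)"
      using b by (intro integral_mono integrable_indicator_mult[OF B mm b] Bi) (auto simp: indicator_def)
    then show "a k - a (Suc k) \<le> mB"
      unfolding a_def integral_avoid_step[OF B] mBint .
  qed
  \<comment> \<open>Each additional time can remove at most the probability of being in
    \<open>B\<close> at one instant.\<close>
  have steps: "0 \<le> a k - a (k + j) \<and> a k - a (k + j) \<le> j * mB" for k j
  proof (induction j)
    case (Suc j)
    then show ?case using step[of "k + j"] by (simp add: algebra_simps)
  qed simp
  have gap: "\<bar>(\<integral>\<^sub>T x. indicator B x * T.average (avoid B (k + j)) x)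
      - (\<integral>\<^sub>T x. indicator B x * (T.average ^^ Suc j) (avoid B k) x)\<bar> \<le> (\<Sum>i=1..j. return_mass B i)" for k j
  proof -
    let ?f = "\<lambda>x. T.average (avoid B (k + j)) x"
    let ?g = "\<lambda>x. (T.average ^^ Suc j) (avoid B k) x"
    let ?s = "\<lambda>x. \<Sum>i=1..j. (T.average ^^ i) (indicator B) x"
    have fm: "?f \<in> borel_measurable borel" using measurable_average_power[OF m, of 1] by simp
    have fb: "0 \<le> ?f x" "?f x \<le> 1" for x
      using average_bounds[of "avoid B (k + j)" 1 x] avoid_bounds by auto
    have gm: "?g \<in> borel_measurable borel" by (rule measurable_average_power[OF m])
    have gb: "0 \<le> ?g x" "?g x \<le> 1" for x
      using average_bounds[of "avoid B k" "Suc j" x] avoid_bounds by auto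
    have im: "(T.average ^^ i) (indicator B) \<in> borel_measurable borel" for i
      using B by (intro measurable_average_power) simp
    have ib: "0 \<le> (T.average ^^ i) (indicator B) x" "(T.average ^^ i) (indicator B) x \<le> 1" for i x
      using average_bounds[of "indicator B" i x] by (auto simp: indicator_def)
    have si: "integrable torus_measure (\<lambda>x. indicator B x * ?s x)"
      unfolding sum_distrib_left by (intro Bochner_Integration.integrable_sum integrable_indicator_mult[OF B im ib])
    have sint: "(\<integral>\<^sub>T x. indicator B x * ?s x) = (\<Sum>i=1..j. return_mass B i)"
      unfolding sum_distrib_left return_mass_def
      by (intro Bochner_Integration.integral_sum integrable_indicator_mult[OF B im ib])
    have le: "?f x \<le> ?g x" for x
      using T.average_power_mono[of "avoid B (k + j)" "(T.average ^^ j) (avoid B k)" 1 x, OF avoid_le] by simp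
    \<comment> \<open>One more averaging shifts the visit times from 0 to \<open>j - 1\<close> to
      the times 1 to \<open>j\<close>, so the start in \<open>B\<close> itself is not counted as a
      return.\<close>
    have ge: "?g x - ?s x \<le> ?f x" for x
    proof -
      have "(T.average ^^ 1) (\<lambda>x. (T.average ^^ j) (avoid B k) x - (\<Sum>i<j. 1 * (T.average ^^ i) (indicator B) x)) x
          \<le> (T.average ^^ 1) (avoid B (k + j)) x"
        by (rule T.average_power_mono) (use avoid_ge in simp)
      then have "?g x - (\<Sum>i<j. (T.average ^^ Suc i) (indicator B) x) \<le> ?f x"
        unfolding T.average_power_diff T.average_power_linear by simp
      moreover have "(\<Sum>i<j. (T.average ^^ Suc i) (indicator B) x) = ?s x"
        by (rule sum.reindex_bij_witness[of _ "\<lambda>i. i - 1" Suc]) auto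
      ultimately show ?thesis by simp
    qed
    have "(\<integral>\<^sub>T x. indicator B x * ?f x) \<le> (\<integral>\<^sub>T x. indicator B x * ?g x)"
      by (intro integral_mono integrable_indicator_mult[OF B fm fb] integrable_indicator_mult[OF B gm gb] mult_left_mono le) auto
    moreover have "(\<integral>\<^sub>T x. indicator B x * ?g x) \<le> (\<integral>\<^sub>T x. indicator B x * ?f x + indicator B x * ?s x)"
    proof (intro integral_mono Bochner_Integration.integrable_add integrable_indicator_mult[OF B fm fb] si integrable_indicator_mult[OF B gm gb])
      show "indicator B x * ?g x \<le> indicator B x * ?f x + indicator B x * ?s x" for x
        using ge[of x] by (simp add: indicator_def)
    qed
    then have "(\<integral>\<^sub>T x. indicator B x * ?g x) \<le> (\<integral>\<^sub>T x. indicator B x * ?f x) + (\<Sum>i=1..j. return_mass B i)"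
      unfolding Bochner_Integration.integral_add[OF integrable_indicator_mult[OF B fm fb] si] sint .
    ultimately show ?thesis by linarith
  qed
  define X where "X = (\<integral>\<^sub>T x. indicator B x * T.average (avoid B k) x)"
  have goal: "\<bar>X - mB * a k\<bar> \<le> (\<Sum>i=1..J. return_mass B i) + J * mB\<^sup>2 + K * \<kappa> ^ J"
  proof (cases "k < J")
    case True
    \<comment> \<open>Too early for a gap of length \<open>J\<close>: all later conditions are
      dropped instead, which compares \<open>X\<close> with \<open>mB\<close>, and
      \<open>a k\<close> is still within \<open>k * mB\<close> of 1.\<close>
    have "\<bar>X - (\<integral>\<^sub>T x. indicator B x * (T.average ^^ Suc k) (avoid B 0) x)\<bar> \<le> (\<Sum>i=1..k. return_mass B i)"
      using gap[of 0 k] by (simp add: X_def)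
    moreover have "(\<integral>\<^sub>T x. indicator B x * (T.average ^^ Suc k) (avoid B 0) x) = mB"
      unfolding avoid.simps T.average_power_const using mBint by simp
    moreover have "(\<Sum>i=1..k. return_mass B i) \<le> (\<Sum>i=1..J. return_mass B i)"
      using True by (intro sum_mono2) (auto intro: return_mass_nonneg)
    moreover have "\<bar>mB - mB * a k\<bar> \<le> J * mB\<^sup>2"
    proof -
      have "a 0 = 1" by (simp add: a_def)
      then have s: "0 \<le> 1 - a k" "1 - a k \<le> k * mB" using steps[of 0 k] by auto
      have "mB - mB * a k = mB * (1 - a k)" by (simp add: algebra_simps)
      then have "\<bar>mB - mB * a k\<bar> = mB * (1 - a k)" using s mB0 by simp
      also have "\<dots> \<le> mB * (k * mB)" using s mB0 by (intro mult_left_mono)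
      also have "\<dots> = k * mB\<^sup>2" by (simp add: power2_eq_square)
      also have "\<dots> \<le> J * mB\<^sup>2" using True by (intro mult_right_mono) auto
      finally show ?thesis .
    qed
    moreover have "0 \<le> K * \<kappa> ^ J" using K \<kappa> by simp
    ultimately show ?thesis by linarith
  next
    case False
    \<comment> \<open>The conditions during the first \<open>J\<close> steps after leaving the start
      are dropped, decorrelation acts across this gap, and \<open>a k'\<close> is then replaced by
      \<open>a k\<close>.\<close>
    define k' where "k' = k - J"
    have k: "k = k' + J" using False by (simp add: k'_def)
    have "\<bar>X - (\<integral>\<^sub>T x. indicator B x * (T.average ^^ Suc J) (avoid B k') x)\<bar> \<le> (\<Sum>i=1..J. return_mass B i)"
      using gap[of k' J] by (simp add: X_def k)
    moreover have "\<bar>(\<integral>\<^sub>T x. indicator B x * (T.average ^^ Suc J) (avoid B k') x) - mB * a k'\<bar> \<le> K * \<kappa> ^ Suc J"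
      unfolding a_def using avoid_bounds by (intro dec m) auto
    moreover have "K * \<kappa> ^ Suc J \<le> K * \<kappa> ^ J"
      using K \<kappa> by (intro mult_left_mono power_decreasing) auto
    moreover have "\<bar>mB * a k' - mB * a k\<bar> \<le> J * mB\<^sup>2"
    proof -
      have s: "0 \<le> a k' - a k" "a k' - a k \<le> J * mB" using steps[of k' J] k by auto
      have "\<bar>mB * a k' - mB * a k\<bar> = mB * (a k' - a k)" using s mB0 by (simp add: abs_mult flip: right_diff_distrib)
      also have "\<dots> \<le> mB * (J * mB)" using s mB0 by (intro mult_left_mono)
      also have "\<dots> = J * mB\<^sup>2" by (simp add: power2_eq_square)
      finally show ?thesis .
    qed
    ultimately show ?thesis by linarith
  qed
  have "a k - a (Suc k) = X" unfolding a_def X_def by (rule integral_avoid_step[OF B])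
  then have "a (Suc k) - (1 - mB) * a k = - (X - mB * a k)" by (simp add: algebra_simps)
  then show ?thesis using goal unfolding a_def[symmetric] by (metis abs_minus_cancel)
qed

end

text \<open>A factor of at most 1 cannot amplify earlier errors, so they merely add up.\<close>

lemma geometric_recursion_error:
  fixes a :: "nat \<Rightarrow> real"
  assumes "a 0 = 1" "0 \<le> q" "q \<le> 1" "\<And>k. \<bar>a (Suc k) - q * a k\<bar> \<le> E"
  shows "\<bar>a n - q ^ n\<bar> \<le> n * E"
proof (induction n)
  case (Suc n)
  have "a (Suc n) - q ^ Suc n = (a (Suc n) - q * a n) + q * (a n - q ^ n)" by (simp add: algebra_simps)
  then have "\<bar>a (Suc n) - q ^ Suc n\<bar> \<le> E + \<bar>q * (a n - q ^ n)\<bar>"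
    using assms(4)[of n] by linarith
  also have "\<bar>q * (a n - q ^ n)\<bar> \<le> 1 * \<bar>a n - q ^ n\<bar>"
    unfolding abs_mult using assms(2,3) by (intro mult_right_mono) auto
  finally show ?case using Suc by (simp add: algebra_simps)
qed (simp add: assms(1))

lemma geometric_tail_le:
  fixes \<kappa> :: real
  assumes "0 < \<kappa>" "\<kappa> < 1"
  shows "(\<Sum>i=Suc I..J. \<kappa> ^ i) \<le> \<kappa> ^ I / (1 - \<kappa>)"
proof (cases "Suc I \<le> J")
  case True
  have "(1 - \<kappa>) * (\<Sum>i=Suc I..J. \<kappa> ^ i) = \<kappa> ^ Suc I - \<kappa> ^ Suc J" by (rule sum_gp_multiplied[OF True])
  also have "\<dots> \<le> \<kappa> ^ Suc I" using assms by simp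
  also have "\<dots> \<le> \<kappa> ^ I" using assms by (intro power_decreasing) auto
  finally show ?thesis using assms by (simp add: field_simps)
qed (use assms in auto)

text \<open>The gap must be negligible against \<open>n\<close>, yet long enough for exponential
  decay to beat the factor \<open>n\<close> from accumulating errors. The square root scale meets
  both demands.\<close>

lemma sqrt_scale_limits:
  fixes \<kappa> :: real
  assumes \<kappa>: "0 < \<kappa>" "\<kappa> < 1"
  defines "J \<equiv> \<lambda>n::nat. nat \<lfloor>sqrt (real n)\<rfloor>"
  shows "(\<lambda>n. real (J n) / real n) \<longlonglongrightarrow> 0" "(\<lambda>n. real n * \<kappa> ^ J n) \<longlonglongrightarrow> 0"
proof -
  have J: "real (J n) \<le> sqrt (real n)" "sqrt (real n) - 1 \<le> real (J n)" for n
    by (auto simp: J_def)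
  have "(\<lambda>n. sqrt (real n) / real n) \<longlonglongrightarrow> 0" by real_asymp
  then show "(\<lambda>n. real (J n) / real n) \<longlonglongrightarrow> 0"
    by (rule tendsto_0_le[where K = 1]) (use J in \<open>auto intro!: always_eventually divide_right_mono\<close>)
  define L where "L = ln \<kappa>"
  have L: "L < 0" using \<kappa> by (simp add: L_def)
  have "(\<lambda>n. real n * exp ((sqrt (real n) - 1) * L)) \<longlonglongrightarrow> 0" using L by real_asymp
  moreover have "norm (real n * \<kappa> ^ J n) \<le> norm (real n * exp ((sqrt (real n) - 1) * L)) * 1" for n
  proof -
    have "\<kappa> ^ J n = exp (real (J n) * L)"
      using \<kappa> by (simp add: L_def exp_of_nat_mult)
    also have "\<dots> \<le> exp ((sqrt (real n) - 1) * L)"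
      using J(2)[of n] L by (simp add: mult_right_mono_neg)
    finally show ?thesis using \<kappa> by (simp add: mult_left_mono)
  qed
  ultimately show "(\<lambda>n. real n * \<kappa> ^ J n) \<longlonglongrightarrow> 0"
    by (auto intro: tendsto_0_le[where K = 1])
qed

section \<open>The limit of the avoidance probability\<close>

context torus_walk
begin

text \<open>Decay enters in two strengths. The crude bound \<open>dec\<close> suffices across the
  long gap \<open>J n\<close>; the returns need the bound with the extra factor \<open>mB n\<close>,
  since they are summed over shorter times.\<close>

lemma extreme_value_limit:
  fixes x\<^sub>0 :: "'n torus" and r :: real
  assumes gap: "\<And>t a. F.square_integrable a \<Longrightarrow> F.energy ((F.average ^^ t) a) \<le> C * \<theta> ^ t * F.energy a"
    and C: "0 < C" and \<theta>: "0 < \<theta>" "\<theta> < 1"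
    and fix_free: "\<And>h. h \<in> semigroup_generated S \<Longrightarrow> torus_act h x\<^sub>0 \<noteq> x\<^sub>0"
  defines "B \<equiv> \<lambda>n. {x. dist x x\<^sub>0 < exp (- (r + 1 / real CARD('n) * ln (real n)))}"
  shows "(\<lambda>n. \<integral>\<^sub>T x. avoid (B n) n x)
    \<longlonglongrightarrow> exp (- (measure lborel (ball (0 :: real ^ 'n) 1) * exp (- (real CARD('n) * r))))"
proof -
  define \<rho> where "\<rho> n = exp (- (r + 1 / real CARD('n) * ln (real n)))" for n
  define V where "V = measure lborel (ball (0 :: real ^ 'n) 1)"
  define \<tau> where "\<tau> = V * exp (- (real CARD('n) * r))"
  define mB where "mB n = measure torus_measure (B n)" for n
  define K \<kappa> where "K = sqrt C" and "\<kappa> = sqrt \<theta>"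
  define J where "J n = nat \<lfloor>sqrt (real n)\<rfloor>" for n
  define a where "a n k = (\<integral>\<^sub>T x. avoid (B n) k x)" for n k
  have K: "0 \<le> K" and \<kappa>: "0 < \<kappa>" "\<kappa> < 1" using C \<theta> by (auto simp: K_def \<kappa>_def)
  have K\<kappa>: "(K * \<kappa> ^ t)\<^sup>2 = C * \<theta> ^ t" for t
    using C \<theta> by (simp add: K_def \<kappa>_def power_mult_distrib power_mult[symmetric] mult.commute[of t])
      (simp add: power_mult)
  have d: "real CARD('n) > 0" by simp
  have V0: "0 \<le> V" and \<tau>0: "0 \<le> \<tau>" by (auto simp: V_def \<tau>_def)
  have B: "B n \<in> sets borel" for n
    unfolding B_def by (intro borel_open) (auto intro!: open_Collect_less continuous_intros)
  have \<rho>0: "\<rho> \<longlonglongrightarrow> 0"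
  proof -
    define c where "c = 1 / real CARD('n)"
    have "c > 0" by (simp add: c_def)
    then have "(\<lambda>n. exp (- (r + c * ln (real n)))) \<longlonglongrightarrow> 0" by real_asymp
    then show ?thesis by (simp add: \<rho>_def[abs_def] c_def)
  qed
  have \<rho>at: "filterlim \<rho> (at_right 0) sequentially"
    using \<rho>0 by (intro filterlim_atI tendsto_imp_filterlim_at_right) (auto simp: \<rho>_def)
  have "\<forall>\<^sub>F n in sequentially. \<rho> n < 1 / 2" using \<rho>0 by (intro order_tendstoD) auto
  \<comment> \<open>The logarithmic term in the level makes the radius to the power of the dimension
    equal to \<open>exp (- (real CARD('n) * r)) / n\<close>; the ball formula applies once the
    radius is below 1/2.\<close>
  then have mB: "\<forall>\<^sub>F n in sequentially. mB n = \<tau> / real n"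
    using eventually_gt_at_top[of 0]
  proof eventually_elim
    case (elim n)
    have "\<rho> n ^ CARD('n) = exp (real CARD('n) * - (r + 1 / real CARD('n) * ln (real n)))"
      unfolding \<rho>_def by (rule exp_of_nat_mult[symmetric])
    also have "real CARD('n) * - (r + 1 / real CARD('n) * ln (real n)) = - (real CARD('n) * r) - ln (real n)"
      using d by (simp add: field_simps)
    also have "exp \<dots> = exp (- (real CARD('n) * r)) / real n"
      using elim by (simp add: exp_diff)
    finally show ?case
      using measure_torus_ball[of "\<rho> n" x\<^sub>0] elim by (simp add: mB_def B_def \<rho>_def \<tau>_def V_def)
  qed
  have indsq: "(\<integral>\<^sub>T x. (indicator (B n) x)\<^sup>2) = mB n" for n
  proof -
    have "(\<lambda>x. (indicator (B n) x)\<^sup>2) = (indicator (B n) :: _ \<Rightarrow> real)" by (auto simp: indicator_def)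
    then show ?thesis using B[of n] by (simp add: mB_def sets_torus_measure)
  qed
  have mB1: "0 \<le> mB n" "mB n \<le> 1" for n by (auto simp: mB_def)
  have decay: "((\<integral>\<^sub>T x. indicator (B n) x * (T.average ^^ t) \<phi> x) - mB n * (\<integral>\<^sub>T x. \<phi> x))\<^sup>2
      \<le> (K * \<kappa> ^ t)\<^sup>2 * (mB n * (\<integral>\<^sub>T x. (\<phi> x)\<^sup>2))"
    if "\<phi> \<in> borel_measurable borel" "\<And>x. 0 \<le> \<phi> x" "\<And>x. \<phi> x \<le> 1" for \<phi> n t
  proof -
    have "(\<integral>\<^sub>T x. indicator (B n) x) = mB n" using B[of n] by (simp add: mB_def sets_torus_measure)
    then show ?thesis
      using correlation_decay[OF gap C \<theta>(1), of "indicator (B n)" 1 \<phi> t] B[of n] that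
      by (simp add: K\<kappa> indsq mult.assoc)
  qed
  have dec: "\<bar>(\<integral>\<^sub>T x. indicator (B n) x * (T.average ^^ t) \<phi> x) - mB n * (\<integral>\<^sub>T x. \<phi> x)\<bar> \<le> K * \<kappa> ^ t"
    if \<phi>: "\<phi> \<in> borel_measurable borel" "\<And>x. 0 \<le> \<phi> x" "\<And>x. \<phi> x \<le> 1" for \<phi> n t
  proof -
    have \<phi>2: "(\<phi> x)\<^sup>2 \<le> 1" for x using \<phi>(2,3)[of x] by (simp add: power_le_one)
    have "(\<integral>\<^sub>T x. (\<phi> x)\<^sup>2) \<le> (\<integral>\<^sub>T x :: 'n torus. 1)"
      by (intro integral_mono integrable_unit_interval) (use \<phi> \<phi>2 in auto)
    then have "mB n * (\<integral>\<^sub>T x. (\<phi> x)\<^sup>2) \<le> 1 * 1"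
      using mB1 by (intro mult_mono) auto
    then have "(K * \<kappa> ^ t)\<^sup>2 * (mB n * (\<integral>\<^sub>T x. (\<phi> x)\<^sup>2)) \<le> (K * \<kappa> ^ t)\<^sup>2 * 1"
      by (intro mult_left_mono) auto
    with decay[OF \<phi>, of n t]
    have "((\<integral>\<^sub>T x. indicator (B n) x * (T.average ^^ t) \<phi> x) - mB n * (\<integral>\<^sub>T x. \<phi> x))\<^sup>2 \<le> (K * \<kappa> ^ t)\<^sup>2"
      by linarith
    moreover have "0 \<le> K * \<kappa> ^ t" using K \<kappa> by simp
    ultimately show ?thesis by - (rule power2_le_imp_le[where y = "K * \<kappa> ^ t"], simp_all)
  qed
  \<comment> \<open>With the indicator in both slots, each square mean equals \<open>mB n\<close>,
    so the square root of the correlation bound is proportional to the measure of the ball.\<close>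
  have ret: "return_mass (B n) i \<le> (mB n)\<^sup>2 + K * \<kappa> ^ i * mB n" for n i
  proof -
    have int: "(\<integral>\<^sub>T x. indicator (B n) x) = mB n" using B[of n] by (simp add: mB_def sets_torus_measure)
    have "((\<integral>\<^sub>T x. indicator (B n) x * (T.average ^^ i) (indicator (B n)) x) - mB n * (\<integral>\<^sub>T x. indicator (B n) x))\<^sup>2
      \<le> (K * \<kappa> ^ i)\<^sup>2 * (mB n * (\<integral>\<^sub>T x. (indicator (B n) x)\<^sup>2))"
      using B[of n] by (intro decay) (auto simp: indicator_def)
    then have "(return_mass (B n) i - (mB n)\<^sup>2)\<^sup>2 \<le> (K * \<kappa> ^ i * mB n)\<^sup>2"
      unfolding int indsq return_mass_def by (simp add: power2_eq_square mult_ac)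
    moreover have "0 \<le> K * \<kappa> ^ i * mB n" using K \<kappa> mB1 by simp
    ultimately have "\<bar>return_mass (B n) i - (mB n)\<^sup>2\<bar> \<le> K * \<kappa> ^ i * mB n"
      by - (rule power2_le_imp_le[where y = "K * \<kappa> ^ i * mB n"], simp_all)
    then show ?thesis by linarith
  qed
  have short: "\<forall>\<^sub>F n in sequentially. \<forall>i\<in>{1..I}. return_mass (B n) i = 0" for I :: nat
  proof (intro eventually_ball_finite ballI)
    fix i assume "i \<in> {1..I}"
    then have "i \<ge> 1" by simp
    from filterlim_iff[THEN iffD1, OF \<rho>at, rule_format, OF no_short_returns[OF fix_free this]]
    show "\<forall>\<^sub>F n in sequentially. return_mass (B n) i = 0"
      by (simp add: return_mass_def B_def \<rho>_def)
  qed simp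
  \<comment> \<open>The one-step error times \<open>n\<close>, with \<open>\<tau> / n\<close> for
    the measure of the ball. The first two terms vanish as \<open>n\<close> grows; the last is the
    tail of returns after time \<open>I\<close> and vanishes only as \<open>I\<close> grows, hence
    the order of the two limits.\<close>
  define err where "err n I = 2 * \<tau>\<^sup>2 * (real (J n) / real n) + K * (real n * \<kappa> ^ J n) + \<tau> * K * (\<kappa> ^ I / (1 - \<kappa>))" for n I
  have bound: "\<forall>\<^sub>F n in sequentially. \<bar>a n n - (1 - \<tau> / real n) ^ n\<bar> \<le> err n I" for I
    using short[of I] mB eventually_gt_at_top[of 0]
  proof eventually_elim
    case (elim n)
    let ?E = "(\<Sum>i=1..J n. return_mass (B n) i) + real (J n) * (mB n)\<^sup>2 + K * \<kappa> ^ J n"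
    have "\<bar>a n n - (1 - mB n) ^ n\<bar> \<le> n * ?E"
    proof (rule geometric_recursion_error[where a = "a n"])
      show "\<bar>a n (Suc k) - (1 - mB n) * a n k\<bar> \<le> ?E" for k
        unfolding a_def by (rule avoid_recursion[OF B mB_def dec K \<kappa>])
      show "a n 0 = 1" by (simp add: a_def)
    qed (use mB1 in auto)
    also have "\<dots> \<le> err n I"
    proof -
      have "(\<Sum>i=1..J n. return_mass (B n) i) \<le> (\<Sum>i=1..J n. (mB n)\<^sup>2 + (if i \<in> {Suc I..J n} then K * mB n * \<kappa> ^ i else 0))"
      proof (rule sum_mono)
        fix i assume i: "i \<in> {1..J n}"
        show "return_mass (B n) i \<le> (mB n)\<^sup>2 + (if i \<in> {Suc I..J n} then K * mB n * \<kappa> ^ i else 0)"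
          using elim(1) i ret[of n i] by (auto simp: mult_ac)
      qed
      also have "\<dots> = real (J n) * (mB n)\<^sup>2 + (\<Sum>i=Suc I..J n. K * mB n * \<kappa> ^ i)"
      proof -
        have "(\<Sum>i=1..J n. if i \<in> {Suc I..J n} then K * mB n * \<kappa> ^ i else 0) = (\<Sum>i\<in>{1..J n} \<inter> {Suc I..J n}. K * mB n * \<kappa> ^ i)"
          by (rule sum.inter_restrict[symmetric]) simp
        also have "{1..J n} \<inter> {Suc I..J n} = {Suc I..J n}" by auto
        finally show ?thesis by (simp only: sum.distrib) simp
      qed
      also have "(\<Sum>i=Suc I..J n. K * mB n * \<kappa> ^ i) \<le> K * mB n * (\<kappa> ^ I / (1 - \<kappa>))"
        unfolding sum_distrib_left[symmetric] using K mB1 \<kappa> by (intro mult_left_mono geometric_tail_le) auto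
      finally have "?E \<le> 2 * (real (J n) * (mB n)\<^sup>2) + K * mB n * (\<kappa> ^ I / (1 - \<kappa>)) + K * \<kappa> ^ J n" by simp
      then have "n * ?E \<le> n * (2 * (real (J n) * (mB n)\<^sup>2) + K * mB n * (\<kappa> ^ I / (1 - \<kappa>)) + K * \<kappa> ^ J n)"
        by (intro mult_left_mono) auto
      also have "\<dots> = err n I"
      proof -
        define t where "t = \<kappa> ^ I / (1 - \<kappa>)"
        show ?thesis using elim(3) unfolding elim(2) err_def t_def[symmetric]
          by (simp add: field_simps power2_eq_square)
      qed
      finally show ?thesis .
    qed
    finally show ?case by (simp add: elim(2))
  qed
  have errlim: "(\<lambda>n. err n I) \<longlonglongrightarrow> 2 * \<tau>\<^sup>2 * 0 + K * 0 + \<tau> * K * (\<kappa> ^ I / (1 - \<kappa>))" for I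
    unfolding err_def J_def by (intro tendsto_intros sqrt_scale_limits[OF \<kappa>])
  have Ilim: "(\<lambda>I. \<tau> * K * (\<kappa> ^ I / (1 - \<kappa>))) \<longlonglongrightarrow> \<tau> * K * (0 / (1 - \<kappa>))"
    using \<kappa> by (intro tendsto_intros LIMSEQ_realpow_zero) auto
  have "(\<lambda>n. a n n - (1 - \<tau> / real n) ^ n) \<longlonglongrightarrow> 0"
  proof (rule tendstoI)
    fix e :: real assume e: "e > 0"
    have "\<forall>\<^sub>F I in sequentially. \<tau> * K * (\<kappa> ^ I / (1 - \<kappa>)) < e"
      using Ilim e by (intro order_tendstoD) auto
    then obtain I where "\<tau> * K * (\<kappa> ^ I / (1 - \<kappa>)) < e" by (auto simp: eventually_sequentially)
    then have "\<forall>\<^sub>F n in sequentially. err n I < e"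
      using errlim[of I] by (intro order_tendstoD) auto
    with bound[of I] show "\<forall>\<^sub>F n in sequentially. dist (a n n - (1 - \<tau> / real n) ^ n) 0 < e"
      by eventually_elim (simp add: dist_real_def)
  qed
  moreover have "(\<lambda>n. (1 + (- \<tau>) / real n) ^ n) \<longlonglongrightarrow> exp (- \<tau>)"
    by (rule tendsto_exp_limit_sequentially)
  ultimately have "(\<lambda>n. (a n n - (1 - \<tau> / real n) ^ n) + (1 + (- \<tau>) / real n) ^ n) \<longlonglongrightarrow> 0 + exp (- \<tau>)"
    by (rule tendsto_add)
  then show ?thesis by (simp add: a_def \<tau>_def V_def)
qed

end

section \<open>From avoidance functions to the random walk\<close>

lemma measurable_walk:
  fixes \<mu> :: "(int ^ 'n::finite ^ 'n) pmf"
  shows "walk i \<in> measurable (walk_measure \<mu>) (borel :: 'n torus measure)"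
proof (induction i)
  case 0
  have "walk 0 = (snd :: _ \<Rightarrow> 'n torus)" by (auto simp: fun_eq_iff)
  moreover have "snd \<in> measurable (walk_measure \<mu>) (torus_measure :: 'n torus measure)"
    unfolding walk_measure_def by (rule measurable_snd)
  ultimately show ?case by (simp add: measurable_cong_sets[OF refl sets_torus_measure])
next
  case (Suc i)
  have "walk (Suc i) = (\<lambda>p. torus_act (fst p i) (walk i p) :: 'n torus)" by (auto simp: fun_eq_iff)
  moreover have "(\<lambda>p. torus_act (fst p i) (walk i p)) \<in> measurable (walk_measure \<mu>) borel"
  \<comment> \<open>There are countably many integer matrices, so measurability can be checked for
    each matrix separately.\<close>
  proof (rule measurable_compose_countable[of "\<lambda>g p. torus_act g (walk i p)"])
    show "(\<lambda>p. torus_act g (walk i p)) \<in> measurable (walk_measure \<mu>) borel" for g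
      by (rule measurable_compose[OF Suc measurable_torus_act])
    have "(\<lambda>p. fst p i) \<in> measurable (walk_measure \<mu> :: (_ \<times> 'n torus) measure) (measure_pmf \<mu>)"
      unfolding walk_measure_def by measurable
    then show "(\<lambda>p. fst p i) \<in> measurable (walk_measure \<mu> :: (_ \<times> 'n torus) measure) (count_space UNIV)"
      by (simp cong: measurable_cong_sets)
  qed
  ultimately show ?case by simp
qed

text \<open>The walk is defined by its last step, whereas \<open>avoid\<close> decomposes by the
  first; this translates between the two.\<close>

lemma walk_Suc_shift: "walk (Suc i) (case_nat g \<omega>, x) = walk i (\<omega>, torus_act g x)"
  by (induction i) auto

text \<open>The value \<infinity> at the centre agrees with the centre belonging to every ball
  around it.\<close>

lemma neg_log_dist_le_iff: "neg_log_dist x\<^sub>0 x \<le> ereal u \<longleftrightarrow> \<not> dist x x\<^sub>0 < exp (- u)"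
proof (cases "x = x\<^sub>0")
  case False
  then have "0 < dist x x\<^sub>0" by simp
  then have "- ln (dist x x\<^sub>0) \<le> u \<longleftrightarrow> exp (- u) \<le> dist x x\<^sub>0"
    using ln_ge_iff[of "dist x x\<^sub>0" "- u"] by linarith
  then show ?thesis using False by (simp add: neg_log_dist_def not_less)
qed (simp add: neg_log_dist_def)

text \<open>At \<open>n = 0\<close> the maximum would be taken over the empty set, where its value
  carries no meaning.\<close>

lemma walk_max_le_iff:
  assumes "n \<ge> 1"
  shows "walk_max x\<^sub>0 n p \<le> ereal u \<longleftrightarrow> (\<forall>i<n. walk i p \<notin> {x. dist x x\<^sub>0 < exp (- u)})"
proof -
  have "0 \<in> {..<n}" using assms by simp
  then have "{..<n} \<noteq> {}" by blast
  then show ?thesis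
    unfolding walk_max_def by (subst Max_le_iff) (auto simp: neg_log_dist_le_iff)
qed

text \<open>For a fixed start, removing the first matrix leaves a sequence of the same law, which
  reproduces the recursion for \<open>avoid\<close>. Fubini then integrates over the start.\<close>

lemma measure_walk_avoid:
  fixes \<mu> :: "(int ^ 'n::finite ^ 'n) pmf" and B :: "'n torus set"
  assumes fin: "finite (set_pmf \<mu>)" and GLZ: "\<And>g. g \<in> set_pmf \<mu> \<Longrightarrow> det g = 1 \<or> det g = - 1"
    and B: "B \<in> sets borel"
  shows "measure (walk_measure \<mu>) {p \<in> space (walk_measure \<mu>). \<forall>i<n. walk i p \<notin> B}
    = (\<integral>\<^sub>T x. torus_walk.avoid (set_pmf \<mu>) (pmf \<mu>) B n x)"
proof -
  interpret W: torus_walk "set_pmf \<mu>" "pmf \<mu>"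
  proof
    show "(\<Sum>g\<in>set_pmf \<mu>. pmf \<mu> g) = 1" by (rule sum_pmf_eq_1[OF fin]) simp
  qed (use fin GLZ in \<open>auto simp: pmf_positive\<close>)
  interpret seq: sequence_space "measure_pmf \<mu>" ..
  define N where "N = (\<Pi>\<^sub>M i\<in>(UNIV :: nat set). measure_pmf \<mu>)"
  interpret N: prob_space N unfolding N_def by (rule seq.prob_space_axioms)
  interpret P: pair_prob_space N "torus_measure :: 'n torus measure" ..
  have wm: "walk_measure \<mu> = N \<Otimes>\<^sub>M torus_measure" by (simp add: walk_measure_def N_def)
  define A where "A n = {p \<in> space (walk_measure \<mu>). \<forall>i<n. walk i p \<notin> B}" for n
  have A: "A n \<in> sets (walk_measure \<mu>)" for n
  proof -
    have "A n = space (walk_measure \<mu>) - (\<Union>i<n. walk i -` B \<inter> space (walk_measure \<mu>))"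
      by (auto simp: A_def)
    moreover have "space (walk_measure \<mu>) - (\<Union>i<n. walk i -` B \<inter> space (walk_measure \<mu>)) \<in> sets (walk_measure \<mu>)"
      by (intro sets.Diff sets.top sets.finite_UN finite_lessThan measurable_sets[OF measurable_walk B])
    ultimately show ?thesis by simp
  qed
  have space: "space (walk_measure \<mu>) = UNIV"
    by (simp add: walk_measure_def space_pair_measure space_PiM)
  have sect: "(\<lambda>\<omega>. (\<omega>, x)) -` A n = {\<omega>. \<forall>i<n. walk i (\<omega>, x) \<notin> B}" for n x
    by (auto simp: A_def space)
  have sectm: "{\<omega>. \<forall>i<n. walk i (\<omega>, x) \<notin> B} \<in> sets N" for n x
    using sets_Pair2[of "A n" N "torus_measure :: 'n torus measure" x] A[of n] by (simp add: wm sect)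
  \<comment> \<open>The start is kept general because the first step moves it.\<close>
  have q: "emeasure N {\<omega>. \<forall>i<n. walk i (\<omega>, x) \<notin> B} = ennreal (W.avoid B n x)" for n x
  proof (induction n arbitrary: x)
    case 0
    have "space N = UNIV" by (simp add: N_def space_PiM)
    then show ?case using N.emeasure_space_1 by simp
  next
    case (Suc n)
    let ?A = "{\<omega>. \<forall>i<Suc n. walk i (\<omega>, x) \<notin> B}"
    have shift: "case_nat g \<omega> \<in> ?A \<longleftrightarrow> x \<notin> B \<and> (\<forall>i<n. walk i (\<omega>, torus_act g x) \<notin> B)" for g \<omega>
      unfolding mem_Collect_eq All_less_Suc2 walk_Suc_shift by simp
    have mc: "(\<lambda>(g, \<omega>). case_nat g \<omega>) \<in> measurable (measure_pmf \<mu> \<Otimes>\<^sub>M N) N"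
      unfolding N_def by measurable
    have Am: "(\<lambda>(g, \<omega>). case_nat g \<omega>) -` ?A \<inter> space (measure_pmf \<mu> \<Otimes>\<^sub>M N) \<in> sets (measure_pmf \<mu> \<Otimes>\<^sub>M N)"
      by (rule measurable_sets[OF mc sectm])
    have spc: "space (measure_pmf \<mu> \<Otimes>\<^sub>M N) = UNIV"
      by (simp add: space_pair_measure N_def space_PiM)
    \<comment> \<open>The sequence measure is the image of its product with one independent first
      matrix under prepending.\<close>
    have "emeasure N ?A = emeasure (distr (measure_pmf \<mu> \<Otimes>\<^sub>M N) N (\<lambda>(g, \<omega>). case_nat g \<omega>)) ?A"
      using seq.PiM_iter by (simp add: N_def)
    also have "\<dots> = emeasure (measure_pmf \<mu> \<Otimes>\<^sub>M N) ((\<lambda>(g, \<omega>). case_nat g \<omega>) -` ?A \<inter> space (measure_pmf \<mu> \<Otimes>\<^sub>M N))"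
      by (rule emeasure_distr[OF mc sectm])
    also have "\<dots> = (\<integral>\<^sup>+g. emeasure N (Pair g -` ((\<lambda>(g, \<omega>). case_nat g \<omega>) -` ?A \<inter> space (measure_pmf \<mu> \<Otimes>\<^sub>M N))) \<partial>measure_pmf \<mu>)"
      by (rule N.emeasure_pair_measure_alt[OF Am])
    also have "\<dots> = (\<integral>\<^sup>+g. (if x \<in> B then 0 else ennreal (W.avoid B n (torus_act g x))) \<partial>measure_pmf \<mu>)"
    proof (rule nn_integral_cong)
      fix g
      have "Pair g -` ((\<lambda>(g, \<omega>). case_nat g \<omega>) -` ?A \<inter> space (measure_pmf \<mu> \<Otimes>\<^sub>M N))
        = {\<omega>. case_nat g \<omega> \<in> ?A}" by (auto simp: spc)
      also have "\<dots> = (if x \<in> B then {} else {\<omega>. \<forall>i<n. walk i (\<omega>, torus_act g x) \<notin> B})"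
        unfolding shift by auto
      finally show "emeasure N (Pair g -` ((\<lambda>(g, \<omega>). case_nat g \<omega>) -` ?A \<inter> space (measure_pmf \<mu> \<Otimes>\<^sub>M N)))
        = (if x \<in> B then 0 else ennreal (W.avoid B n (torus_act g x)))"
        using Suc by simp
    qed
    also have "\<dots> = (\<Sum>g\<in>set_pmf \<mu>. (if x \<in> B then 0 else ennreal (W.avoid B n (torus_act g x))) * ennreal (pmf \<mu> g))"
      by (rule nn_integral_measure_pmf_finite[OF fin]) simp
    also have "\<dots> = (\<Sum>g\<in>set_pmf \<mu>. ennreal ((1 - indicator B x) * (pmf \<mu> g * W.avoid B n (torus_act g x))))"
      using W.avoid_bounds by (intro sum.cong refl) (simp add: ennreal_mult mult.commute)
    also have "\<dots> = ennreal (\<Sum>g\<in>set_pmf \<mu>. (1 - indicator B x) * (pmf \<mu> g * W.avoid B n (torus_act g x)))"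
      using W.avoid_bounds by (intro sum_ennreal) (auto simp: indicator_def)
    also have "(\<Sum>g\<in>set_pmf \<mu>. (1 - indicator B x) * (pmf \<mu> g * W.avoid B n (torus_act g x))) = W.avoid B (Suc n) x"
      unfolding sum_distrib_left[symmetric] by (simp add: W.T.average_apply)
    finally show ?case .
  qed
  have "emeasure (walk_measure \<mu>) (A n) = (\<integral>\<^sup>+x. emeasure N ((\<lambda>\<omega>. (\<omega>, x)) -` A n) \<partial>torus_measure)"
    unfolding wm by (rule P.emeasure_pair_measure_alt2) (use A in \<open>simp add: wm\<close>)
  also have "\<dots> = (\<integral>\<^sup>+x. ennreal (W.avoid B n x) \<partial>torus_measure)"
    by (simp add: sect q)
  also have "\<dots> = ennreal (\<integral>\<^sub>T x. W.avoid B n x)"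
    using W.avoid_bounds W.measurable_avoid[OF B]
    by (intro nn_integral_eq_integral W.integrable_unit_interval) auto
  finally show ?thesis
    using W.avoid_bounds by (simp add: measure_def A_def Bochner_Integration.integral_nonneg)
qed

section \<open>Invariant means\<close>

definition bounded_fun :: "('a \<Rightarrow> real) \<Rightarrow> bool" where
  "bounded_fun f \<longleftrightarrow> (\<exists>C. \<forall>x. \<bar>f x\<bar> \<le> C)"

lemma bounded_funI: "(\<And>x. \<bar>f x\<bar> \<le> C) \<Longrightarrow> bounded_fun f"
  by (auto simp: bounded_fun_def)

lemma bounded_fun_const [simp]: "bounded_fun (\<lambda>x. c)"
  by (auto simp: bounded_fun_def)

lemma bounded_fun_of_bool [simp]: "bounded_fun (\<lambda>x. of_bool (P x))"
  by (rule bounded_funI[of _ 1]) simp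

lemma bounded_fun_add:
  assumes "bounded_fun f" "bounded_fun g"
  shows "bounded_fun (\<lambda>x. f x + g x)"
proof -
  obtain C D where "\<And>x. \<bar>f x\<bar> \<le> C" "\<And>x. \<bar>g x\<bar> \<le> D" using assms by (auto simp: bounded_fun_def)
  then show ?thesis by (intro bounded_funI[of _ "C + D"]) (meson abs_triangle_ineq add_mono order_trans)
qed

lemma bounded_fun_mult:
  assumes "bounded_fun f" "bounded_fun g"
  shows "bounded_fun (\<lambda>x. f x * g x)"
proof -
  obtain C D where CD: "\<And>x. \<bar>f x\<bar> \<le> C" "\<And>x. \<bar>g x\<bar> \<le> D" using assms by (auto simp: bounded_fun_def)
  show ?thesis
  proof (rule bounded_funI)
    show "\<bar>f x * g x\<bar> \<le> C * D" for x
      using CD order_trans[OF abs_ge_zero CD(1)] by (auto simp: abs_mult intro!: mult_mono)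
  qed
qed

lemma bounded_fun_compose: "bounded_fun f \<Longrightarrow> bounded_fun (\<lambda>x. f (h x))"
  by (auto simp: bounded_fun_def)

text \<open>A functional on bounded functions rather than a finitely additive set function, so that
  it can be iterated over the entries of a tuple.\<close>

locale invariant_mean =
  fixes m :: "('x \<Rightarrow> real) \<Rightarrow> real" and G :: "'g set" and \<alpha> :: "'g \<Rightarrow> 'x \<Rightarrow> 'x"
  assumes mean_add: "bounded_fun f \<Longrightarrow> bounded_fun h \<Longrightarrow> m (\<lambda>x. f x + h x) = m f + m h"
    and mean_scale: "bounded_fun f \<Longrightarrow> m (\<lambda>x. c * f x) = c * m f"
    and mean_nonneg: "bounded_fun f \<Longrightarrow> (\<And>x. 0 \<le> f x) \<Longrightarrow> 0 \<le> m f"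
    and mean_one: "m (\<lambda>x. 1) = 1"
    and mean_invariant: "g \<in> G \<Longrightarrow> bounded_fun f \<Longrightarrow> m (\<lambda>x. f (\<alpha> g x)) = m f"
begin

lemma mean_const: "m (\<lambda>x. c) = c"
  using mean_scale[of "\<lambda>x. 1" c] by (simp add: mean_one)

lemma mean_mono:
  assumes "bounded_fun f" "bounded_fun g" "\<And>x. f x \<le> g x"
  shows "m f \<le> m g"
proof -
  have b: "bounded_fun (\<lambda>x. (-1) * f x)" by (intro bounded_fun_mult assms) simp
  have "0 \<le> m (\<lambda>x. g x + (-1) * f x)"
    using assms by (intro mean_nonneg bounded_fun_add b) auto
  also have "\<dots> = m g + (-1) * m f"
    unfolding mean_add[OF assms(2) b] mean_scale[OF assms(1)] ..
  finally show ?thesis by simp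
qed

lemma mean_abs_le:
  assumes "\<And>x. \<bar>f x\<bar> \<le> C"
  shows "\<bar>m f\<bar> \<le> C"
proof -
  have b: "bounded_fun f" using assms by (rule bounded_funI)
  have "m f \<le> m (\<lambda>x. C)" by (rule mean_mono[OF b]) (use abs_le_D1[OF assms] in auto)
  moreover have "m (\<lambda>x. - C) \<le> m f"
    by (rule mean_mono[OF _ b]) (use abs_le_D2[OF assms] in \<open>auto simp: minus_le_iff\<close>)
  ultimately show ?thesis by (simp add: mean_const abs_le_iff)
qed

text \<open>The mean over \<open>n\<close> independent points, averaging the last entry first. For
  finitely additive means the order of averaging can matter, so the recursion fixes it.\<close>

primrec iterated_mean :: "nat \<Rightarrow> ('x list \<Rightarrow> real) \<Rightarrow> real" where
  "iterated_mean 0 F = F []"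
| "iterated_mean (Suc n) F = m (\<lambda>x. iterated_mean n (\<lambda>xs. F (x # xs)))"

lemma iterated_mean_abs_le: "(\<And>xs. \<bar>F xs\<bar> \<le> C) \<Longrightarrow> \<bar>iterated_mean n F\<bar> \<le> C"
  by (induction n arbitrary: F) (auto intro: mean_abs_le)

lemma bounded_iterated_mean:
  assumes "bounded_fun F"
  shows "bounded_fun (\<lambda>x. iterated_mean n (\<lambda>xs. F (x # xs)))"
proof -
  obtain C where "\<And>xs. \<bar>F xs\<bar> \<le> C" using assms by (auto simp: bounded_fun_def)
  then show ?thesis by (intro bounded_funI[of _ C] iterated_mean_abs_le)
qed

text \<open>For the diagonal action, the tail is moved by the inductive hypothesis with the head
  held fixed, and then the outer mean absorbs the move of the head.\<close>

lemma iterated_mean_invariant_mean: "invariant_mean (iterated_mean n) G (\<lambda>g. map (\<alpha> g))"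
proof (induction n)
  case 0
  show ?case by unfold_locales auto
next
  case (Suc n)
  interpret n: invariant_mean "iterated_mean n" G "\<lambda>g. map (\<alpha> g)" by (rule Suc)
  note bc = bounded_fun_compose[where h = "\<lambda>xs. _ # xs"]
  show ?case
  proof unfold_locales
    fix F F' :: "'x list \<Rightarrow> real" assume F: "bounded_fun F" "bounded_fun F'"
    have "iterated_mean (Suc n) (\<lambda>xs. F xs + F' xs)
        = m (\<lambda>x. iterated_mean n (\<lambda>xs. F (x # xs)) + iterated_mean n (\<lambda>xs. F' (x # xs)))"
      using n.mean_add[OF bc[OF F(1)] bc[OF F(2)]] by simp
    also have "\<dots> = iterated_mean (Suc n) F + iterated_mean (Suc n) F'"
      using mean_add[OF bounded_iterated_mean[OF F(1)] bounded_iterated_mean[OF F(2)]] by simp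
    finally show "iterated_mean (Suc n) (\<lambda>xs. F xs + F' xs) = iterated_mean (Suc n) F + iterated_mean (Suc n) F'" .
  next
    fix F :: "'x list \<Rightarrow> real" and c assume F: "bounded_fun F"
    have "iterated_mean (Suc n) (\<lambda>xs. c * F xs) = m (\<lambda>x. c * iterated_mean n (\<lambda>xs. F (x # xs)))"
      using n.mean_scale[OF bc[OF F]] by simp
    also have "\<dots> = c * iterated_mean (Suc n) F"
      using mean_scale[OF bounded_iterated_mean[OF F]] by simp
    finally show "iterated_mean (Suc n) (\<lambda>xs. c * F xs) = c * iterated_mean (Suc n) F" .
  next
    fix F :: "'x list \<Rightarrow> real" assume F: "bounded_fun F" "\<And>xs. 0 \<le> F xs"
    show "0 \<le> iterated_mean (Suc n) F"
      unfolding iterated_mean.simps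
      by (intro mean_nonneg bounded_iterated_mean n.mean_nonneg bc F)
  next
    show "iterated_mean (Suc n) (\<lambda>xs. 1) = 1" by (simp add: n.mean_one mean_one)
  next
    fix g and F :: "'x list \<Rightarrow> real" assume g: "g \<in> G" and F: "bounded_fun F"
    have "iterated_mean (Suc n) (\<lambda>xs. F (map (\<alpha> g) xs)) = m (\<lambda>x. iterated_mean n (\<lambda>xs. F (\<alpha> g x # xs)))"
      using n.mean_invariant[OF g bc[OF F]] by simp
    also have "\<dots> = m (\<lambda>x. iterated_mean n (\<lambda>xs. F (x # xs)))"
      by (rule mean_invariant[OF g bounded_iterated_mean[OF F]])
    finally show "iterated_mean (Suc n) (\<lambda>xs. F (map (\<alpha> g) xs)) = iterated_mean (Suc n) F" by simp
  qed
qed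

end

lemma integrable_mult_bounded_fun:
  fixes p :: "'a \<Rightarrow> real"
  assumes "integrable (count_space X) p" "bounded_fun f"
  shows "integrable (count_space X) (\<lambda>x. p x * f x)"
proof -
  obtain C where C: "\<And>x. \<bar>f x\<bar> \<le> C" using assms(2) by (auto simp: bounded_fun_def)
  show ?thesis
  proof (rule Bochner_Integration.integrable_bound)
    show "integrable (count_space X) (\<lambda>x. C * \<bar>p x\<bar>)" using assms(1) by simp
    show "AE x in count_space X. norm (p x * f x) \<le> norm (C * \<bar>p x\<bar>)"
    proof (rule AE_I2)
      fix x
      have "\<bar>f x\<bar> * \<bar>p x\<bar> \<le> \<bar>C\<bar> * \<bar>p x\<bar>"
        using C[of x] by (intro mult_right_mono) auto
      then show "norm (p x * f x) \<le> norm (C * \<bar>p x\<bar>)" by (simp add: abs_mult mult.commute)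
    qed
  qed simp
qed

text \<open>A cluster point, in the product topology, of the functionals given by ever more
  invariant densities.\<close>

lemma invariant_mean_of_almost_invariant:
  fixes \<alpha> :: "'g \<Rightarrow> 'x \<Rightarrow> 'x"
  assumes bij: "\<And>g. g \<in> I \<Longrightarrow> bij_betw (\<alpha> g) X X"
    and approx: "\<And>e. e > 0 \<Longrightarrow> \<exists>p :: 'x \<Rightarrow> real. integrable (count_space X) p \<and> (\<forall>x. 0 \<le> p x) \<and>
      (\<integral>x. p x \<partial>count_space X) = 1 \<and> (\<forall>g\<in>I. (\<integral>x. \<bar>p (\<alpha> g x) - p x\<bar> \<partial>count_space X) \<le> e)"
  obtains m where "invariant_mean m I \<alpha>" "\<And>f. bounded_fun f \<Longrightarrow> (\<And>x. x \<in> X \<Longrightarrow> f x = 0) \<Longrightarrow> m f = 0"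
proof -
  have "\<forall>j. \<exists>p :: 'x \<Rightarrow> real. integrable (count_space X) p \<and> (\<forall>x. 0 \<le> p x) \<and>
      (\<integral>x. p x \<partial>count_space X) = 1 \<and> (\<forall>g\<in>I. (\<integral>x. \<bar>p (\<alpha> g x) - p x\<bar> \<partial>count_space X) \<le> 1 / real (Suc j))"
    by (intro allI approx) simp
  then obtain p :: "nat \<Rightarrow> 'x \<Rightarrow> real" where p: "\<And>j. integrable (count_space X) (p j)" "\<And>j x. 0 \<le> p j x"
    "\<And>j. (\<integral>x. p j x \<partial>count_space X) = 1"
    "\<And>j g. g \<in> I \<Longrightarrow> (\<integral>x. \<bar>p j (\<alpha> g x) - p j x\<bar> \<partial>count_space X) \<le> 1 / real (Suc j)"
    by metis
  note pf = integrable_mult_bounded_fun[OF p(1)]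
  define \<Phi> :: "nat \<Rightarrow> ('x \<Rightarrow> real) \<Rightarrow> real" where
    "\<Phi> j f = (if bounded_fun f then \<integral>x. p j x * f x \<partial>count_space X else 0)" for j f
  have \<Phi>_le: "\<bar>\<Phi> j f\<bar> \<le> C" if f: "\<And>x. \<bar>f x\<bar> \<le> C" for j f C
  proof -
    have b: "bounded_fun f" using f by (rule bounded_funI)
    have "\<bar>\<integral>x. p j x * f x \<partial>count_space X\<bar> \<le> (\<integral>x. \<bar>p j x * f x\<bar> \<partial>count_space X)"
      by (rule integral_abs_bound)
    also have "\<dots> \<le> (\<integral>x. C * p j x \<partial>count_space X)"
    proof (rule integral_mono)
      show "\<bar>p j x * f x\<bar> \<le> C * p j x" for x
        using mult_right_mono[OF f[of x] p(2)[of j x]] p(2)[of j x] by (simp add: abs_mult mult.commute)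
    qed (use pf[OF b] p(1) in auto)
    also have "\<dots> = C" using p(3) by simp
    finally show ?thesis using b by (simp add: \<Phi>_def)
  qed
  \<comment> \<open>A Tychonoff cube. For bounded \<open>f\<close> the interval comes from a chosen
    bound; for unbounded \<open>f\<close> that choice is arbitrary, but the absolute value keeps 0,
    the value of \<open>\<Phi>\<close> there, inside the interval.\<close>
  define K where "K = (PiE UNIV (\<lambda>f::'x \<Rightarrow> real. {- \<bar>SOME C. \<forall>x. \<bar>f x\<bar> \<le> C\<bar>..\<bar>SOME C. \<forall>x. \<bar>f x\<bar> \<le> C\<bar>}))"
  have "compactin (product_topology (\<lambda>_. euclidean) UNIV) K"
    unfolding K_def by (subst compactin_PiE) auto
  then have K: "compact K" by (simp add: euclidean_product_topology)
  have \<Phi>K: "\<Phi> j \<in> K" for j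
  proof -
    have "\<bar>\<Phi> j f\<bar> \<le> \<bar>SOME C. \<forall>x. \<bar>f x\<bar> \<le> C\<bar>" for f
    proof (cases "bounded_fun f")
      case True
      then have "\<forall>x. \<bar>f x\<bar> \<le> (SOME C. \<forall>x. \<bar>f x\<bar> \<le> C)"
        unfolding bounded_fun_def by (rule someI_ex)
      then have "\<bar>\<Phi> j f\<bar> \<le> (SOME C. \<forall>x. \<bar>f x\<bar> \<le> C)" by (intro \<Phi>_le) blast
      also have "\<dots> \<le> \<bar>SOME C. \<forall>x. \<bar>f x\<bar> \<le> C\<bar>" by (rule abs_ge_self)
      finally show ?thesis .
    qed (simp add: \<Phi>_def)
    then have "\<Phi> j f \<in> {- \<bar>SOME C. \<forall>x. \<bar>f x\<bar> \<le> C\<bar>..\<bar>SOME C. \<forall>x. \<bar>f x\<bar> \<le> C\<bar>}" for f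
      unfolding atLeastAtMost_iff by (meson abs_le_D1 abs_le_D2 minus_le_iff)
    then show ?thesis by (auto simp only: K_def PiE_UNIV_domain)
  qed
  define F where "F = filtermap \<Phi> sequentially"
  have "F \<noteq> bot" by (simp add: F_def filtermap_bot_iff)
  moreover have "eventually (\<lambda>\<phi>. \<phi> \<in> K) F" by (simp add: F_def eventually_filtermap \<Phi>K)
  ultimately obtain m where m: "m \<in> K" "inf (nhds m) F \<noteq> bot"
    using K unfolding compact_filter by blast
  have lim: "((\<lambda>\<phi>. \<phi> f) \<longlongrightarrow> m f) (inf (nhds m) F)" for f
  proof (rule topological_tendstoI)
    fix T :: "real set" assume T: "open T" "m f \<in> T"
    have "open ((\<lambda>\<phi> :: ('x \<Rightarrow> real) \<Rightarrow> real. \<phi> f) -` T)"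
      by (rule open_vimage[OF T(1) continuous_on_product_coordinates])
    then have "eventually (\<lambda>\<phi>. \<phi> \<in> (\<lambda>\<phi>. \<phi> f) -` T) (nhds m)"
      by (rule eventually_nhds_in_open) (simp add: T)
    then show "eventually (\<lambda>\<phi>. \<phi> f \<in> T) (inf (nhds m) F)"
      by (intro filter_leD[OF inf_le1]) simp
  qed
  \<comment> \<open>The filter near \<open>m\<close> plays the role of a convergent subnet:
    evaluations tend to those of \<open>m\<close>, and limits along the whole sequence persist.
    Comparing the two gives equations for \<open>m\<close>.\<close>
  have transfer: "c = d" if "(H \<longlongrightarrow> c) (inf (nhds m) F)" "(\<lambda>j. H (\<Phi> j)) \<longlonglongrightarrow> d"
    for H :: "(('x \<Rightarrow> real) \<Rightarrow> real) \<Rightarrow> real" and c d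
  proof (rule tendsto_unique[OF m(2) that(1)])
    have "(H \<longlongrightarrow> d) F" using that(2) by (simp add: F_def filterlim_filtermap)
    then show "(H \<longlongrightarrow> d) (inf (nhds m) F)" by (rule tendsto_mono[OF inf_le2])
  qed
  have "invariant_mean m I \<alpha>"
  proof
    fix f g :: "'x \<Rightarrow> real" assume fg: "bounded_fun f" "bounded_fun g"
    have "\<Phi> j (\<lambda>x. f x + g x) - \<Phi> j f - \<Phi> j g = 0" for j
      using fg pf[OF fg(1)] pf[OF fg(2)] by (simp add: \<Phi>_def bounded_fun_add distrib_left)
    then have "m (\<lambda>x. f x + g x) - m f - m g = 0"
      by (intro transfer[where H = "\<lambda>\<phi>. \<phi> (\<lambda>x. f x + g x) - \<phi> f - \<phi> g"] tendsto_diff lim) simp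
    then show "m (\<lambda>x. f x + g x) = m f + m g" by simp
  next
    fix f :: "'x \<Rightarrow> real" and c assume f: "bounded_fun f"
    have "\<Phi> j (\<lambda>x. c * f x) - c * \<Phi> j f = 0" for j
      using f pf[OF f] by (simp add: \<Phi>_def bounded_fun_mult mult.left_commute)
    then have "m (\<lambda>x. c * f x) - c * m f = 0"
      by (intro transfer[where H = "\<lambda>\<phi>. \<phi> (\<lambda>x. c * f x) - c * \<phi> f"] tendsto_diff tendsto_mult_left lim) simp
    then show "m (\<lambda>x. c * f x) = c * m f" by simp
  next
    fix f :: "'x \<Rightarrow> real" assume f: "bounded_fun f" "\<And>x. 0 \<le> f x"
    have "0 \<le> \<Phi> j f" for j
      using f p(2) by (simp add: \<Phi>_def)
    \<comment> \<open>Positivity is phrased as an equation because \<open>transfer\<close> compares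
      limits for equality.\<close>
    then have "\<bar>\<Phi> j f\<bar> - \<Phi> j f = 0" for j by simp
    then have "\<bar>m f\<bar> - m f = 0"
      by (intro transfer[where H = "\<lambda>\<phi>. \<bar>\<phi> f\<bar> - \<phi> f"] tendsto_diff tendsto_rabs lim) simp
    then show "0 \<le> m f" by simp
  next
    have "\<Phi> j (\<lambda>x. 1) = 1" for j using p(3) by (simp add: \<Phi>_def)
    then show "m (\<lambda>x. 1) = 1"
      by (intro transfer[where H = "\<lambda>\<phi>. \<phi> (\<lambda>x. 1)"] lim) simp
  next
    fix g and f :: "'x \<Rightarrow> real" assume g: "g \<in> I" and f: "bounded_fun f"
    obtain C where C: "\<And>x. \<bar>f x\<bar> \<le> C" using f by (auto simp: bounded_fun_def)
    have fg: "bounded_fun (\<lambda>x. f (\<alpha> g x))" using f by (rule bounded_fun_compose)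
    have comp: "(\<integral>x. h (\<alpha> g x) \<partial>count_space X) = (\<integral>x. h x \<partial>count_space X)" for h :: "'x \<Rightarrow> real"
      by (rule integral_bij_count_space[OF bij[OF g]])
    have pg: "integrable (count_space X) (\<lambda>x. p j (\<alpha> g x))" for j
      using integrable_bij_count_space[OF bij[OF g], of "p j"] p(1) by simp
    have "\<bar>\<Phi> j (\<lambda>x. f (\<alpha> g x)) - \<Phi> j f\<bar> \<le> C * (1 / real (Suc j))" for j
    proof -
      \<comment> \<open>The change of variables by the bijection moves the defect of invariance from
        \<open>f\<close> to the density, where it is small.\<close>
      have "\<Phi> j f = (\<integral>x. p j (\<alpha> g x) * f (\<alpha> g x) \<partial>count_space X)"
        using f comp[of "\<lambda>x. p j x * f x"] by (simp add: \<Phi>_def)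
      then have "\<Phi> j (\<lambda>x. f (\<alpha> g x)) - \<Phi> j f = (\<integral>x. (p j x - p j (\<alpha> g x)) * f (\<alpha> g x) \<partial>count_space X)"
        using fg pf[OF fg] integrable_mult_bounded_fun[OF pg fg] by (simp add: \<Phi>_def left_diff_distrib)
      also have "\<bar>\<dots>\<bar> \<le> (\<integral>x. \<bar>(p j x - p j (\<alpha> g x)) * f (\<alpha> g x)\<bar> \<partial>count_space X)"
        by (rule integral_abs_bound)
      also have "\<dots> \<le> (\<integral>x. C * \<bar>p j (\<alpha> g x) - p j x\<bar> \<partial>count_space X)"
      proof (rule integral_mono)
        have "integrable (count_space X) (\<lambda>x. p j x - p j (\<alpha> g x))" using p(1) pg by simp
        from integrable_mult_bounded_fun[OF this fg]
        show "integrable (count_space X) (\<lambda>x. \<bar>(p j x - p j (\<alpha> g x)) * f (\<alpha> g x)\<bar>)" by simp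
        show "\<bar>(p j x - p j (\<alpha> g x)) * f (\<alpha> g x)\<bar> \<le> C * \<bar>p j (\<alpha> g x) - p j x\<bar>" for x
          using mult_right_mono[OF C[of "\<alpha> g x"], of "\<bar>p j (\<alpha> g x) - p j x\<bar>"]
          by (simp add: abs_mult abs_minus_commute mult.commute)
      qed (use p(1) pg in auto)
      also have "\<dots> = C * (\<integral>x. \<bar>p j (\<alpha> g x) - p j x\<bar> \<partial>count_space X)" by simp
      also have "\<dots> \<le> C * (1 / real (Suc j))"
        using p(4)[OF g] order_trans[OF abs_ge_zero C] by (intro mult_left_mono) auto
      finally show ?thesis .
    qed
    then have "norm (\<Phi> j (\<lambda>x. f (\<alpha> g x)) - \<Phi> j f) \<le> norm (1 / real (Suc j)) * C" for j
      by (simp add: mult.commute)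
    then have "(\<lambda>j. \<Phi> j (\<lambda>x. f (\<alpha> g x)) - \<Phi> j f) \<longlonglongrightarrow> 0"
      by (intro tendsto_0_le[OF LIMSEQ_Suc[OF lim_1_over_n]] always_eventually allI)
    then have "m (\<lambda>x. f (\<alpha> g x)) - m f = 0"
      by (intro transfer[where H = "\<lambda>\<phi>. \<phi> (\<lambda>x. f (\<alpha> g x)) - \<phi> f"] tendsto_diff lim)
    then show "m (\<lambda>x. f (\<alpha> g x)) = m f" by simp
  qed
  moreover have "m f = 0" if f: "bounded_fun f" "\<And>x. x \<in> X \<Longrightarrow> f x = 0" for f
  proof -
    have "(\<integral>x. p j x * f x \<partial>count_space X) = (\<integral>x. 0 \<partial>count_space X)" for j
      by (rule Bochner_Integration.integral_cong) (auto simp: f(2))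
    then have "\<Phi> j f = 0" for j using f(1) by (simp add: \<Phi>_def)
    then show ?thesis by (intro transfer[where H = "\<lambda>\<phi>. \<phi> f"] lim) simp
  qed
  ultimately show thesis by (rule that)
qed

section \<open>Means on lattice points and amenable factors\<close>

text \<open>The transposed lattice action extended to real vectors, so that spans and dimensions
  become available.\<close>

definition dual_act :: "int ^ 'n ^ 'n \<Rightarrow> real ^ 'n \<Rightarrow> real ^ 'n" where
  "dual_act g v = transpose (real_matrix g) *v v"

lemma linear_dual_act: "linear (dual_act g)"
  by (simp add: dual_act_def[abs_def] del: transpose_matrix_vector)

lemma of_int_vec_dual: "of_int_vec (transpose g *v k) = dual_act g (of_int_vec k)"
proof -
  have "real_matrix (transpose g) = transpose (real_matrix g)" by (simp add: vec_eq_iff transpose_def)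
  then show ?thesis by (simp add: dual_act_def of_int_vec_matrix_mult del: transpose_matrix_vector)
qed

lemma dual_act_one: "dual_act (mat 1) v = v"
  by (simp add: dual_act_def real_matrix_one del: transpose_matrix_vector)

text \<open>Transposition reverses products, so this is a right action; the order of factors in the
  orbit arguments below follows from it.\<close>

lemma dual_act_mult: "dual_act (g ** h) v = dual_act h (dual_act g v)"
  by (simp add: dual_act_def real_matrix_mult matrix_transpose_mul matrix_vector_mul_assoc del: transpose_matrix_vector)

lemma dual_mult: "transpose (g ** h) *v k = transpose h *v (transpose g *v (k :: int ^ 'n))"
  by (simp add: matrix_transpose_mul matrix_vector_mul_assoc del: transpose_matrix_vector)

text \<open>Invariance under an inverse comes from invariance under the element itself, applied to
  the function composed with the inverse.\<close>

lemma invariant_mean_generate: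
  fixes S :: "(int ^ 'n::finite ^ 'n) set"
  assumes S: "S \<subseteq> carrier GLZ" and m: "invariant_mean m S (\<lambda>g k. transpose g *v k)"
  shows "invariant_mean m (generate GLZ S) (\<lambda>g k. transpose g *v k)"
proof -
  interpret invariant_mean m S "\<lambda>g k. transpose g *v k" by (rule m)
  interpret GLZ: group "GLZ :: (int ^ 'n ^ 'n) monoid" by (rule group_GLZ)
  have "m (\<lambda>k. f (transpose g *v k)) = m f" if "g \<in> generate GLZ S" "bounded_fun f" for g f
    using that
  proof (induction arbitrary: f rule: generate.induct)
    case one
    then show ?case by (simp add: GLZ_def del: transpose_matrix_vector)
  next
    case (incl h)
    then show ?case by (intro mean_invariant)
  next
    case (inv h)
    have "h ** inv\<^bsub>GLZ\<^esub> h = mat 1" using GLZ.r_inv[of h] inv S by (auto simp: GLZ_def)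
    then have e: "transpose (inv\<^bsub>GLZ\<^esub> h) *v (transpose h *v k) = k" for k :: "int ^ 'n"
      unfolding dual_mult[symmetric] by (simp add: transpose_mat del: transpose_matrix_vector)
    have "m (\<lambda>k. f (transpose (inv\<^bsub>GLZ\<^esub> h) *v (transpose h *v k))) = m (\<lambda>k. f (transpose (inv\<^bsub>GLZ\<^esub> h) *v k))"
      by (rule mean_invariant[OF inv(1) bounded_fun_compose[OF inv(2)]])
    then show ?case unfolding e by simp
  next
    case (eng h1 h2)
    have "m (\<lambda>k. f (transpose (h1 ** h2) *v k)) = m (\<lambda>k. f (transpose h2 *v (transpose h1 *v k)))"
      unfolding dual_mult ..
    also have "\<dots> = m (\<lambda>k. f (transpose h2 *v k))"
      by (rule eng.IH(1)[OF bounded_fun_compose[OF eng.prems]])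
    also have "\<dots> = m f" by (rule eng.IH(2)[OF eng.prems])
    finally show ?case by (simp add: GLZ_def)
  qed
  then show ?thesis
    by unfold_locales (auto intro: mean_add mean_scale mean_nonneg mean_one)
qed

lemma span_insert_span:
  fixes a :: "'b::real_vector"
  shows "span (insert a (span A)) = span (insert a A)"
proof (rule antisym)
  show "span (insert a (span A)) \<subseteq> span (insert a A)"
    using span_mono[of A "insert a A"] by (intro span_minimal) (auto intro: span_base)
  show "span (insert a A) \<subseteq> span (insert a (span A))"
    using span_superset[of A] by (intro span_mono) auto
qed

text \<open>The point mass at the origin is invariant under every group of matrices;
  \<open>mean_at_0\<close> excludes it.\<close>

locale lattice_mean = invariant_mean m G "\<lambda>g k. transpose g *v k"
  for m :: "(int ^ 'n::finite \<Rightarrow> real) \<Rightarrow> real" and G +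
  assumes G: "subgroup G GLZ"
    and mean_at_0: "m (\<lambda>k. of_bool (k = 0)) = 0"
begin

interpretation GLZ: group "GLZ :: (int ^ 'n ^ 'n) monoid" by (rule group_GLZ)

text \<open>The finitely additive mass of a set of real vectors, counting its lattice
  points.\<close>

definition lattice_mass :: "(real ^ 'n) set \<Rightarrow> real" where
  "lattice_mass A = m (\<lambda>k. of_bool (of_int_vec k \<in> A))"

lemma lattice_mass_nonneg: "0 \<le> lattice_mass A"
  unfolding lattice_mass_def by (intro mean_nonneg) auto

lemma lattice_mass_mono: "A \<subseteq> B \<Longrightarrow> lattice_mass A \<le> lattice_mass B"
  unfolding lattice_mass_def by (intro mean_mono) auto

lemma lattice_mass_Diff: "lattice_mass (A - B) = lattice_mass A - lattice_mass (A \<inter> B)"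
proof -
  have "(\<lambda>k. of_bool (of_int_vec k \<in> A) :: real) = (\<lambda>k. of_bool (of_int_vec k \<in> A - B) + of_bool (of_int_vec k \<in> A \<inter> B))"
    by auto
  then show ?thesis
    unfolding lattice_mass_def by (simp only: mean_add[OF bounded_fun_of_bool bounded_fun_of_bool])
qed

lemma one_in_G: "mat 1 \<in> G"
  using subgroup.one_closed[OF G] by (simp add: GLZ_def)

lemma mult_in_G: "g \<in> G \<Longrightarrow> h \<in> G \<Longrightarrow> g ** h \<in> G"
  using subgroup.m_closed[OF G] by (simp add: GLZ_def)

lemma inverse_in_G:
  assumes "g \<in> G"
  obtains h where "h \<in> G" "g ** h = mat 1" "h ** g = mat 1"
proof -
  have c: "g \<in> carrier GLZ" using subgroup.subset[OF G] assms by blast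
  show thesis
  proof (rule that[of "inv\<^bsub>GLZ\<^esub> g"])
    show "inv\<^bsub>GLZ\<^esub> g \<in> G" using subgroup.m_inv_closed[OF G assms] .
  qed (use GLZ.r_inv[OF c] GLZ.l_inv[OF c] in \<open>auto simp: GLZ_def\<close>)
qed

lemma inj_dual_act:
  assumes "g \<in> G"
  shows "inj (dual_act g)"
proof -
  obtain h where h: "h \<in> G" "g ** h = mat 1" "h ** g = mat 1" using inverse_in_G[OF assms] .
  have "dual_act h (dual_act g v) = v" for v using h by (simp add: dual_act_mult[symmetric] dual_act_one)
  then show ?thesis by (metis injI)
qed

lemma lattice_mass_vimage: "g \<in> G \<Longrightarrow> lattice_mass (dual_act g -` A) = lattice_mass A"
  using mean_invariant[of g "\<lambda>k. of_bool (of_int_vec k \<in> A)"]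
  by (simp add: lattice_mass_def of_int_vec_dual del: transpose_matrix_vector)

lemma minimal_charged_subspace:
  obtains W where "subspace W" "0 < lattice_mass W"
    "\<And>A. subspace A \<Longrightarrow> A \<subset> W \<Longrightarrow> lattice_mass A = 0"
proof -
  have "subspace (UNIV :: (real ^ 'n) set) \<and> 0 < lattice_mass UNIV" by (simp add: lattice_mass_def mean_one)
  from ex_has_least_nat[of "\<lambda>W. subspace W \<and> 0 < lattice_mass W", OF this, of dim]
  obtain W where W: "subspace W" "0 < lattice_mass W"
    "\<And>A. subspace A \<Longrightarrow> 0 < lattice_mass A \<Longrightarrow> dim W \<le> dim A" by blast
  have "lattice_mass A = 0" if "subspace A" "A \<subset> W" for A
  proof (rule ccontr)
    assume "lattice_mass A \<noteq> 0"
    then have "0 < lattice_mass A" using lattice_mass_nonneg[of A] by simp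
    then have "dim W \<le> dim A" using W(3) that by blast
    then have "A = W" using subspace_dim_equal[OF that(1) W(1)] that by blast
    then show False using that by simp
  qed
  then show thesis using that W by blast
qed

definition list_span :: "(int ^ 'n) list \<Rightarrow> (real ^ 'n) set" where
  "list_span xs = span (of_int_vec ` set xs)"

text \<open>Each further random lattice point, with probability bounded below, stays in the invariant
  subspace and increases the span until the latter is exhausted.\<close>

lemma spanning_tuples:
  obtains U where "subspace U" "\<And>g v. g \<in> G \<Longrightarrow> v \<in> U \<Longrightarrow> dual_act g v \<in> U" "0 < lattice_mass U"
    "0 < iterated_mean (dim U) (\<lambda>xs. of_bool (list_span xs = U))"
proof -
  obtain W where W: "subspace W" "0 < lattice_mass W"
    "\<And>A. subspace A \<Longrightarrow> A \<subset> W \<Longrightarrow> lattice_mass A = 0" by (rule minimal_charged_subspace) blast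
  define U where "U = span (\<Union>g\<in>G. dual_act g ` W)"
  have U: "subspace U" by (simp add: U_def)
  have gW: "dual_act g ` W \<subseteq> U" if "g \<in> G" for g
    unfolding U_def using that by (auto intro: span_base)
  have WU: "W \<subseteq> U" using gW[OF one_in_G] by (auto simp: dual_act_one)
  have inv: "dual_act g v \<in> U" if g: "g \<in> G" and v: "v \<in> U" for g v
  proof -
    have "dual_act g ` U = span (dual_act g ` (\<Union>g\<in>G. dual_act g ` W))"
      unfolding U_def by (rule linear_span_image[OF linear_dual_act, symmetric])
    also have "dual_act g ` (\<Union>g\<in>G. dual_act g ` W) \<subseteq> (\<Union>g\<in>G. dual_act g ` W)"
      using mult_in_G[OF _ g] by (auto simp: dual_act_mult[symmetric] intro!: bexI[of _ "_ ** g"])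
    then have "span (dual_act g ` (\<Union>g\<in>G. dual_act g ` W)) \<subseteq> U"
      unfolding U_def by (rule span_mono)
    finally show ?thesis using v by blast
  qed
  define c where "c = lattice_mass W"
  have c: "0 < c" using W by (simp add: c_def)
  \<comment> \<open>Some translate of \<open>W\<close> is not contained in \<open>A\<close>. Pulled
    back, \<open>A\<close> meets \<open>W\<close> in a proper subspace, which is null by minimality,
    so the full mass of \<open>W\<close> is carried outside \<open>A\<close>. The bound
    \<open>c\<close> is the same for all \<open>A\<close>.\<close>
  have grow: "c \<le> lattice_mass (U - A)" if A: "subspace A" "\<not> U \<subseteq> A" for A
  proof -
    obtain g where g: "g \<in> G" "\<not> dual_act g ` W \<subseteq> A"
    proof -
      have "\<exists>g\<in>G. \<not> dual_act g ` W \<subseteq> A"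
      proof (rule ccontr)
        assume "\<not> (\<exists>g\<in>G. \<not> dual_act g ` W \<subseteq> A)"
        then have "(\<Union>g\<in>G. dual_act g ` W) \<subseteq> A" by blast
        then have "U \<subseteq> A" unfolding U_def using A(1) by (rule span_minimal)
        then show False using A(2) by simp
      qed
      then show thesis using that by blast
    qed
    have "lattice_mass (W - dual_act g -` A) = lattice_mass W - lattice_mass (W \<inter> dual_act g -` A)"
      by (rule lattice_mass_Diff)
    also have "lattice_mass (W \<inter> dual_act g -` A) = 0"
    proof (rule W(3))
      show "subspace (W \<inter> dual_act g -` A)"
        by (intro subspace_inter W(1) linear_subspace_vimage[OF linear_dual_act A(1)])
      show "W \<inter> dual_act g -` A \<subset> W" using g(2) by auto
    qed
    finally have "c = lattice_mass (W - dual_act g -` A)" by (simp add: c_def)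
    also have "\<dots> \<le> lattice_mass (dual_act g -` (U - A))"
      using gW[OF g(1)] by (intro lattice_mass_mono) auto
    also have "\<dots> = lattice_mass (U - A)" by (rule lattice_mass_vimage[OF g(1)])
    finally show ?thesis .
  qed
  have cU: "c \<le> lattice_mass U" unfolding c_def by (rule lattice_mass_mono[OF WU])
  \<comment> \<open>The prefix \<open>ys\<close> records the points already drawn. The claim also
    covers draws made after the span is full, so the number of draws need not depend on their
    outcome.\<close>
  have "c ^ n \<le> iterated_mean n (\<lambda>xs. of_bool (list_span (ys @ xs) = U))"
    if "list_span ys \<subseteq> U" "dim U \<le> dim (list_span ys) + n" for n ys
    using that
  proof (induction n arbitrary: ys)
    case 0
    have "list_span ys = U"
      by (rule subspace_dim_equal) (use 0 U in \<open>auto simp: list_span_def\<close>)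
    then show ?case by simp
  next
    case (Suc n)
    \<comment> \<open>The favourable values of the next draw: any point of \<open>U\<close> once the
      span is full, otherwise a point of \<open>U\<close> that enlarges it.\<close>
    define D where "D = (if list_span ys = U then U else U - list_span ys)"
    have DU: "D \<subseteq> U" by (auto simp: D_def)
    have "c \<le> lattice_mass D"
      using cU grow[of "list_span ys"] Suc.prems(1) by (auto simp: D_def list_span_def)
    have step: "c ^ n \<le> iterated_mean n (\<lambda>xs. of_bool (list_span (ys @ x # xs) = U))" if x: "of_int_vec x \<in> D" for x
    proof -
      have ins: "list_span (ys @ [x]) = span (insert (of_int_vec x) (list_span ys))"
        unfolding list_span_def by (simp add: span_insert_span)
      have "list_span (ys @ [x]) \<subseteq> U"
        unfolding ins using x DU Suc.prems(1) U by (intro span_minimal) auto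
      moreover have "dim U \<le> dim (list_span (ys @ [x])) + n"
      proof (cases "list_span ys = U")
        case True
        then have "list_span (ys @ [x]) = U"
          unfolding ins using x DU U by (simp add: insert_absorb subset_iff span_eq_iff)
        then show ?thesis by simp
      next
        case False
        then have "of_int_vec x \<notin> span (list_span ys)" using x by (simp add: D_def list_span_def span_span)
        then have "dim (list_span (ys @ [x])) = Suc (dim (list_span ys))"
          unfolding ins by (simp add: dim_insert)
        then show ?thesis using Suc.prems(2) by simp
      qed
      ultimately show ?thesis using Suc.IH[of "ys @ [x]"] by simp
    qed
    have "c ^ Suc n \<le> c ^ n * lattice_mass D"
      using \<open>c \<le> lattice_mass D\<close> c by (simp add: mult.commute mult_left_mono)
    also have "\<dots> = m (\<lambda>x. c ^ n * of_bool (of_int_vec x \<in> D))"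
      by (simp add: lattice_mass_def mean_scale)
    also have "\<dots> \<le> m (\<lambda>x. iterated_mean n (\<lambda>xs. of_bool (list_span (ys @ x # xs) = U)))"
    proof (rule mean_mono)
      show "bounded_fun (\<lambda>x. iterated_mean n (\<lambda>xs. of_bool (list_span (ys @ x # xs) = U)))"
        by (rule bounded_iterated_mean[where F = "\<lambda>xs. of_bool (list_span (ys @ xs) = U)"]) simp
      show "c ^ n * of_bool (of_int_vec x \<in> D) \<le> iterated_mean n (\<lambda>xs. of_bool (list_span (ys @ x # xs) = U))" for x
      proof (cases "of_int_vec x \<in> D")
        case False
        then show ?thesis
          using invariant_mean.mean_nonneg[OF iterated_mean_invariant_mean, of "\<lambda>xs. of_bool (list_span (ys @ x # xs) = U)" n]
          by simp
      qed (simp add: step)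
    qed (intro bounded_fun_mult, auto)
    finally show ?case by simp
  qed
  from this[of "[]" "dim U"] have "c ^ dim U \<le> iterated_mean (dim U) (\<lambda>xs. of_bool (list_span xs = U))"
    using subspace_0[OF U] by (simp add: list_span_def)
  then have "0 < iterated_mean (dim U) (\<lambda>xs. of_bool (list_span xs = U))"
    using zero_less_power[OF c, of "dim U"] by linarith
  then show thesis using that U inv cU c by fastforce
qed

text \<open>By linearity the action on spanning tuples is free up to elements acting trivially on
  the span.\<close>

lemma dual_act_eq_on_span:
  assumes "map (\<lambda>k. transpose g *v k) xs = map (\<lambda>k. transpose h *v k) xs" "v \<in> list_span xs"
  shows "dual_act g v = dual_act h v"
proof (rule linear_eq_on_span[OF linear_dual_act linear_dual_act])
  show "v \<in> span (of_int_vec ` set xs)" using assms(2) by (simp add: list_span_def)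
  show "dual_act g u = dual_act h u" if "u \<in> of_int_vec ` set xs" for u
    using that assms(1) by (auto simp: of_int_vec_dual[symmetric] simp del: transpose_matrix_vector)
qed

lemma list_span_map_dual:
  "list_span (map (\<lambda>k. transpose g *v k) xs) = dual_act g ` list_span xs"
proof -
  have "of_int_vec ` set (map (\<lambda>k. transpose g *v k) xs) = dual_act g ` of_int_vec ` set xs"
    by (auto simp: of_int_vec_dual[symmetric] image_image simp del: transpose_matrix_vector)
  then show ?thesis unfolding list_span_def by (simp only: linear_span_image[OF linear_dual_act])
qed

text \<open>The annihilator of the invariant subspace is the kernel of the factor. The automorphism
  that an element induces on the factor is determined by what it does to any spanning tuple, so the
  mean on spanning tuples can be transported to the group of these automorphisms along a choice of
  orbit representatives.\<close>

theorem amenable_factor: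
  shows "\<exists>H. invariant_factor_kernel G H \<and> H \<noteq> UNIV \<and> amenable (factor_projection G H)"
proof -
  obtain U where U: "subspace U" "\<And>g v. g \<in> G \<Longrightarrow> v \<in> U \<Longrightarrow> dual_act g v \<in> U" "0 < lattice_mass U"
    "0 < iterated_mean (dim U) (\<lambda>xs. of_bool (list_span xs = U))" by (rule spanning_tuples) blast
  define H where "H = {x :: 'n torus. \<forall>k. of_int_vec k \<in> U \<longrightarrow> chi k x = 1}"
  have closedH: "closed H"
  proof -
    have "H = (\<Inter>k\<in>{k. of_int_vec k \<in> U}. {x. chi k x = 1})" by (auto simp: H_def)
    then show ?thesis by (auto intro!: closed_INT closed_Collect_eq continuous_chi)
  qed
  have chi0: "chi k (0 :: 'n torus) = 1" for k
  proof -
    have "chi k (0 :: 'n torus) \<noteq> 0" using norm_chi[of k "0 :: 'n torus"] by (metis norm_zero zero_neq_one)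
    then show ?thesis using chi_add_right[of k "0 :: 'n torus" 0] by simp
  qed
  have add: "x + y \<in> H" if "x \<in> H" "y \<in> H" for x y using that by (simp add: H_def chi_add_right)
  have neg: "- x \<in> H" if "x \<in> H" for x using that by (simp add: H_def chi_uminus_right)
  have zero: "0 \<in> H" by (simp add: H_def chi0)
  interpret T: comm_group "torus_group :: 'n torus monoid" by (rule comm_group_torus_group)
  have inv: "inv\<^bsub>torus_group\<^esub> x = - x" for x :: "'n torus"
    by (rule T.inv_equality) (simp_all add: torus_group_def)
  have subH: "subgroup H torus_group"
    by (rule T.subgroupI) (use add neg zero inv in \<open>auto simp: torus_group_def\<close>)
  have actH: "torus_act g ` H \<subseteq> H" if "g \<in> G" for g
    using U(2)[OF that] by (auto simp: H_def chi_torus_act of_int_vec_dual simp del: transpose_matrix_vector)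
  have actH': "torus_act g ` H = H" if g: "g \<in> G" for g
  proof
    obtain h where h: "h \<in> G" "g ** h = mat 1" "h ** g = mat 1" using inverse_in_G[OF g] .
    show "H \<subseteq> torus_act g ` H"
    proof
      fix x assume "x \<in> H"
      then have "torus_act h x \<in> H" using actH[OF h(1)] by blast
      moreover have "torus_act g (torus_act h x) = x"
        unfolding torus_act_mult[symmetric] h(2) by (rule torus_act_one)
      ultimately show "x \<in> torus_act g ` H" by (metis imageI)
    qed
  qed (rule actH[OF g])
  have ker: "invariant_factor_kernel G H"
    using closedH subH actH' by (simp add: invariant_factor_kernel_def)
  \<comment> \<open>The mean charges \<open>U\<close> but not the origin, so \<open>U\<close>
    contains a nonzero lattice point, and its character is not constant.\<close>
  have proper: "H \<noteq> UNIV"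
  proof
    assume HU: "H = UNIV"
    obtain k where k: "k \<noteq> 0" "of_int_vec k \<in> U"
    proof -
      have "\<exists>k. k \<noteq> 0 \<and> of_int_vec k \<in> U"
      proof (rule ccontr)
        assume no: "\<nexists>k. k \<noteq> 0 \<and> of_int_vec k \<in> U"
        have "lattice_mass U \<le> m (\<lambda>k. of_bool (k = 0))"
          unfolding lattice_mass_def using no by (intro mean_mono) auto
        then show False using U(3) mean_at_0 by simp
      qed
      then show thesis using that by blast
    qed
    have "chi k x = 1" for x :: "'n torus" using HU k by (auto simp: H_def)
    then have "chi k = (\<lambda>x :: 'n torus. 1)" by auto
    then have "(\<integral>\<^sub>T x. chi k x) = 1" by simp
    then show False using k integral_chi[of k] by simp
  qed
  let ?Q = "factor_projection G H"
  let ?F = "factor_aut H"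
  have Q: "group ?Q"
    unfolding factor_projection_def
    by (intro subgroup.subgroup_is_group subgroup_factor_projection G ker group.AutoGroup normal.factorgroup_is_group)
      (rule T.subgroup_imp_normal[OF subH])
  interpret Q: group ?Q by (rule Q)
  have carQ: "carrier ?Q = ?F ` G" by (simp add: factor_projection_def)
  have cosets: "carrier (torus_group Mod H) = range (\<lambda>a. (\<lambda>h. h + a) ` H)"
    by (auto simp: FactGroup_def RCOSETS_def r_coset_def torus_group_def)
  have Bij: "?F g \<in> Bij (carrier (torus_group Mod H))" if "g \<in> G" for g
  proof -
    have "?F g \<in> carrier (AutoGroup (torus_group Mod H))"
      using subgroup.subset[OF subgroup_factor_projection[OF G ker]] that by blast
    then show ?thesis by (simp add: AutoGroup_def auto_def)
  qed
  have mult: "?F g \<otimes>\<^bsub>?Q\<^esub> ?F h = ?F (g ** h)" if "g \<in> G" "h \<in> G" for g h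
  proof -
    have "?F h C \<in> carrier (torus_group Mod H)" if "C \<in> carrier (torus_group Mod H)" for C
      using Bij[OF \<open>h \<in> G\<close>] that by (auto simp: Bij_def bij_betw_def)
    then have "compose (carrier (torus_group Mod H)) (?F g) (?F h) = ?F (g ** h)"
      by (auto simp: fun_eq_iff compose_def factor_aut_def restrict_def torus_act_mult image_image)
    then show ?thesis using Bij that by (simp add: factor_projection_def AutoGroup_def BijGroup_def)
  qed
  \<comment> \<open>Agreement on \<open>U\<close> makes every character with frequency in
    \<open>U\<close> trivial on \<open>torus_act g a - torus_act h a\<close>, so both elements send
    each coset of \<open>H\<close> to the same coset.\<close>
  have F_eq: "?F g = ?F h" if g: "g \<in> G" and h: "h \<in> G" and eq: "\<And>v. v \<in> U \<Longrightarrow> dual_act g v = dual_act h v" for g h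
  proof -
    have coset: "torus_act g ` ((\<lambda>h. h + a) ` H) = (\<lambda>h. h + torus_act g a) ` H" if "g \<in> G" for g a
    proof -
      have "torus_act g ` ((\<lambda>h. h + a) ` H) = (\<lambda>h. h + torus_act g a) ` (torus_act g ` H)"
        by (auto simp: image_image torus_act_add)
      then show ?thesis using actH'[OF that] by simp
    qed
    have "torus_act g a - torus_act h a \<in> H" for a
    proof -
      have "chi k (torus_act g a + - torus_act h a) = 1" if "of_int_vec k \<in> U" for k
      proof -
        have "of_int_vec (transpose g *v k) = (of_int_vec (transpose h *v k) :: real ^ 'n)"
          using eq[OF that] by (simp add: of_int_vec_dual del: transpose_matrix_vector)
        then have eq': "transpose g *v k = transpose h *v k" by (simp add: vec_eq_iff)
        show ?thesis
          unfolding chi_add_right chi_uminus_right chi_torus_act eq'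
          using complex_norm_square[of "chi (transpose h *v k) a"]
          by (simp del: transpose_matrix_vector)
      qed
      then show ?thesis by (simp add: H_def)
    qed
    then have d: "torus_act g a - torus_act h a \<in> H" "torus_act h a - torus_act g a \<in> H" for a
      using neg[of "torus_act g a - torus_act h a"] by auto
    have same: "(\<lambda>x. x + torus_act g a) ` H = (\<lambda>x. x + torus_act h a) ` H" for a
    proof (intro equalityI image_subsetI)
      fix x assume "x \<in> H"
      then have "x + (torus_act g a - torus_act h a) \<in> H" "x + (torus_act h a - torus_act g a) \<in> H"
        using d add by blast+
      then show "x + torus_act g a \<in> (\<lambda>x. x + torus_act h a) ` H" "x + torus_act h a \<in> (\<lambda>x. x + torus_act g a) ` H"
        by - (rule image_eqI[rotated], assumption, simp)+
    qed
    have "torus_act g ` C = torus_act h ` C" if C0: "C \<in> carrier (torus_group Mod H)" for C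
    proof -
      obtain a where C: "C = (\<lambda>h. h + a) ` H" using C0 by (auto simp: cosets)
      show ?thesis unfolding C coset[OF g] coset[OF h] by (rule same)
    qed
    then show ?thesis by (auto simp: factor_aut_def restrict_def fun_eq_iff)
  qed
  define act where "act g = map (\<lambda>k. transpose g *v k)" for g :: "int ^ 'n ^ 'n"
  define E where "E xs \<longleftrightarrow> list_span xs = U" for xs
  have act_mult: "act (g ** h) xs = act h (act g xs)" for g h xs
    by (simp add: act_def dual_mult del: transpose_matrix_vector)
  have act_one: "act (mat 1) xs = xs" by (simp add: act_def transpose_mat del: transpose_matrix_vector)
  have gU: "dual_act g ` U = U" if g: "g \<in> G" for g
  proof
    obtain h where h: "h \<in> G" "g ** h = mat 1" "h ** g = mat 1" using inverse_in_G[OF g] .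
    show "U \<subseteq> dual_act g ` U"
    proof
      fix v assume "v \<in> U"
      then have "dual_act h v \<in> U" by (rule U(2)[OF h(1)])
      moreover have "dual_act g (dual_act h v) = v"
        unfolding dual_act_mult[symmetric] h(3) by (rule dual_act_one)
      ultimately show "v \<in> dual_act g ` U" by (metis imageI)
    qed
  qed (use U(2)[OF g] in blast)
  have E_act: "E (act g xs) \<longleftrightarrow> E xs" if g: "g \<in> G" for g xs
  proof -
    have "list_span (act g xs) = dual_act g ` list_span xs" unfolding act_def by (rule list_span_map_dual)
    then show ?thesis
      using gU[OF g] inj_image_eq_iff[OF inj_dual_act[OF g], of "list_span xs" U] by (simp add: E_def)
  qed
  define orb where "orb xs = (\<lambda>g. act g xs) ` G" for xs
  have orb_act: "orb (act g xs) = orb xs" if g: "g \<in> G" for g xs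
  proof
    show "orb (act g xs) \<subseteq> orb xs"
      using mult_in_G[OF g] by (auto simp: orb_def act_mult[symmetric])
    obtain h where h: "h \<in> G" "g ** h = mat 1" "h ** g = mat 1" using inverse_in_G[OF g] .
    have undo: "act a xs = act (h ** a) (act g xs)" for a
      unfolding act_mult[symmetric] matrix_mul_assoc h(2) by simp
    show "orb xs \<subseteq> orb (act g xs)"
      unfolding orb_def
    proof (rule image_subsetI)
      fix a assume "a \<in> G"
      then show "act a xs \<in> (\<lambda>a. act a (act g xs)) ` G"
        unfolding undo[of a] by (intro imageI mult_in_G h(1))
    qed
  qed
  \<comment> \<open>The choice depends on the tuple only through its orbit, so it is constant along
    orbits.\<close>
  define rep where "rep xs = (SOME ys. ys \<in> orb xs)" for xs
  define \<gamma> where "\<gamma> xs = (SOME g. g \<in> G \<and> act g xs = rep xs)" for xs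
  have \<gamma>: "\<gamma> xs \<in> G \<and> act (\<gamma> xs) xs = rep xs" for xs
  proof -
    have "orb xs \<noteq> {}" using one_in_G by (auto simp: orb_def)
    then have "rep xs \<in> orb xs" unfolding rep_def by (simp add: some_in_eq)
    then obtain g where "rep xs = act g xs" "g \<in> G" unfolding orb_def by (rule imageE)
    then have "\<exists>g. g \<in> G \<and> act g xs = rep xs" by (intro exI[of _ g]) simp
    then show ?thesis unfolding \<gamma>_def by (rule someI_ex)
  qed
  define \<psi> where "\<psi> xs = ?F (\<gamma> xs)" for xs
  have \<psi>Q: "\<psi> xs \<in> carrier ?Q" for xs using \<gamma> by (simp add: \<psi>_def carQ)
  \<comment> \<open>Both \<open>\<gamma> xs\<close> and \<open>g ** \<gamma> (act g xs)\<close>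
    carry \<open>xs\<close> to the common representative. They may differ as matrices, but on a
    spanning tuple they induce the same automorphism of the factor.\<close>
  have \<psi>_act: "\<psi> xs = ?F g \<otimes>\<^bsub>?Q\<^esub> \<psi> (act g xs)" if g: "g \<in> G" and xs: "E xs" for g xs
  proof -
    have "act (g ** \<gamma> (act g xs)) xs = rep (act g xs)" using \<gamma>[of "act g xs"] by (simp add: act_mult)
    also have "rep (act g xs) = rep xs" by (simp add: rep_def orb_act[OF g])
    also have "\<dots> = act (\<gamma> xs) xs" using \<gamma>[of xs] by simp
    finally have eq: "act (g ** \<gamma> (act g xs)) xs = act (\<gamma> xs) xs" .
    define b where "b = \<gamma> (act g xs)"
    have "?F (g ** \<gamma> (act g xs)) = ?F (\<gamma> xs)"
    proof (rule F_eq)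
      show "g ** \<gamma> (act g xs) \<in> G" using g \<gamma> by (intro mult_in_G) auto
      show "\<gamma> xs \<in> G" using \<gamma> by simp
      show "dual_act (g ** \<gamma> (act g xs)) v = dual_act (\<gamma> xs) v" if "v \<in> U" for v
        unfolding b_def[symmetric]
        by (rule dual_act_eq_on_span[OF eq[folded b_def, unfolded act_def]]) (use that xs in \<open>simp add: E_def\<close>)
    qed
    then show ?thesis using mult[OF g] \<gamma> by (simp add: \<psi>_def)
  qed
  interpret L: invariant_mean "iterated_mean (dim U)" G "\<lambda>g. map (\<lambda>k. transpose g *v k)"
    by (rule iterated_mean_invariant_mean)
  define z where "z = iterated_mean (dim U) (\<lambda>xs. of_bool (E xs))"
  have z: "z > 0" using U(4) by (simp add: z_def E_def)
  \<comment> \<open>The law of \<open>\<psi>\<close> conditioned on the tuple spanning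
    \<open>U\<close>, an event of positive mean.\<close>
  define \<nu> where "\<nu> A = iterated_mean (dim U) (\<lambda>xs. of_bool (E xs \<and> \<psi> xs \<in> A)) / z" for A
  have "amenable ?Q"
    unfolding amenable_def
  proof (intro exI[of _ \<nu>] conjI allI ballI impI)
    show "0 \<le> \<nu> A" for A
      unfolding \<nu>_def using z by (intro divide_nonneg_pos L.mean_nonneg) auto
    show "\<nu> (carrier ?Q) = 1"
      using z by (simp add: \<nu>_def \<psi>Q z_def)
  next
    fix A B assume "A \<inter> B = ({} :: ('n torus set \<Rightarrow> 'n torus set) set)"
    then have "(\<lambda>xs. of_bool (E xs \<and> \<psi> xs \<in> A \<union> B) :: real)
       = (\<lambda>xs. of_bool (E xs \<and> \<psi> xs \<in> A) + of_bool (E xs \<and> \<psi> xs \<in> B))"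
      by (auto simp: fun_eq_iff)
    then show "\<nu> (A \<union> B) = \<nu> A + \<nu> B"
      unfolding \<nu>_def by (simp only: L.mean_add[OF bounded_fun_of_bool bounded_fun_of_bool] add_divide_distrib)
  next
    fix q A assume q: "q \<in> carrier ?Q" and A: "A \<subseteq> carrier ?Q"
    then obtain g where g: "g \<in> G" "q = ?F g" by (auto simp: carQ)
    \<comment> \<open>Left translation by \<open>q\<close> becomes the diagonal action of
      \<open>g\<close> on tuples, under which the iterated mean and the spanning event are
      invariant.\<close>
    have "E xs \<and> \<psi> xs \<in> q <#\<^bsub>?Q\<^esub> A \<longleftrightarrow> E (act g xs) \<and> \<psi> (act g xs) \<in> A" for xs
    proof (cases "E xs")
      case True
      have "\<psi> xs \<in> q <#\<^bsub>?Q\<^esub> A \<longleftrightarrow> (\<exists>a\<in>A. q \<otimes>\<^bsub>?Q\<^esub> \<psi> (act g xs) = q \<otimes>\<^bsub>?Q\<^esub> a)"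
        using \<psi>_act[OF g(1) True] by (auto simp: l_coset_def g(2))
      also have "\<dots> \<longleftrightarrow> \<psi> (act g xs) \<in> A"
        using Q.Units_l_cancel[of q "\<psi> (act g xs)"] q \<psi>Q A by (auto simp: Q.Units_eq subset_iff)
      finally show ?thesis using True E_act[OF g(1)] by simp
    qed (simp add: E_act[OF g(1)])
    then have "\<nu> (q <#\<^bsub>?Q\<^esub> A) = iterated_mean (dim U) (\<lambda>xs. of_bool (E (act g xs) \<and> \<psi> (act g xs) \<in> A)) / z"
      unfolding \<nu>_def by simp
    also have "\<dots> = \<nu> A"
      unfolding \<nu>_def act_def
      by (subst L.mean_invariant[OF g(1), of "\<lambda>xs. of_bool (E xs \<and> \<psi> xs \<in> A)"]) simp_all
    finally show "\<nu> (q <#\<^bsub>?Q\<^esub> A) = \<nu> A" .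
  qed
  then show ?thesis using ker proper by blast
qed

end

section \<open>Spectral gap and proof of the limit theorem\<close>

lemma finite_bounded_int_matrices:
  fixes A :: "(int ^ 'n ^ 'm) set"
  assumes "bounded (real_matrix ` A)"
  shows "finite A"
proof -
  obtain C where C: "\<And>g. g \<in> A \<Longrightarrow> norm (real_matrix g) \<le> C"
    using assms by (auto simp: bounded_iff)
  have "g $ i $ j \<in> {- \<lceil>C\<rceil>..\<lceil>C\<rceil>}" if "g \<in> A" for g i j
  proof -
    have "\<bar>real_matrix g $ i $ j\<bar> \<le> norm (real_matrix g)"
      by (rule order_trans[OF component_le_norm_cart Finite_Cartesian_Product.norm_nth_le])
    then have "\<bar>real_of_int (g $ i $ j)\<bar> \<le> C" using C[OF that] by simp
    then show ?thesis by (simp add: abs_le_iff le_ceiling_iff minus_le_iff) linarith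
  qed
  then have "(\<lambda>g (i, j). g $ i $ j) ` A \<subseteq> PiE UNIV (\<lambda>_. {- \<lceil>C\<rceil>..\<lceil>C\<rceil>})" by auto
  then have "finite ((\<lambda>g (i, j). g $ i $ j) ` A)"
    by (rule finite_subset) (intro finite_PiE, auto)
  moreover have "inj_on (\<lambda>g (i, j). g $ i $ j) A"
    by (auto simp: inj_on_def fun_eq_iff vec_eq_iff)
  ultimately show ?thesis by (rule finite_imageD)
qed

lemma (in torus_walk) spectral_gap:
  assumes no_factor: "\<not> (\<exists>H. invariant_factor_kernel (generate GLZ S) H \<and> H \<noteq> UNIV \<and>
    amenable (factor_projection (generate GLZ S) H))"
  obtains C \<theta> where "0 < C" "0 < \<theta>" "\<theta> < 1"
    "\<And>t a. F.square_integrable a \<Longrightarrow> F.energy ((F.average ^^ t) a) \<le> C * \<theta> ^ t * F.energy a"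
proof (rule F.spectral_gap_or_almost_invariant)
  have SG: "S \<subseteq> carrier GLZ" using GLZ by (auto simp: GLZ_def)
  show "\<not> (\<forall>e>0. \<exists>p :: int ^ 'n \<Rightarrow> real. integrable (count_space (- {0})) p \<and> (\<forall>k. 0 \<le> p k) \<and>
    (\<integral>k. p k \<partial>count_space (- {0})) = 1 \<and>
    (\<forall>g\<in>S. (\<integral>k. \<bar>p (transpose g *v k) - p k\<bar> \<partial>count_space (- {0})) \<le> e))"
  proof
    assume approx: "\<forall>e>0. \<exists>p :: int ^ 'n \<Rightarrow> real. integrable (count_space (- {0})) p \<and> (\<forall>k. 0 \<le> p k) \<and>
      (\<integral>k. p k \<partial>count_space (- {0})) = 1 \<and>
      (\<forall>g\<in>S. (\<integral>k. \<bar>p (transpose g *v k) - p k\<bar> \<partial>count_space (- {0})) \<le> e)"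
    obtain m where m: "invariant_mean m S (\<lambda>g k. transpose g *v k)"
      "\<And>f. bounded_fun f \<Longrightarrow> (\<And>k. k \<in> - {0} \<Longrightarrow> f k = 0) \<Longrightarrow> m f = 0"
    proof (rule invariant_mean_of_almost_invariant[of S "\<lambda>g k. transpose g *v k" "- {0 :: int ^ 'n}"])
      show "bij_betw (\<lambda>k. transpose g *v k) (- {0}) (- {0})" if "g \<in> S" for g
        using GLZ[OF that] by (rule bij_transpose_mult)
    qed (use approx in blast)+
    interpret invariant_mean m "generate GLZ S" "\<lambda>g k. transpose g *v k"
      by (rule invariant_mean_generate[OF SG m(1)])
    interpret lattice_mean m "generate GLZ S"
    proof (intro lattice_mean.intro lattice_mean_axioms.intro)
      show "invariant_mean m (generate GLZ S) (\<lambda>g k. transpose g *v k)" by (rule invariant_mean_axioms)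
      show "subgroup (generate GLZ S) GLZ" by (rule group.generate_is_subgroup[OF group_GLZ SG])
      \<comment> \<open>The approximating densities live off the origin, so their cluster point
        gives it no mass.\<close>
      show "m (\<lambda>k. of_bool (k = 0)) = 0" by (rule m(2)) auto
    qed
    show False using amenable_factor no_factor by blast
  qed
qed (rule that)

theorem theorem1p1:
  fixes \<mu> :: "(int ^ 'n ^ 'n) pmf" and r :: real
  assumes aut: "set_pmf \<mu> \<subseteq> carrier GLZ"
    and no_amenable_factor:
      "\<not> (\<exists>H. invariant_factor_kernel (generate GLZ (set_pmf \<mu>)) H \<and> H \<noteq> UNIV \<and>
              amenable (factor_projection (generate GLZ (set_pmf \<mu>)) H))"
    and bounded_support: "bounded (real_matrix ` set_pmf \<mu>)"
    and det_nz: "\<forall>g \<in> semigroup_generated (set_pmf \<mu>). det (g - mat 1) \<noteq> 0"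
  shows "AE x\<^sub>0 in torus_measure.
    (\<lambda>n. measure (walk_measure \<mu>)
           {\<omega> \<in> space (walk_measure \<mu>).
              walk_max x\<^sub>0 n \<omega> \<le> ereal (r + 1 / real CARD('n) * ln (real n))})
      \<longlonglongrightarrow> exp (- (measure lborel (ball (0 :: real ^ 'n) 1) * exp (- (real CARD('n) * r))))"
proof -
  have fin: "finite (set_pmf \<mu>)" by (rule finite_bounded_int_matrices[OF bounded_support])
  have GL: "det g = 1 \<or> det g = - 1" if "g \<in> set_pmf \<mu>" for g
    using aut that by (auto simp: GLZ_def)
  interpret W: torus_walk "set_pmf \<mu>" "pmf \<mu>"
  proof
    show "(\<Sum>g\<in>set_pmf \<mu>. pmf \<mu> g) = 1" by (rule sum_pmf_eq_1[OF fin]) simp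
  qed (use fin GL in \<open>auto simp: pmf_positive\<close>)
  obtain C \<theta> where gap: "0 < C" "0 < \<theta>" "\<theta> < 1"
    "\<And>t a. W.F.square_integrable a \<Longrightarrow> W.F.energy ((W.F.average ^^ t) a) \<le> C * \<theta> ^ t * W.F.energy a"
    by (rule W.spectral_gap[OF no_amenable_factor]) blast
  \<comment> \<open>The semigroup is countable, so the null sets of fixed points can be united into
    one.\<close>
  have "AE x\<^sub>0 in torus_measure. \<forall>h\<in>semigroup_generated (set_pmf \<mu>). torus_act h x\<^sub>0 \<noteq> x\<^sub>0"
    using det_nz by (intro AE_ball_countable' AE_torus_act_neq) auto
  then show ?thesis
  proof eventually_elim
    case (elim x\<^sub>0)
    let ?u = "\<lambda>n. r + 1 / real CARD('n) * ln (real n)"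
    let ?B = "\<lambda>n. {x. dist x x\<^sub>0 < exp (- ?u n)}"
    have "(\<lambda>n. \<integral>\<^sub>T x. W.avoid (?B n) n x)
      \<longlonglongrightarrow> exp (- (measure lborel (ball (0 :: real ^ 'n) 1) * exp (- (real CARD('n) * r))))"
      using elim by (intro W.extreme_value_limit[OF gap(4) gap(1-3)]) auto
    moreover have "\<forall>\<^sub>F n in sequentially. (\<integral>\<^sub>T x. W.avoid (?B n) n x)
      = measure (walk_measure \<mu>) {\<omega> \<in> space (walk_measure \<mu>). walk_max x\<^sub>0 n \<omega> \<le> ereal (?u n)}"
      using eventually_ge_at_top[of 1]
    proof eventually_elim
      case (elim n)
      have B: "?B n \<in> sets borel"
        by (intro borel_open) (auto intro!: open_Collect_less continuous_intros)
      show ?case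
        unfolding walk_max_le_iff[OF elim] by (rule measure_walk_avoid[OF fin GL B, symmetric])
    qed
    ultimately show ?case by (rule Lim_transform_eventually)
  qed
qed

end
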